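(* Let $Z$ be an $\mathbb R^m$-valued Lévy process with characteristic exponent $\psi$, let $\Phi:\mathbb R^d\to\mathbb R^{d\times m}$ be admissible, finely continuous and locally bounded, and let $X$ be the solution of $dX_t^x=\Phi(X_{t-}^x)\,dZ_t$, $X_0^x=x$ ($x\in\mathbb R^d$). Suppose there exists an $x_0\in\mathbb R^d$ such that the mapping $\mathbb R^d\ni\xi\mapsto\Phi(x_0)'\xi\in\mathbb R^m$ is surjective. Assume that both $\psi$ and $\Phi$ are unbounded, but $\beta_\infty^{unif}(X)<+\infty$. Then $$\beta_\infty^{unif,1}(X)=\beta_\infty^{unif}(X)=\beta_1(Z).$$
   Context: $'$ denotes transposition. $\psi:\mathbb R^m\to\mathbb C$ is given by $\mathbb E e^{iy'Z_t}=e^{-t\psi(y)}$. $\Phi$ is admissible if the SDE admits a unique conservative solution for every starting point. $\Phi$ is finely continuous if $\Phi\circ X$ is a.s. right continuous for every starting point. Under these assumptions $X$ is a Lévy-type process (a Hunt semimartingale with characteristics of the form $B_t=\int_0^t\ell(X_s)ds$, $C_t=\int_0^tQ(X_s)ds$, $\nu(ds,dy)=N(X_s,dy)ds$), and its symbol $$q(x,\xi):=-\lim_{t\downarrow0}\mathbb E^x\frac{e^{i(X_{t\wedge\sigma}-x)'\xi}-1}{t}$$ ($\sigma$ the first exit time from a compact neighbourhood of $x$, the limit not depending on the neighbourhood) exists and is given by $q(x,\xi)=\psi(\Phi(x)'\xi)$. For $x\in\mathbb R^d$, $R>0$ put $H(x,R):=\sup_{\|y-x\|\le2R}\sup_{\|\varepsilon\|\le1}|q(y,\varepsilon/R)|$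 and $H(R):=\sup_{x\in\mathbb R^d}H(x,R)=\sup_{y\in\mathbb R^d}\sup_{\|\varepsilon\|\le1}|q(y,\varepsilon/R)|$ (values in $[0,\infty]$). Then $$\beta_\infty^{unif}(X):=\inf\{\lambda>0:\limsup_{R\to0+}R^\lambda H(R)=0\},\qquad \beta_\infty^{unif,1}(X):=\sup_{x\in\mathbb R^d}\inf\{\lambda>0:\limsup_{R\to0+}R^\lambda H(x,R)=0\},$$ with $\inf\emptyset=+\infty$, and $\beta_1(Z):=\inf\{\alpha>0:\lim_{\|y\|\to\infty}\|y\|^{-\alpha}|\psi(y)|=0\}$. *)

theory Defs
  imports "HOL-Probability.Probability"
begin

section \<open>Stochastic basis, Levy processes\<close>

text \<open>The time set is $[0,\infty)$, represented by the nonnegative reals. Only the values at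
  times $t \ge 0$ of a process or of a filtration matter; a filtration on $[0,\infty)$ is thought
  of as extended by $F_t = F_0$ for $t < 0$, so that the library notions \<open>filtration\<close> and
  \<open>stopping_time\<close> apply.\<close>

text \<open>Filtered probability space satisfying the usual conditions.\<close>

definition stochastic_basis :: "'w measure \<Rightarrow> (real \<Rightarrow> 'w measure) \<Rightarrow> bool" where
  "stochastic_basis M F \<longleftrightarrow>
     prob_space M \<and> complete_measure M \<and> filtration (space M) F \<and>
     (\<forall>t. subalgebra M (F t)) \<and>
     null_sets M \<subseteq> sets (F 0) \<and>
     (\<forall>t\<ge>0. sets (F t) = (\<Inter>s\<in>{t<..}. sets (F s)))"

definition adapted :: "(real \<Rightarrow> 'w measure) \<Rightarrow> (real \<Rightarrow> 'w \<Rightarrow> 'b::topological_space) \<Rightarrow> bool" where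
  "adapted F X \<longleftrightarrow> (\<forall>t\<ge>0. X t \<in> borel_measurable (F t))"

definition cadlag :: "(real \<Rightarrow> 'b::topological_space) \<Rightarrow> bool" where
  "cadlag f \<longleftrightarrow> (\<forall>t\<ge>0. continuous (at_right t) f) \<and> (\<forall>t>0. \<exists>l. (f \<longlongrightarrow> l) (at_left t))"

definition indistinguishable ::
    "'w measure \<Rightarrow> (real \<Rightarrow> 'w \<Rightarrow> 'b) \<Rightarrow> (real \<Rightarrow> 'w \<Rightarrow> 'b) \<Rightarrow> bool" where
  "indistinguishable M X Y \<longleftrightarrow> (AE \<omega> in M. \<forall>t\<ge>0. X t \<omega> = Y t \<omega>)"

text \<open>Stochastic continuity is not listed, since it follows from stationarity of the increments
  and right continuity at $0$.\<close>

definition levy_process ::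
    "'w measure \<Rightarrow> (real \<Rightarrow> 'w measure) \<Rightarrow> (real \<Rightarrow> 'w \<Rightarrow> real ^ 'm) \<Rightarrow> bool" where
  "levy_process M F Z \<longleftrightarrow>
     adapted F Z \<and>
     (AE \<omega> in M. Z 0 \<omega> = 0) \<and>
     (AE \<omega> in M. cadlag (\<lambda>t. Z t \<omega>)) \<and>
     (\<forall>s t. 0 \<le> s \<longrightarrow> s \<le> t \<longrightarrow>
        prob_space.indep_set M (sets (F s))
          {(\<lambda>\<omega>. Z t \<omega> - Z s \<omega>) -` B \<inter> space M | B. B \<in> sets borel}) \<and>
     (\<forall>s t. 0 \<le> s \<longrightarrow> s \<le> t \<longrightarrow>
        distr M borel (\<lambda>\<omega>. Z t \<omega> - Z s \<omega>) = distr M borel (Z (t - s)))"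

text \<open>As the identity is required for all $t \ge 0$, it determines $\psi$ uniquely.\<close>

definition characteristic_exponent ::
    "'w measure \<Rightarrow> (real \<Rightarrow> 'w \<Rightarrow> real ^ 'm) \<Rightarrow> (real ^ 'm \<Rightarrow> complex) \<Rightarrow> bool" where
  "characteristic_exponent M Z \<psi> \<longleftrightarrow>
     (\<forall>t\<ge>0. \<forall>y. (LINT \<omega>|M. iexp (y \<bullet> Z t \<omega>)) = exp (- (complex_of_real t * \<psi> y)))"

section \<open>The stochastic integral\<close>

text \<open>Elementary predictable integrands
  $H = \sum_{k<n} A_k 1_{(\tau_k,\tau_{k+1}]}$ with values in the $d \times m$ matrices,
  and their integrals.\<close>

definition elementary_integrand ::
    "nat \<Rightarrow> (nat \<Rightarrow> real) \<Rightarrow> (nat \<Rightarrow> 'w \<Rightarrow> real ^ 'm ^ 'd) \<Rightarrow> real \<Rightarrow> 'w \<Rightarrow> real ^ 'm ^ 'd" where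
  "elementary_integrand n \<tau> A t \<omega> = (\<Sum>k<n. if \<tau> k < t \<and> t \<le> \<tau> (Suc k) then A k \<omega> else 0)"

definition elementary_integral ::
    "(real \<Rightarrow> 'w \<Rightarrow> real ^ 'm) \<Rightarrow> nat \<Rightarrow> (nat \<Rightarrow> real) \<Rightarrow> (nat \<Rightarrow> 'w \<Rightarrow> real ^ 'm ^ 'd) \<Rightarrow>
      real \<Rightarrow> 'w \<Rightarrow> real ^ 'd" where
  "elementary_integral Z n \<tau> A t \<omega> =
     (\<Sum>k<n. A k \<omega> *v (Z (min t (\<tau> (Suc k))) \<omega> - Z (min t (\<tau> k)) \<omega>))"

text \<open>Uniform convergence on compacts in probability.\<close>

definition ucp_tendsto ::
    "'w measure \<Rightarrow> (nat \<Rightarrow> real \<Rightarrow> 'w \<Rightarrow> 'b::real_normed_vector) \<Rightarrow> (real \<Rightarrow> 'w \<Rightarrow> 'b) \<Rightarrow> bool" where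
  "ucp_tendsto M Y Y' \<longleftrightarrow>
     (\<forall>t\<ge>0. \<forall>e>0.
        (\<lambda>n. measure M {\<omega> \<in> space M. \<exists>s\<in>{0..t}. norm (Y n s \<omega> - Y' s \<omega>) > e}) \<longlonglongrightarrow> 0)"

text \<open>Local uniform boundedness of a sequence of integrands, along a localizing sequence of
  stopping times.\<close>

definition locally_uniformly_bounded ::
    "'w measure \<Rightarrow> (real \<Rightarrow> 'w measure) \<Rightarrow> (nat \<Rightarrow> real \<Rightarrow> 'w \<Rightarrow> 'b::real_normed_vector) \<Rightarrow> bool" where
  "locally_uniformly_bounded M F H \<longleftrightarrow>
     (\<exists>(T :: nat \<Rightarrow> 'w \<Rightarrow> real) (c :: nat \<Rightarrow> real).
        (\<forall>k. stopping_time F (T k)) \<and> (\<forall>k \<omega>. 0 \<le> T k \<omega>) \<and>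
        (AE \<omega> in M. incseq (\<lambda>k. T k \<omega>) \<and> filterlim (\<lambda>k. T k \<omega>) at_top sequentially) \<and>
        (AE \<omega> in M. \<forall>k n t. 0 < t \<and> t \<le> T k \<omega> \<longrightarrow> norm (H n t \<omega>) \<le> c k))"

text \<open>\<open>stochastic_integral M F Z H Y\<close> means that $Y = \int_0^{\cdot} H_s\,dZ_s$ up to
  indistinguishability. The integral of locally bounded predictable integrands is the unique
  extension of the elementary integral that satisfies the dominated convergence theorem; as a
  relation, it is therefore the least one which contains the elementary integrals and is closed
  under (locally) dominated pointwise limits. The domain consists of the processes which agree on
  $(0,\infty)$, up to evanescence, with a locally bounded predictable process. Working with
  matrix valued integrands amounts to
  $Y^i = \sum_j \int_0^{\cdot} H^{ij}_s\,dZ^j_s$.\<close>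

inductive stochastic_integral ::
    "'w measure \<Rightarrow> (real \<Rightarrow> 'w measure) \<Rightarrow> (real \<Rightarrow> 'w \<Rightarrow> real ^ 'm) \<Rightarrow>
      (real \<Rightarrow> 'w \<Rightarrow> real ^ 'm ^ 'd) \<Rightarrow> (real \<Rightarrow> 'w \<Rightarrow> real ^ 'd) \<Rightarrow> bool"
  for M F Z where
  elementary:
    "\<lbrakk>0 \<le> \<tau> 0; incseq \<tau>;
      \<And>k. A k \<in> borel_measurable (F (\<tau> k)); \<And>k. bounded (range (A k))\<rbrakk>
     \<Longrightarrow> stochastic_integral M F Z (elementary_integrand n \<tau> A) (elementary_integral Z n \<tau> A)"
| dominated_limit:
    "\<lbrakk>\<And>n. stochastic_integral M F Z (H n) (Y n);
      locally_uniformly_bounded M F H;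
      AE \<omega> in M. \<forall>t>0. (\<lambda>n. H n t \<omega>) \<longlonglongrightarrow> H' t \<omega>;
      adapted F Y'; AE \<omega> in M. cadlag (\<lambda>t. Y' t \<omega>);
      ucp_tendsto M Y Y'\<rbrakk>
     \<Longrightarrow> stochastic_integral M F Z H' Y'"

section \<open>The stochastic differential equation\<close>

text \<open>Solutions of $dX_t = \Phi(X_{t-})\,dZ_t$, $X_0 = x$, defined on all of $[0,\infty)$ with
  values in $R^d$, that is, conservative ones.\<close>

definition sde_solution ::
    "'w measure \<Rightarrow> (real \<Rightarrow> 'w measure) \<Rightarrow> (real \<Rightarrow> 'w \<Rightarrow> real ^ 'm) \<Rightarrow>
      (real ^ 'd \<Rightarrow> real ^ 'm ^ 'd) \<Rightarrow> real ^ 'd \<Rightarrow> (real \<Rightarrow> 'w \<Rightarrow> real ^ 'd) \<Rightarrow> bool" where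
  "sde_solution M F Z \<Phi> x X \<longleftrightarrow>
     adapted F X \<and> (AE \<omega> in M. cadlag (\<lambda>t. X t \<omega>)) \<and>
     (\<exists>Y. stochastic_integral M F Z (\<lambda>t \<omega>. \<Phi> (Lim (at_left t) (\<lambda>s. X s \<omega>))) Y \<and>
          indistinguishable M X (\<lambda>t \<omega>. x + Y t \<omega>))"

definition admissible ::
    "'w measure \<Rightarrow> (real \<Rightarrow> 'w measure) \<Rightarrow> (real \<Rightarrow> 'w \<Rightarrow> real ^ 'm) \<Rightarrow>
      (real ^ 'd \<Rightarrow> real ^ 'm ^ 'd) \<Rightarrow> bool" where
  "admissible M F Z \<Phi> \<longleftrightarrow>
     (\<forall>x. (\<exists>X. sde_solution M F Z \<Phi> x X) \<and>
          (\<forall>X X'. sde_solution M F Z \<Phi> x X \<longrightarrow> sde_solution M F Z \<Phi> x X' \<longrightarrow>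
                  indistinguishable M X X'))"

text \<open>In the following, \<open>X x\<close> is the process started in \<open>x\<close>; expectations under $P^x$ are
  expectations of functionals of \<open>X x\<close> under \<open>M\<close>.\<close>

definition finely_continuous ::
    "'w measure \<Rightarrow> (real ^ 'd \<Rightarrow> real \<Rightarrow> 'w \<Rightarrow> real ^ 'd) \<Rightarrow>
      (real ^ 'd \<Rightarrow> real ^ 'm ^ 'd) \<Rightarrow> bool" where
  "finely_continuous M X \<Phi> \<longleftrightarrow>
     (\<forall>x. AE \<omega> in M. \<forall>t\<ge>0. continuous (at_right t) (\<lambda>s. \<Phi> (X x s \<omega>)))"

definition locally_bounded :: "(real ^ 'd \<Rightarrow> real ^ 'm ^ 'd) \<Rightarrow> bool" where
  "locally_bounded \<Phi> \<longleftrightarrow> (\<forall>K. compact K \<longrightarrow> bounded (\<Phi> ` K))"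

section \<open>Symbol and indices\<close>

definition exit_time :: "(real \<Rightarrow> 'w \<Rightarrow> 'b) \<Rightarrow> 'b set \<Rightarrow> 'w \<Rightarrow> ereal" where
  "exit_time X K \<omega> = Inf {ereal t | t. 0 \<le> t \<and> X t \<omega> \<notin> K}"

definition stopped :: "(real \<Rightarrow> 'w \<Rightarrow> 'b) \<Rightarrow> ('w \<Rightarrow> ereal) \<Rightarrow> real \<Rightarrow> 'w \<Rightarrow> 'b" where
  "stopped X \<sigma> t \<omega> = X (real_of_ereal (min (ereal t) (\<sigma> \<omega>))) \<omega>"

definition symbol ::
    "'w measure \<Rightarrow> (real ^ 'd \<Rightarrow> real \<Rightarrow> 'w \<Rightarrow> real ^ 'd) \<Rightarrow> real ^ 'd \<Rightarrow> real ^ 'd \<Rightarrow> complex" where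
  "symbol M X x \<xi> =
     (THE z. \<forall>K. compact K \<and> x \<in> interior K \<longrightarrow>
        ((\<lambda>t. - ((LINT \<omega>|M. iexp ((stopped (X x) (exit_time (X x) K) t \<omega> - x) \<bullet> \<xi>) - 1)
                 / complex_of_real t)) \<longlongrightarrow> z) (at_right 0))"

definition H_loc :: "(real ^ 'd \<Rightarrow> real ^ 'd \<Rightarrow> complex) \<Rightarrow> real ^ 'd \<Rightarrow> real \<Rightarrow> ereal" where
  "H_loc q x R = (SUP y\<in>{y. norm (y - x) \<le> 2 * R}. SUP e\<in>{e. norm e \<le> 1}. ereal (cmod (q y (e /\<^sub>R R))))"

definition H_glob :: "(real ^ 'd \<Rightarrow> real ^ 'd \<Rightarrow> complex) \<Rightarrow> real \<Rightarrow> ereal" where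
  "H_glob q R = (SUP x. H_loc q x R)"

definition beta_inf_unif :: "(real ^ 'd \<Rightarrow> real ^ 'd \<Rightarrow> complex) \<Rightarrow> ereal" where
  "beta_inf_unif q =
     Inf {ereal l | l. 0 < l \<and> Limsup (at_right 0) (\<lambda>R. ereal (R powr l) * H_glob q R) = 0}"

definition beta_inf_unif1 :: "(real ^ 'd \<Rightarrow> real ^ 'd \<Rightarrow> complex) \<Rightarrow> ereal" where
  "beta_inf_unif1 q =
     (SUP x. Inf {ereal l | l. 0 < l \<and> Limsup (at_right 0) (\<lambda>R. ereal (R powr l) * H_loc q x R) = 0})"

definition beta_1 :: "(real ^ 'm \<Rightarrow> complex) \<Rightarrow> ereal" where
  "beta_1 \<psi> =
     Inf {ereal a | a. 0 < a \<and> ((\<lambda>y. norm y powr (- a) * cmod (\<psi> y)) \<longlongrightarrow> 0) at_infinity}"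

end

theory Submission
  imports Defs
begin

text \<open>For a bounded predictable integrand \<open>H\<close> and \<open>Y = \<integral> H dZ\<close> the process
  \<open>exp (i \<xi>'Y\<^sub>t + \<integral>\<^sub>0\<^sup>t \<psi>(H\<^sub>s'\<xi>) ds)\<close> is a martingale. For elementary integrands this is the
  independence of the increments of \<open>Z\<close>, and it passes to dominated limits. Stopped at the exit time
  of a compact neighbourhood and differentiated at \<open>t = 0\<close>, it shows that the symbol of \<open>X\<close> is
  \<open>q(x,\<xi>) = \<psi>(\<Phi>(x)'\<xi>)\<close>, without recourse to Ito's formula.

  For the indices, surjectivity of \<open>\<Phi>(x\<^sub>0)'\<close> gives \<open>\<beta>\<^sub>1(Z) \<le> \<beta>\<^sup>u\<^sup>n\<^sup>i\<^sup>f\<^sup>,\<^sup>1(X)\<close>. Conversely,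
  if \<open>H(R) < \<infinity>\<close> for one \<open>R\<close>, then \<open>\<psi>\<close> is bounded along every direction in which the set
  \<open>{\<Phi>(y)'\<epsilon> : \<parallel>\<epsilon>\<parallel> \<le> 1}\<close> is unbounded. As \<open>|\<psi>(a - b)| \<le> 2|\<psi>(a)| + 2|\<psi>(b)|\<close>, such directions
  contribute only a constant, and \<open>H(R)\<close> is controlled by \<open>\<psi>\<close> on balls of radius \<open>const/R\<close>.\<close>

section \<open>Comparison of the indices\<close>

text \<open>On the index side the obstacle is that \<open>\<Phi>\<close> is unbounded, so the
  arguments of \<open>\<psi>\<close> do not stay in a ball of radius const/R. If
  \<open>\<psi>\<close> is bounded by C on all segments from 0 to vectors y_n with norms tending to
  infinity, then every point t*u on the ray in a limiting direction u is a limit of the shortened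
  vectors (t/|y_n|)*y_n, so continuity alone gives the bound C on the whole ray. The inequality for
  \<open>\<psi>(a - b)\<close> turns rays into lines and finitely many lines into a subspace.

  On the stochastic side the integral is available only as the least relation closed under locally
  dominated ucp limits, so whatever is claimed about it must survive such limits. An expectation at
  a bounded stopping time up to which the integrand is bounded does: the integral enters only
  through a bounded Lipschitz function, for which convergence in probability is enough, and the
  integrand only through a bounded exponent, for which pointwise convergence is enough. Path
  properties hold almost surely only, so measurability rests on completeness throughout.\<close>

lemma Limsup_eq_0_iff_nonneg:
  fixes f :: "'a \<Rightarrow> ereal"
  assumes "G \<noteq> bot" and nonneg: "eventually (\<lambda>x. 0 \<le> f x) G"
  shows "Limsup G f = 0 \<longleftrightarrow> (f \<longlongrightarrow> 0) G"
proof
  assume L: "Limsup G f = 0"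
  have "0 \<le> Liminf G f" using nonneg by (rule Liminf_bounded)
  with Liminf_le_Limsup[OF assms(1), of f] L have "Liminf G f = 0" by (intro antisym) auto
  with L show "(f \<longlongrightarrow> 0) G" using tendsto_iff_Liminf_eq_Limsup[OF assms(1)] by blast
next
  assume "(f \<longlongrightarrow> 0) G" then show "Limsup G f = 0"
    using tendsto_iff_Liminf_eq_Limsup[OF assms(1)] by blast
qed

section \<open>Directions along which the exponent stays bounded\<close>

text \<open>Directions of points of \<open>S\<close> with norm above \<open>n + 1\<close>
  accumulate, by compactness of the unit sphere of \<open>W\<close>, at some \<open>u\<close>. For
  fixed \<open>t\<close> and large \<open>n\<close>, \<open>t\<close> times the \<open>n\<close>-th
  direction lies on the segment from 0 to the \<open>n\<close>-th point, where the bound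
  \<open>C\<close> holds; continuity carries it to the ray through \<open>u\<close>.\<close>

lemma bounded_ray_in_subspace:
  fixes \<psi> :: "'a::euclidean_space \<Rightarrow> complex"
  assumes cont: "continuous_on UNIV \<psi>" and W: "subspace W" "S \<subseteq> W"
    and unb: "\<not> bounded S"
    and bd: "\<And>y s. y \<in> S \<Longrightarrow> 0 \<le> s \<Longrightarrow> s \<le> 1 \<Longrightarrow> cmod (\<psi> (s *\<^sub>R y)) \<le> C"
  obtains u where "norm u = 1" "u \<in> W" "\<And>t. 0 \<le> t \<Longrightarrow> cmod (\<psi> (t *\<^sub>R u)) \<le> C"
proof -
  have "\<exists>y\<in>S. real n + 1 < norm y" for n
    using unb unfolding bounded_iff by (meson not_le_imp_less)
  then obtain y where y: "\<And>n. y n \<in> S" "\<And>n. real n + 1 < norm (y n)" by metis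
  define v where "v n = y n /\<^sub>R norm (y n)" for n
  have ypos: "norm (y n) > 0" for n using y(2)[of n] by linarith
  have "v n \<in> sphere 0 1 \<inter> W" for n
    using ypos[of n] y(1)[of n] W by (auto simp: v_def subspace_scale)
  moreover have "compact (sphere 0 1 \<inter> W)"
    using W by (intro compact_Int_closed closed_subspace) auto
  ultimately obtain u r where u: "u \<in> sphere 0 1 \<inter> W" "strict_mono r" "(v \<circ> r) \<longlonglongrightarrow> u"
    using compact_def by (metis (no_types, lifting))
  have "cmod (\<psi> (t *\<^sub>R u)) \<le> C" if "0 \<le> t" for t
  proof -
    have "(\<lambda>n. \<psi> (t *\<^sub>R v (r n))) \<longlonglongrightarrow> \<psi> (t *\<^sub>R u)"
      using u(3) by (intro continuous_on_tendsto_compose[OF cont] tendsto_intros) (auto simp: o_def)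
    moreover have "eventually (\<lambda>n. cmod (\<psi> (t *\<^sub>R v (r n))) \<le> C) sequentially"
      using eventually_ge_at_top[of "nat \<lceil>t\<rceil>"]
    proof eventually_elim
      case (elim n)
      have "t \<le> norm (y (r n))"
        using elim y(2)[of "r n"] seq_suble[OF u(2), of n] by linarith
      then have "cmod (\<psi> ((t / norm (y (r n))) *\<^sub>R y (r n))) \<le> C"
        using that ypos[of "r n"] by (intro bd y) auto
      then show ?case by (simp add: v_def divide_inverse)
    qed
    ultimately show ?thesis
      by (intro tendsto_upperbound[OF tendsto_norm]) auto
  qed
  with u(1) show thesis by (intro that[of u]) auto
qed

text \<open>Each further vector \<open>b\<close> is split off as
  \<open>u = (u - k b) - (- k b)\<close>, which turns the bounds \<open>C\<close>, \<open>D\<close>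
  into \<open>2 * C + 2 * D\<close>. The constant grows with every vector, hence the finiteness of
  \<open>B\<close>.\<close>

lemma bounded_on_span:
  fixes \<psi> :: "'a::real_vector \<Rightarrow> complex"
  assumes sub: "\<And>a b. cmod (\<psi> (a - b)) \<le> 2 * cmod (\<psi> a) + 2 * cmod (\<psi> b)"
    and "finite B" and "\<And>b. b \<in> B \<Longrightarrow> \<exists>C. \<forall>t. cmod (\<psi> (t *\<^sub>R b)) \<le> C"
  shows "\<exists>C. \<forall>u\<in>span B. cmod (\<psi> u) \<le> C"
  using assms(2,3)
proof (induction B rule: finite_induct)
  case empty
  then show ?case by (auto intro: exI[of _ "cmod (\<psi> 0)"])
next
  case (insert b B)
  obtain C where C: "\<And>u. u \<in> span B \<Longrightarrow> cmod (\<psi> u) \<le> C" using insert by blast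
  obtain D where D: "\<And>t. cmod (\<psi> (t *\<^sub>R b)) \<le> D" using insert by blast
  have "cmod (\<psi> u) \<le> 2 * C + 2 * D" if u: "u \<in> span (insert b B)" for u
  proof -
    obtain k where "u - k *\<^sub>R b \<in> span B" using u by (auto simp: span_insert)
    from C[OF this] D[of "- k"] sub[of "u - k *\<^sub>R b" "- k *\<^sub>R b"] show ?thesis by simp
  qed
  then show ?case by blast
qed

text \<open>The lines on which \<open>\<psi>\<close> is bounded fill a subspace, and a set on which \<open>\<psi>\<close> is bounded
  has bounded projection onto its orthogonal complement.\<close>

lemma bounded_on_starlike_decomposition:
  fixes \<psi> :: "'a::euclidean_space \<Rightarrow> complex"
  assumes cont: "continuous_on UNIV \<psi>"
    and sub: "\<And>a b. cmod (\<psi> (a - b)) \<le> 2 * cmod (\<psi> a) + 2 * cmod (\<psi> b)"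
    and bd: "\<And>y s. y \<in> S \<Longrightarrow> 0 \<le> s \<Longrightarrow> s \<le> 1 \<Longrightarrow> cmod (\<psi> (s *\<^sub>R y)) \<le> C"
  obtains C' K where "0 < C'" "0 < K"
    "\<And>y a. y \<in> S \<Longrightarrow> \<exists>z. norm z \<le> K \<and> cmod (\<psi> (a *\<^sub>R y)) \<le> C' + 2 * cmod (\<psi> (a *\<^sub>R z))"
proof -
  \<comment> \<open>A maximal independent subset \<open>B\<close> of \<open>L\<close> spans a
    subspace containing \<open>L\<close>, and being finite it yields one bound for
    \<open>\<psi>\<close> on all of \<open>span B\<close>.\<close>
  define L where "L = {u. \<exists>C. \<forall>t. cmod (\<psi> (t *\<^sub>R u)) \<le> C}"
  obtain B where B: "B \<subseteq> L" "finite B" "L \<subseteq> span B"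
    using maximal_independent_subset_extend[of "{}" L] independent_imp_finite
    by (metis empty_subsetI independent_empty)
  have neg: "cmod (\<psi> (- a)) \<le> 2 * cmod (\<psi> 0) + 2 * cmod (\<psi> a)" for a
    using sub[of 0 a] by simp
  have "\<exists>C. \<forall>t. cmod (\<psi> (t *\<^sub>R b)) \<le> C" if "b \<in> B" for b
    using that B(1) by (auto simp: L_def)
  from bounded_on_span[of \<psi>, OF sub B(2) this] obtain D0
    where D0: "\<And>u. u \<in> span B \<Longrightarrow> cmod (\<psi> u) \<le> D0" by blast
  \<comment> \<open>The maximum with 1 makes the final constant \<open>2 * D\<close>
    positive.\<close>
  define D where "D = max D0 1"
  have D: "cmod (\<psi> u) \<le> D" if "u \<in> span B" for u
    using D0[OF that] unfolding D_def by linarith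
  have "\<exists>p q. p \<in> span B \<and> (\<forall>w\<in>span B. orthogonal q w) \<and> x = p + q" for x :: 'a
    by (metis orthogonal_subspace_decomp_exists)
  then obtain p q where pq: "\<And>x. p x \<in> span B" "\<And>x w. w \<in> span B \<Longrightarrow> orthogonal (q x) w"
    "\<And>x. x = p x + q x" by metis
  let ?W = "{x. \<forall>w\<in>span B. orthogonal w x}"
  have W: "subspace ?W" by (rule subspace_orthogonal_to_vectors)
  \<comment> \<open>The components \<open>q x = x - p x\<close> inherit a bound for
    \<open>\<psi>\<close> on their segments. Were they unbounded, some unit vector \<open>u\<close>
    orthogonal to \<open>span B\<close> would carry a bounded ray, by \<open>neg\<close> a bounded
    line, and so lie in \<open>L\<close>, hence in \<open>span B\<close>: it would be orthogonal to
    itself.\<close>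
  have "bounded (q ` S)"
  proof (rule ccontr)
    assume unb: "\<not> bounded (q ` S)"
    have sW: "q ` S \<subseteq> ?W" using pq(2) by (auto simp: orthogonal_commute)
    have "cmod (\<psi> (s *\<^sub>R y)) \<le> 2 * C + 2 * D" if y: "y \<in> q ` S" "0 \<le> s" "s \<le> 1" for y s
    proof -
      obtain x where x: "x \<in> S" "y = q x" using y by auto
      have "s *\<^sub>R y = s *\<^sub>R x - s *\<^sub>R p x"
        using pq(3)[of x] x by (metis add_diff_cancel_left' scaleR_diff_right)
      then show ?thesis
        using sub[of "s *\<^sub>R x" "s *\<^sub>R p x"] bd[OF x(1) y(2,3)] D[of "s *\<^sub>R p x"] pq(1)[of x]
        by (simp add: span_scale)
    qed
    from bounded_ray_in_subspace[OF cont W sW unb this] obtain u where u: "norm u = 1" "u \<in> ?W"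
      "\<And>t. 0 \<le> t \<Longrightarrow> cmod (\<psi> (t *\<^sub>R u)) \<le> 2 * C + 2 * D" by blast
    have "cmod (\<psi> (t *\<^sub>R u)) \<le> 2 * cmod (\<psi> 0) + 2 * (2 * C + 2 * D) + (2 * C + 2 * D)" for t
    proof -
      have "0 \<le> 2 * C + 2 * D" using u(3)[of 0] by (smt (verit) norm_ge_zero)
      then show ?thesis using u(3)[of t] u(3)[of "- t"] neg[of "(- t) *\<^sub>R u"]
        by (cases "0 \<le> t") (auto, smt (verit) norm_ge_zero)
    qed
    then have "u \<in> L" unfolding L_def by blast
    with B u(2) have "orthogonal u u" by blast
    with u(1) show False by (simp add: orthogonal_def)
  qed
  then obtain K where K: "0 < K" "\<And>y. y \<in> S \<Longrightarrow> norm (q y) \<le> K"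
    by (metis bounded_pos imageI)
  show thesis
  proof
    show "0 < 2 * D" "0 < K" using K by (auto simp: D_def)
    fix y and a :: real assume "y \<in> S"
    \<comment> \<open>The hypothesis \<open>sub\<close> is about differences, hence the witness
      \<open>- q y\<close> rather than \<open>q y\<close>.\<close>
    have "a *\<^sub>R y = a *\<^sub>R p y - a *\<^sub>R (- q y)"
      by (metis diff_minus_eq_add pq(3) scaleR_minus_right scaleR_right_distrib)
    then have "cmod (\<psi> (a *\<^sub>R y)) \<le> 2 * D + 2 * cmod (\<psi> (a *\<^sub>R (- q y)))"
      using sub[of "a *\<^sub>R p y" "a *\<^sub>R (- q y)"] D[of "a *\<^sub>R p y"] pq(1)[of y] by (simp add: span_scale)
    then show "\<exists>z. norm z \<le> K \<and> cmod (\<psi> (a *\<^sub>R y)) \<le> 2 * D + 2 * cmod (\<psi> (a *\<^sub>R z))"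
      using K(2)[OF \<open>y \<in> S\<close>] by (intro exI[of _ "- q y"]) auto
  qed
qed

section \<open>Inequalities between the three indices\<close>

lemma H_loc_nonneg: "0 \<le> R \<Longrightarrow> 0 \<le> H_loc q x R"
proof -
  assume "0 \<le> R"
  then have "ereal (cmod (q x (0 /\<^sub>R R))) \<le> H_loc q x R"
    unfolding H_loc_def by (intro SUP_upper2[of x] SUP_upper2[of 0]) auto
  then show ?thesis by (meson ereal_less_eq(5) norm_ge_zero order_trans)
qed

lemma H_loc_le_H_glob: "H_loc q x R \<le> H_glob q R"
  unfolding H_glob_def by (rule SUP_upper) simp

lemma cmod_le_H_loc: "norm (y - x) \<le> 2 * R \<Longrightarrow> norm e \<le> 1 \<Longrightarrow> ereal (cmod (q y (e /\<^sub>R R))) \<le> H_loc q x R"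
  unfolding H_loc_def by (rule SUP_upper2[of y]) (auto intro: SUP_upper2[of e])

lemma H_glob_le:
  assumes "\<And>y e. norm e \<le> 1 \<Longrightarrow> ereal (cmod (q y (e /\<^sub>R R))) \<le> b"
  shows "H_glob q R \<le> b"
  unfolding H_glob_def H_loc_def using assms by (auto intro!: SUP_least)

lemma eventually_at_right_0_nonneg: "(\<And>R::real. 0 \<le> R \<Longrightarrow> P R) \<Longrightarrow> eventually P (at_right 0)"
  by (auto simp: eventually_at_filter)

lemma beta_inf_unif1_le: "beta_inf_unif1 q \<le> beta_inf_unif q"
proof -
  have "Limsup (at_right 0) (\<lambda>R. ereal (R powr l) * H_loc q x R) = 0"
    if "Limsup (at_right 0) (\<lambda>R. ereal (R powr l) * H_glob q R) = 0" for x l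
  proof (rule antisym)
    show "Limsup (at_right 0) (\<lambda>R. ereal (R powr l) * H_loc q x R) \<le> 0"
      unfolding that[symmetric]
      by (intro Limsup_mono always_eventually allI ereal_mult_left_mono H_loc_le_H_glob) auto
    show "0 \<le> Limsup (at_right 0) (\<lambda>R. ereal (R powr l) * H_loc q x R)"
      by (rule order_trans[OF Liminf_bounded Liminf_le_Limsup])
        (auto intro!: eventually_at_right_0_nonneg ereal_0_le_mult H_loc_nonneg)
  qed
  then show ?thesis
    unfolding beta_inf_unif1_def beta_inf_unif_def by (intro SUP_least Inf_superset_mono) auto
qed

text \<open>A linear right inverse of \<open>transpose (\<Phi> x\<^sub>0)\<close> writes every
  \<open>y\<close> as the image of some \<open>\<xi>\<close> with
  \<open>norm \<xi> \<le> B * norm y\<close>. At scale \<open>R = 1 / (B * norm y)\<close> the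
  vector \<open>R \<xi>\<close> lies in the unit ball, so the modulus of \<open>\<psi> y\<close> is
  at most \<open>H_loc q x\<^sub>0 R\<close>, and large \<open>y\<close> correspond to small
  \<open>R\<close>.\<close>

lemma beta_1_le_beta_inf_unif1:
  fixes \<psi> :: "real ^ 'm \<Rightarrow> complex" and \<Phi> :: "real ^ 'd \<Rightarrow> real ^ 'm ^ 'd"
  assumes q: "\<And>x \<xi>. q x \<xi> = \<psi> (transpose (\<Phi> x) *v \<xi>)"
    and surj: "surj (\<lambda>\<xi>. transpose (\<Phi> x\<^sub>0) *v \<xi>)"
  shows "beta_1 \<psi> \<le> beta_inf_unif1 q"
proof -
  obtain B where B: "0 < B" "\<And>y. \<exists>\<xi>. transpose (\<Phi> x\<^sub>0) *v \<xi> = y \<and> norm \<xi> \<le> B * norm y"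
  proof -
    obtain g where g: "linear g" "(\<lambda>\<xi>. transpose (\<Phi> x\<^sub>0) *v \<xi>) \<circ> g = id"
      using linear_surjective_right_inverse[OF matrix_vector_mul_linear surj] by blast
    obtain B where "0 < B" "\<And>y. norm (g y) \<le> B * norm y"
      using linear_bounded_pos[OF g(1)] by blast
    with g(2) show thesis by (intro that[of B]) (auto simp: fun_eq_iff)
  qed
  have "((\<lambda>y. norm y powr (- l) * cmod (\<psi> y)) \<longlongrightarrow> 0) at_infinity"
    if "0 < l" and L: "Limsup (at_right 0) (\<lambda>R. ereal (R powr l) * H_loc q x\<^sub>0 R) = 0" for l
  proof (rule tendstoI)
    fix e :: real assume "0 < e"
    \<comment> \<open>Compensates the factor in
      \<open>norm y powr (- l) = B powr l * R powr l\<close>.\<close>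
    define e' where "e' = e / B powr l"
    have e': "0 < e'" using \<open>0 < e\<close> \<open>0 < B\<close> by (simp add: e'_def)
    have "((\<lambda>R. ereal (R powr l) * H_loc q x\<^sub>0 R) \<longlongrightarrow> 0) (at_right 0)"
      using L by (subst (asm) Limsup_eq_0_iff_nonneg)
        (auto intro!: eventually_at_right_0_nonneg ereal_0_le_mult H_loc_nonneg)
    then have "eventually (\<lambda>R. ereal (R powr l) * H_loc q x\<^sub>0 R < e') (at_right 0)"
      using e' by (intro order_tendstoD) auto
    then obtain r where r: "0 < r" "\<And>R. 0 < R \<Longrightarrow> R < r \<Longrightarrow> ereal (R powr l) * H_loc q x\<^sub>0 R < e'"
      unfolding eventually_at_right_field by blast
    show "eventually (\<lambda>y. dist (norm y powr (- l) * cmod (\<psi> y)) 0 < e) at_infinity"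
      unfolding eventually_at_infinity
    proof (intro exI[of _ "2 / (B * r)"] allI impI)
      fix y :: "real ^ 'm" assume y: "2 / (B * r) \<le> norm y"
      have "0 < 2 / (B * r)" using B(1) r(1) by simp
      with y have y0: "0 < norm y" by linarith
      \<comment> \<open>The threshold \<open>2 / (B * r)\<close> for \<open>norm y\<close> gives
        \<open>R \<le> r / 2\<close>, hence the strict inequality \<open>R < r\<close>.\<close>
      define R where "R = 1 / (B * norm y)"
      have R: "0 < R" "R < r"
      proof -
        show "0 < R" using y0 B by (simp add: R_def)
        have "2 \<le> norm y * (B * r)" using y B(1) r(1) by (simp add: pos_divide_le_eq)
        then have "1 < r * (B * norm y)" by (simp add: mult_ac)
        then show "R < r" using y0 B by (simp add: R_def pos_divide_less_eq)
      qed
      obtain \<xi> where \<xi>: "transpose (\<Phi> x\<^sub>0) *v \<xi> = y" "norm \<xi> \<le> B * norm y" using B(2) by blast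
      have "norm (R *\<^sub>R \<xi>) \<le> 1"
        using \<xi>(2) R(1) y0 B(1) by (simp add: R_def field_simps)
      then have "ereal (cmod (q x\<^sub>0 ((R *\<^sub>R \<xi>) /\<^sub>R R))) \<le> H_loc q x\<^sub>0 R"
        using R by (intro cmod_le_H_loc) auto
      then have "ereal (cmod (\<psi> y)) \<le> H_loc q x\<^sub>0 R" using R(1) \<xi>(1) by (simp add: q)
      then have "ereal (R powr l) * ereal (cmod (\<psi> y)) \<le> ereal (R powr l) * H_loc q x\<^sub>0 R"
        by (intro ereal_mult_left_mono) auto
      also have "\<dots> < e'" using r(2) R by blast
      finally have "R powr l * cmod (\<psi> y) < e'" by simp
      moreover have "norm y powr (- l) = B powr l * R powr l"
        using y0 B(1) by (simp add: R_def powr_divide powr_mult powr_minus_divide)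
      ultimately show "dist (norm y powr (- l) * cmod (\<psi> y)) 0 < e"
        using B(1) by (simp add: e'_def field_simps)
    qed
  qed
  then have "beta_1 \<psi> \<le> Inf {ereal l | l. 0 < l \<and>
      Limsup (at_right 0) (\<lambda>R. ereal (R powr l) * H_loc q x\<^sub>0 R) = 0}"
    unfolding beta_1_def by (intro Inf_superset_mono) auto
  also have "\<dots> \<le> beta_inf_unif1 q" unfolding beta_inf_unif1_def by (rule SUP_upper) simp
  finally show ?thesis .
qed

text \<open>A finite index makes \<open>H_glob q\<close> finite at one radius \<open>R1\<close>. Any
  other radius is reached by scaling: the argument of \<open>\<psi>\<close> at \<open>R\<close> is
  \<open>R1 / R\<close> times an element of \<open>S\<close>. The decomposition of \<open>S\<close>
  then bounds \<open>q y (e / R)\<close>, uniformly in \<open>y\<close>, by \<open>C'\<close> plus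
  twice the value of \<open>\<psi>\<close> at a vector of norm at most \<open>K * R1 / R\<close>, so
  the growth rate of \<open>\<psi>\<close> passes to \<open>H_glob q\<close>.\<close>

lemma beta_inf_unif_le_beta_1:
  fixes \<psi> :: "real ^ 'm \<Rightarrow> complex" and \<Phi> :: "real ^ 'd \<Rightarrow> real ^ 'm ^ 'd"
  assumes q: "\<And>x \<xi>. q x \<xi> = \<psi> (transpose (\<Phi> x) *v \<xi>)"
    and cont: "continuous_on UNIV \<psi>"
    and sub: "\<And>a b. cmod (\<psi> (a - b)) \<le> 2 * cmod (\<psi> a) + 2 * cmod (\<psi> b)"
    and fin: "beta_inf_unif q < \<infinity>"
  shows "beta_inf_unif q \<le> beta_1 \<psi>"
proof -
  \<comment> \<open>Without such an \<open>l\<close> the index would be the infimum of the empty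
    set, which is infinite.\<close>
  have "\<exists>l. 0 < l \<and> Limsup (at_right 0) (\<lambda>R. ereal (R powr l) * H_glob q R) = 0"
  proof (rule ccontr)
    assume "\<not> ?thesis"
    then have *: "{ereal l | l. 0 < l \<and> Limsup (at_right 0) (\<lambda>R. ereal (R powr l) * H_glob q R) = 0} = {}"
      by blast
    with fin show False unfolding beta_inf_unif_def * by (simp add: top_ereal_def)
  qed
  then obtain l where l: "0 < l" "Limsup (at_right 0) (\<lambda>R. ereal (R powr l) * H_glob q R) = 0"
    by blast
  have nonneg: "0 \<le> H_glob q R" if "0 \<le> R" for R
    using H_loc_nonneg[OF that] H_loc_le_H_glob by (rule order_trans)
  have "((\<lambda>R. ereal (R powr l) * H_glob q R) \<longlongrightarrow> 0) (at_right 0)"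
    using l(2) by (subst (asm) Limsup_eq_0_iff_nonneg)
      (auto intro!: eventually_at_right_0_nonneg ereal_0_le_mult nonneg)
  then have "eventually (\<lambda>R. ereal (R powr l) * H_glob q R < 1) (at_right 0)"
    by (intro order_tendstoD) auto
  then obtain r where r: "0 < r" "\<And>R. 0 < R \<Longrightarrow> R < r \<Longrightarrow> ereal (R powr l) * H_glob q R < 1"
    unfolding eventually_at_right_field by blast
  define R1 where "R1 = r / 2"
  have R1: "0 < R1" "ereal (R1 powr l) * H_glob q R1 < 1" using r by (auto simp: R1_def)
  have "H_glob q R1 \<noteq> \<infinity>"
    using R1 l(1) by auto
  then obtain C where C: "H_glob q R1 = ereal C" using nonneg[of R1] R1(1)
    by (cases "H_glob q R1") auto
  \<comment> \<open>This set is star-shaped about 0, because \<open>s *\<^sub>R e\<close> stays in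
    the unit ball for \<open>s\<close> in \<open>[0,1]\<close>; the bound at radius
    \<open>R1\<close> therefore covers whole segments.\<close>
  define S where "S = {transpose (\<Phi> y) *v (e /\<^sub>R R1) | y e. norm e \<le> 1}"
  have "cmod (\<psi> (s *\<^sub>R z)) \<le> C" if s: "z \<in> S" "0 \<le> s" "s \<le> 1" for z s
  proof -
    obtain y e where z: "z = transpose (\<Phi> y) *v (e /\<^sub>R R1)" "norm e \<le> 1"
      using s(1) unfolding S_def by blast
    have "norm (s *\<^sub>R e) \<le> 1" using z(2) s by (simp add: mult_le_one)
    then have "ereal (cmod (q y ((s *\<^sub>R e) /\<^sub>R R1))) \<le> H_glob q R1"
      using R1(1) by (intro order_trans[OF cmod_le_H_loc H_loc_le_H_glob, of y y]) auto
    then show ?thesis by (simp add: C q z(1) matrix_vector_mult_scaleR mult.commute)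
  qed
  from bounded_on_starlike_decomposition[OF cont sub this, of S]
  obtain C' K where K: "0 < C'" "0 < K"
    "\<And>y a. y \<in> S \<Longrightarrow> \<exists>z. norm z \<le> K \<and> cmod (\<psi> (a *\<^sub>R y)) \<le> C' + 2 * cmod (\<psi> (a *\<^sub>R z))"
    by blast
  have "Limsup (at_right 0) (\<lambda>R. ereal (R powr a) * H_glob q R) = 0"
    if a: "0 < a" and lim: "((\<lambda>y. norm y powr (- a) * cmod (\<psi> y)) \<longlongrightarrow> 0) at_infinity" for a
  proof (subst Limsup_eq_0_iff_nonneg)
    show "\<forall>\<^sub>F x in at_right 0. 0 \<le> ereal (x powr a) * H_glob q x"
    by (intro eventually_at_right_0_nonneg ereal_0_le_mult nonneg) auto
    have main: "\<forall>\<^sub>F R in at_right 0. ereal (R powr a) * H_glob q R < ereal e" if "0 < e" for e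
    proof -
      \<comment> \<open>With this constant \<open>R powr a * (2 * e' * (K * R1 / R) powr a)\<close>
        equals \<open>e / 2\<close> for every \<open>R\<close>; the other half of \<open>e\<close>
        absorbs the term \<open>R powr a * (C' + 2 * D)\<close>, which tends to 0.\<close>
      define e' where "e' = e / (4 * (K * R1) powr a)"
      have e': "0 < e'" using that K R1 by (simp add: e'_def)
      from tendstoD[OF lim e'] obtain b where
        b: "\<And>y. b \<le> norm y \<Longrightarrow> norm y powr (- a) * cmod (\<psi> y) < e'"
        by (auto simp: eventually_at_infinity)
      \<comment> \<open>Outside the ball of radius \<open>max b 1\<close> the decay estimate applies
        and the norm is positive, as needed to move the power to the other side.\<close>
      obtain D where D: "0 < D" "\<And>y. norm y \<le> max b 1 \<Longrightarrow> cmod (\<psi> y) \<le> D"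
      proof -
        have "bounded (\<psi> ` cball 0 (max b 1))"
          by (intro compact_imp_bounded compact_continuous_image continuous_on_subset[OF cont]) auto
        then show thesis using that by (auto simp: bounded_pos)
      qed
      have \<psi>: "cmod (\<psi> y) \<le> D + e' * norm y powr a" for y
      proof (cases "norm y \<le> max b 1")
        case True then show ?thesis using D(2)[of y] e' by (smt (verit) mult_nonneg_nonneg powr_ge_zero)
      next
        case False
        then have "norm y powr (- a) * cmod (\<psi> y) < e'" "0 < norm y" using b[of y] by linarith+
        then have "cmod (\<psi> y) < e' * norm y powr a" by (simp add: powr_minus_divide field_simps)
        with D(1) show ?thesis by linarith
      qed
      have H: "H_glob q R \<le> ereal (C' + 2 * (D + e' * (K * R1 / R) powr a))" if "0 < R" for R
      proof (rule H_glob_le)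
        fix y e assume e: "norm (e :: real ^ 'd) \<le> 1"
        have "transpose (\<Phi> y) *v (e /\<^sub>R R1) \<in> S" using e S_def by auto
        from K(3)[OF this, of "R1 / R"] obtain z where z: "norm z \<le> K"
          "cmod (q y (e /\<^sub>R R)) \<le> C' + 2 * cmod (\<psi> ((R1 / R) *\<^sub>R z))"
          using R1(1) by (auto simp: q matrix_vector_mult_scaleR field_simps)
        have "norm ((R1 / R) *\<^sub>R z) powr a \<le> (K * R1 / R) powr a"
          using z(1) R1(1) that a
          by (intro powr_mono2) (auto simp: divide_right_mono mult.commute mult_left_mono)
        then have "e' * norm ((R1 / R) *\<^sub>R z) powr a \<le> e' * (K * R1 / R) powr a"
          using e' by simp
        with z(2) \<psi>[of "(R1 / R) *\<^sub>R z"]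
        show "ereal (cmod (q y (e /\<^sub>R R))) \<le> ereal (C' + 2 * (D + e' * (K * R1 / R) powr a))"
          by simp
      qed
      have "((\<lambda>R::real. R powr a * (C' + 2 * D)) \<longlongrightarrow> 0 powr a * (C' + 2 * D)) (at_right 0)"
        using a by (intro tendsto_mult_right tendsto_powr')
          (auto simp: tendsto_ident_at eventually_at_filter)
      then have "\<forall>\<^sub>F R in at_right 0. R powr a * (C' + 2 * D) < e / 2"
        using \<open>0 < e\<close> by (intro order_tendstoD) auto
      moreover have "\<forall>\<^sub>F R in at_right 0. (0::real) < R" by (simp add: eventually_at_right_less)
      ultimately show ?thesis
      proof eventually_elim
        case (elim R)
        have "R powr a * (e' * (K * R1 / R) powr a) = e' * (K * R1) powr a"
          using elim(2) K(2) R1(1) by (simp add: powr_divide)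
        also have "\<dots> = e / 4" using K(2) R1(1) by (simp add: e'_def)
        finally have "R powr a * (C' + 2 * (D + e' * (K * R1 / R) powr a)) = R powr a * (C' + 2 * D) + e / 2"
          by (simp add: algebra_simps)
        also have "\<dots> < e" using elim(1) by simp
        finally have "ereal (R powr a) * ereal (C' + 2 * (D + e' * (K * R1 / R) powr a)) < ereal e"
          by simp
        then show ?case
          by (rule le_less_trans[rotated]) (intro ereal_mult_left_mono H elim, simp)
      qed
    qed
    show "((\<lambda>x. ereal (x powr a) * H_glob q x) \<longlongrightarrow> 0) (at_right 0)"
    proof (rule order_tendstoI)
      fix c :: ereal assume "c < 0"
      then show "\<forall>\<^sub>F x in at_right 0. c < ereal (x powr a) * H_glob q x"
        by (intro eventually_at_right_0_nonneg, elim less_le_trans)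
          (intro ereal_0_le_mult nonneg, auto)
    next
      fix c :: ereal assume "0 < c"
      then obtain e where "0 < ereal e" "ereal e < c" using ereal_dense2 by blast
      with main[of e] show "\<forall>\<^sub>F x in at_right 0. ereal (x powr a) * H_glob q x < c"
        by (auto elim!: eventually_mono)
    qed
  qed auto
  then show ?thesis unfolding beta_inf_unif_def beta_1_def by (intro Inf_superset_mono) auto
qed

section \<open>The characteristic exponent\<close>

text \<open>Recovers the exponent as a right derivative at time 0, so that statements about
  \<open>\<psi>\<close> follow from statements about characteristic functions without a branch of
  the logarithm.\<close>

lemma exp_difference_quotient:
  fixes z :: complex
  shows "((\<lambda>t. (1 - exp (- (complex_of_real t * z))) / complex_of_real t) \<longlongrightarrow> z) (at_right 0)"
proof (cases "z = 0")
  case False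
  have "filterlim (\<lambda>t. - (complex_of_real t * z)) (at (- (complex_of_real 0 * z))) (at_right 0)"
    unfolding filterlim_at
  proof
    show "((\<lambda>t. - (complex_of_real t * z)) \<longlongrightarrow> - (complex_of_real 0 * z)) (at_right 0)"
      by (intro tendsto_intros)
  qed (use False in \<open>auto simp: eventually_at_filter\<close>)
  then have "((\<lambda>t. (exp (- (complex_of_real t * z)) - 1) / (- (complex_of_real t * z))) \<longlongrightarrow> 1) (at_right 0)"
    by (intro filterlim_compose[OF lim_exp_minus_1]) simp
  from tendsto_mult_right[OF this, of z] False
  have "((\<lambda>t. (exp (- (complex_of_real t * z)) - 1) / (- (complex_of_real t * z)) * z) \<longlongrightarrow> z) (at_right 0)"
    by simp
  moreover have "(exp (- (complex_of_real t * z)) - 1) / (- (complex_of_real t * z)) * z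
      = (1 - exp (- (complex_of_real t * z))) / complex_of_real t" for t
    using False by (cases "t = 0") (auto simp: field_simps)
  ultimately show ?thesis by simp
qed simp

locale levy_basis =
  fixes M :: "'w measure" and F :: "real \<Rightarrow> 'w measure"
    and Z :: "real \<Rightarrow> 'w \<Rightarrow> real ^ 'm" and \<psi> :: "real ^ 'm \<Rightarrow> complex"
  assumes basis: "stochastic_basis M F"
    and levy: "levy_process M F Z"
    and cexp: "characteristic_exponent M Z \<psi>"
begin

sublocale prob_space M
  using basis by (simp add: stochastic_basis_def)

sublocale complete_measure M
  using basis by (simp add: stochastic_basis_def)

sublocale filtration "space M" F
  using basis by (simp add: stochastic_basis_def)

lemma sets_F_subset: "sets (F t) \<subseteq> sets M"
  using basis by (auto simp: stochastic_basis_def subalgebra_def)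

lemma measurable_F_imp_M: "f \<in> measurable (F t) N \<Longrightarrow> f \<in> measurable M N"
  using measurable_mono[OF order_refl refl sets_F_subset] space_F by blast

lemma measurable_F_mono: "f \<in> measurable (F s) N \<Longrightarrow> s \<le> t \<Longrightarrow> f \<in> measurable (F t) N"
  using measurable_mono[OF order_refl refl sets_F_mono, of s t N] by (auto simp: space_F)

lemma Z_measurable: "0 \<le> t \<Longrightarrow> Z t \<in> borel_measurable (F t)"
  using levy by (simp add: levy_process_def adapted_def)

lemma Z_measurable_M: "0 \<le> t \<Longrightarrow> Z t \<in> borel_measurable M"
  using Z_measurable measurable_F_imp_M by blast

text \<open>Preimages under \<open>f\<close> and \<open>g\<close> differ by a subset of a null set,
  and \<open>M\<close> is complete.\<close>

lemma measurable_AE_eq: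
  assumes g: "g \<in> measurable M N" and eq: "AE \<omega> in M. f \<omega> = g \<omega>"
    and sp: "\<And>\<omega>. \<omega> \<in> space M \<Longrightarrow> f \<omega> \<in> space N"
  shows "f \<in> measurable M N"
proof (rule measurableI)
  fix A assume "A \<in> sets N"
  then have "g -` A \<inter> space M \<in> sets M" using g by (rule measurable_sets[rotated])
  then show "f -` A \<inter> space M \<in> sets M"
    by (rule in_sets_AE[rotated]) (use eq in auto)
qed (rule sp)

lemma borel_measurable_AE_limit:
  fixes f :: "nat \<Rightarrow> 'w \<Rightarrow> 'b::{banach, second_countable_topology}"
  assumes "\<And>n. f n \<in> borel_measurable M" "AE \<omega> in M. (\<lambda>n. f n \<omega>) \<longlonglongrightarrow> g \<omega>"
  shows "g \<in> borel_measurable M"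
proof (rule measurable_AE_eq)
  show "(\<lambda>\<omega>. lim (\<lambda>n. f n \<omega>)) \<in> borel_measurable M"
    using assms(1) by (rule borel_measurable_lim_metric)
  show "AE \<omega> in M. g \<omega> = lim (\<lambda>n. f n \<omega>)"
    using assms(2) by eventually_elim (simp add: limI)
qed simp

lemma characteristic_function:
  "0 \<le> t \<Longrightarrow> (LINT \<omega>|M. iexp (y \<bullet> Z t \<omega>)) = exp (- (complex_of_real t * \<psi> y))"
  using cexp by (simp add: characteristic_exponent_def)

lemma integrable_iexp:
  "0 \<le> t \<Longrightarrow> integrable M (\<lambda>\<omega>. iexp (y \<bullet> Z t \<omega>))"
  using Z_measurable_M by (intro integrable_const_bound[where B=1]) auto

lemma Re_\<psi>_nonneg: "0 \<le> Re (\<psi> y)"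
proof -
  have "cmod (LINT \<omega>|M. iexp (y \<bullet> Z 1 \<omega>)) \<le> (LINT \<omega>|M. cmod (iexp (y \<bullet> Z 1 \<omega>)))"
    by (rule integral_norm_bound)
  then have "cmod (LINT \<omega>|M. iexp (y \<bullet> Z 1 \<omega>)) \<le> 1" by (simp add: prob_space)
  then show ?thesis by (subst (asm) characteristic_function) auto
qed

text \<open>A single time would determine \<open>\<psi> 0\<close> only up to multiples of
  \<open>2 pi i / t\<close>; the identity for all \<open>t\<close> is differentiated at 0.\<close>

lemma \<psi>_0: "\<psi> 0 = 0"
proof -
  have "exp (- (complex_of_real t * \<psi> 0)) = 1" if "0 \<le> t" for t
    using characteristic_function[OF that, of 0] by (simp add: prob_space)
  then have "eventually (\<lambda>t. (1 - exp (- (complex_of_real t * \<psi> 0))) / complex_of_real t = 0) (at_right 0)"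
    by (auto simp: eventually_at_filter)
  from tendsto_cong[OF this] have "((\<lambda>t::real. 0) \<longlongrightarrow> \<psi> 0) (at_right 0)"
    using exp_difference_quotient[of "\<psi> 0"] by blast
  then show ?thesis by (simp add: tendsto_const_iff)
qed

text \<open>For the characters \<open>e_y = iexp (y \<bullet> Z t \<omega>)\<close> one has
  \<open>e_(a-b) - e_a - e_(-b) + 1 = (e_a - 1) (e_(-b) - 1)\<close>. Since
  \<open>|e_y - 1|^2 = 2 - 2 Re e_y\<close>, the inequality \<open>2|uv| \<le> |u|^2 + |v|^2\<close>
  bounds the expectation of the product by \<open>Re (1 - \<phi> a) + Re (1 - \<phi> (-b))\<close>.
  Solving for \<open>1 - \<phi> (a - b)\<close> costs the factor 2, conjugation replaces
  \<open>-b\<close> by \<open>b\<close>, and division by \<open>t\<close> with \<open>t\<close>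
  tending to 0 replaces \<open>1 - \<phi>\<close> by \<open>\<psi>\<close>.\<close>

lemma cmod_\<psi>_diff_le: "cmod (\<psi> (a - b)) \<le> 2 * cmod (\<psi> a) + 2 * cmod (\<psi> b)"
proof -
  let ?D = "\<lambda>y t. (1 - exp (- (complex_of_real t * \<psi> y))) / complex_of_real t"
  have main: "cmod (1 - exp (- (complex_of_real t * \<psi> (a - b))))
      \<le> 2 * cmod (1 - exp (- (complex_of_real t * \<psi> a))) + 2 * cmod (1 - exp (- (complex_of_real t * \<psi> b)))"
    if "0 \<le> t" for t
  proof -
    let ?e = "\<lambda>y \<omega>. iexp (y \<bullet> Z t \<omega>)" and ?\<phi> = "\<lambda>y. exp (- (complex_of_real t * \<psi> y))"
    note int [simp] = integrable_iexp[OF that]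
    have cnj_e: "cnj (?e y \<omega>) = ?e (- y) \<omega>" for y \<omega> by (simp add: exp_cnj)
    have \<phi>_minus: "?\<phi> (- y) = cnj (?\<phi> y)" for y
      using Bochner_Integration.integral_cnj[of M "?e y"] unfolding cnj_e characteristic_function[OF that] .
    have mult: "?e a \<omega> * ?e (- b) \<omega> = ?e (a - b) \<omega>" for \<omega>
      by (simp add: exp_add[symmetric] inner_diff_left algebra_simps)
    have sq: "(cmod (?e y \<omega> - 1))\<^sup>2 = 2 - 2 * Re (?e y \<omega>)" for y \<omega>
    proof -
      have "(cmod (?e y \<omega>))\<^sup>2 = 1" by simp
      then show ?thesis by (simp only: cmod_power2) (simp add: power2_diff algebra_simps)
    qed
    have "?\<phi> (a - b) - ?\<phi> a - ?\<phi> (- b) + 1 = (LINT \<omega>|M. ?e (a - b) \<omega> - ?e a \<omega> - ?e (- b) \<omega> + 1)"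
      unfolding characteristic_function[OF that, symmetric]
      using int[of "a - b"] int[of a] int[of "- b"] by (simp add: prob_space del: inner_minus_left)
    also have "\<dots> = (LINT \<omega>|M. (?e a \<omega> - 1) * (?e (- b) \<omega> - 1))"
      unfolding mult[symmetric] by (simp add: algebra_simps)
    finally have eq: "?\<phi> (a - b) - ?\<phi> a - ?\<phi> (- b) + 1 = (LINT \<omega>|M. (?e a \<omega> - 1) * (?e (- b) \<omega> - 1))" .
    have "cmod (?\<phi> (a - b) - ?\<phi> a - ?\<phi> (- b) + 1) \<le> (LINT \<omega>|M. cmod ((?e a \<omega> - 1) * (?e (- b) \<omega> - 1)))"
      unfolding eq by (rule integral_norm_bound)
    also have "\<dots> \<le> (LINT \<omega>|M. (1 - Re (?e a \<omega>)) + (1 - Re (?e (- b) \<omega>)))"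
    proof (rule integral_mono)
      have [measurable]: "Z t \<in> borel_measurable M" using Z_measurable_M that .
      have "cmod ((?e a \<omega> - 1) * (?e (- b) \<omega> - 1)) \<le> 2 * 2" for \<omega>
        unfolding norm_mult
        by (intro mult_mono order_trans[OF norm_triangle_ineq4]) auto
      then show "integrable M (\<lambda>\<omega>. cmod ((?e a \<omega> - 1) * (?e (- b) \<omega> - 1)))"
        by (intro integrable_const_bound[where B=4]) auto
      show "integrable M (\<lambda>\<omega>. (1 - Re (?e a \<omega>)) + (1 - Re (?e (- b) \<omega>)))"
        by (intro Bochner_Integration.integrable_add Bochner_Integration.integrable_diff integrable_Re int)
          auto
      fix \<omega>
      have "2 * (cmod (?e a \<omega> - 1) * cmod (?e (- b) \<omega> - 1))
          \<le> (cmod (?e a \<omega> - 1))\<^sup>2 + (cmod (?e (- b) \<omega> - 1))\<^sup>2"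
        using sum_squares_bound[of "cmod (?e a \<omega> - 1)" "cmod (?e (- b) \<omega> - 1)"] by simp
      then show "cmod ((?e a \<omega> - 1) * (?e (- b) \<omega> - 1)) \<le> (1 - Re (?e a \<omega>)) + (1 - Re (?e (- b) \<omega>))"
        unfolding sq norm_mult by linarith
    qed
    also have "\<dots> = (1 - Re (?\<phi> a)) + (1 - Re (?\<phi> (- b)))"
      unfolding characteristic_function[OF that, symmetric]
      using int[of a] int[of "- b"] by (simp add: prob_space integral_Re[symmetric] del: inner_minus_left integral_Re)
    finally have "cmod (?\<phi> (a - b) - ?\<phi> a - ?\<phi> (- b) + 1) \<le> Re (1 - ?\<phi> a) + Re (1 - ?\<phi> (- b))"
      by simp
    also have "\<dots> \<le> cmod (1 - ?\<phi> a) + cmod (1 - ?\<phi> (- b))"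
      by (intro add_mono complex_Re_le_cmod)
    finally have "cmod (1 - ?\<phi> (a - b)) \<le> 2 * cmod (1 - ?\<phi> a) + 2 * cmod (1 - ?\<phi> (- b))"
      using norm_triangle_ineq4[of "(1 - ?\<phi> a) + (1 - ?\<phi> (- b))" "?\<phi> (a - b) - ?\<phi> a - ?\<phi> (- b) + 1"]
        norm_triangle_ineq[of "1 - ?\<phi> a" "1 - ?\<phi> (- b)"] by (simp add: algebra_simps)
    moreover have "cmod (1 - ?\<phi> (- b)) = cmod (1 - ?\<phi> b)"
      unfolding \<phi>_minus by (metis complex_cnj_diff complex_cnj_one complex_mod_cnj)
    ultimately show ?thesis by simp
  qed
  have "((\<lambda>t. cmod (?D (a - b) t)) \<longlongrightarrow> cmod (\<psi> (a - b))) (at_right 0)"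
    by (intro tendsto_norm exp_difference_quotient)
  moreover have "((\<lambda>t. 2 * cmod (?D a t) + 2 * cmod (?D b t)) \<longlongrightarrow> 2 * cmod (\<psi> a) + 2 * cmod (\<psi> b)) (at_right 0)"
    by (intro tendsto_intros exp_difference_quotient)
  moreover have "eventually (\<lambda>t. cmod (?D (a - b) t) \<le> 2 * cmod (?D a t) + 2 * cmod (?D b t)) (at_right 0)"
    using eventually_at_right_less[of 0]
  proof eventually_elim
    case (elim t)
    then show ?case using divide_right_mono[OF main[of t], of t]
      by (simp add: norm_divide add_divide_distrib)
  qed
  ultimately show ?thesis by (intro tendsto_le[of "at_right (0::real)"]) auto
qed

text \<open>With \<open>w = 1 + \<psi>(y)\<close>, the integral of \<open>t \<mapsto> e\<^sup>-\<^sup>t\<^sup>w\<close> over \<open>[0,1]\<close> and the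
  value of \<open>e\<^sup>-\<^sup>w\<close> determine \<open>w\<close>, and both are continuous in \<open>y\<close>.\<close>

lemma continuous_on_\<psi>: "continuous_on UNIV \<psi>"
  unfolding continuous_on_sequentially
proof (intro allI ballI impI, elim conjE)
  fix y and x :: "nat \<Rightarrow> real ^ 'm" assume lim: "x \<longlonglongrightarrow> y"
  have \<phi>: "(\<lambda>n. exp (- (complex_of_real t * \<psi> (x n)))) \<longlonglongrightarrow> exp (- (complex_of_real t * \<psi> y))"
    if "0 \<le> t" for t
    unfolding characteristic_function[OF that, symmetric]
  proof (rule integral_dominated_convergence[where w="\<lambda>_. 1"])
    have [measurable]: "Z t \<in> borel_measurable M" using Z_measurable_M that .
    show "(\<lambda>\<omega>. iexp (y \<bullet> Z t \<omega>)) \<in> borel_measurable M" by measurable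
    show "(\<lambda>\<omega>. iexp (x n \<bullet> Z t \<omega>)) \<in> borel_measurable M" for n by measurable
    show "AE \<omega> in M. (\<lambda>n. iexp (x n \<bullet> Z t \<omega>)) \<longlonglongrightarrow> iexp (y \<bullet> Z t \<omega>)"
      using lim by (intro AE_I2) (auto intro!: tendsto_intros)
  qed auto
  \<comment> \<open>The shift gives \<open>Re (w z) \<ge> 1\<close>: then \<open>w z\<close> is
    nonzero, the exponentials are dominated by 1, and \<open>exp (- w z)\<close> has modulus below
    1, so \<open>1 - exp (- w z)\<close> is nonzero as well.\<close>
  define w where "w z = 1 + \<psi> z" for z
  have Re_w: "1 \<le> Re (w z)" for z using Re_\<psi>_nonneg[of z] by (simp add: w_def)
  then have w0: "w z \<noteq> 0" for z by (metis not_one_le_zero zero_complex.sel(1))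
  have e_w: "exp (- (complex_of_real t * w z)) = exp (- complex_of_real t) * exp (- (complex_of_real t * \<psi> z))" for t z
    by (simp add: w_def exp_add[symmetric] algebra_simps)
  have lim_w: "(\<lambda>n. exp (- (complex_of_real t * w (x n)))) \<longlonglongrightarrow> exp (- (complex_of_real t * w y))" if "0 \<le> t" for t
    unfolding e_w by (intro tendsto_intros \<phi> that)
  have int: "((\<lambda>t. exp (- (complex_of_real t * w z))) has_integral (1 - exp (- w z)) / w z) {0..1}" for z
  proof -
    have "((\<lambda>t. exp (- (complex_of_real t * w z))) has_integral
        (- exp (- (complex_of_real 1 * w z)) / w z) - (- exp (- (complex_of_real 0 * w z)) / w z)) {0..1}"
      by (rule fundamental_theorem_of_calculus)
        (use w0 in \<open>auto intro!: derivative_eq_intros has_vector_derivative_real_field\<close>)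
    then show ?thesis by (simp add: diff_divide_distrib)
  qed
  have "(\<lambda>n. integral {0..1} (\<lambda>t. exp (- (complex_of_real t * w (x n)))))
      \<longlonglongrightarrow> integral {0..1} (\<lambda>t. exp (- (complex_of_real t * w y)))"
  proof (rule dominated_convergence(2)[where h="\<lambda>_. 1"])
    show "norm (exp (- (complex_of_real t * w (x n)))) \<le> 1" if "t \<in> {0..1}" for t n
      using that Re_w[of "x n"] by simp
  qed (use int lim_w in \<open>auto simp: integrable_on_def\<close>)
  then have quot: "(\<lambda>n. (1 - exp (- w (x n))) / w (x n)) \<longlonglongrightarrow> (1 - exp (- w y)) / w y"
    unfolding integral_unique[OF int] .
  have e1: "(\<lambda>n. 1 - exp (- w (x n))) \<longlonglongrightarrow> 1 - exp (- w y)"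
    using tendsto_diff[OF tendsto_const[of 1] lim_w[of 1]] by simp
  have ne: "1 - exp (- w z) \<noteq> 0" for z
  proof
    assume "1 - exp (- w z) = 0"
    then have "cmod (exp (- w z)) = 1" by simp
    then show False using Re_w[of z] by simp
  qed
  have "(1 - exp (- w y)) / w y \<noteq> 0" using ne w0 by simp
  from tendsto_divide[OF e1 quot this] have "(\<lambda>n. w (x n)) \<longlonglongrightarrow> w y" using ne w0 by simp
  then have "(\<lambda>n. w (x n) - 1) \<longlonglongrightarrow> w y - 1" by (intro tendsto_intros)
  then show "(\<psi> \<circ> x) \<longlonglongrightarrow> \<psi> y" by (simp add: w_def o_def)
qed

lemma borel_measurable_\<psi> [measurable]: "\<psi> \<in> borel_measurable borel"
  using continuous_on_\<psi> by (rule borel_measurable_continuous_onI)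

lemma \<psi>_bounded_on_cball: obtains B where "0 < B" "\<And>y. norm y \<le> c \<Longrightarrow> cmod (\<psi> y) \<le> B"
proof -
  have "bounded (\<psi> ` cball 0 c)"
    by (intro compact_imp_bounded compact_continuous_image continuous_on_subset[OF continuous_on_\<psi>]) auto
  then show thesis using that by (auto simp: bounded_pos)
qed

text \<open>Viewed as a map into the coarser space \<open>F s\<close>, the identity is independent
  of the increment, so the joint law is a product. By Fubini \<open>W\<close> may be frozen;
  integrating out the increment gives \<open>exp (- (t - s) \<psi> (W \<omega>))\<close>, which
  cancels the compensator.\<close>

lemma independent_increment_exp:
  fixes U :: "'w \<Rightarrow> complex" and W :: "'w \<Rightarrow> real ^ 'm"
  assumes st: "0 \<le> s" "s \<le> t"
    and U [measurable]: "U \<in> borel_measurable (F s)" and Ub: "\<And>\<omega>. cmod (U \<omega>) \<le> C"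
    and W [measurable]: "W \<in> borel_measurable (F s)" and Wb: "\<And>\<omega>. norm (W \<omega>) \<le> D"
  shows "(LINT \<omega>|M. U \<omega> * exp (\<i> * complex_of_real (W \<omega> \<bullet> (Z t \<omega> - Z s \<omega>)) + complex_of_real (t - s) * \<psi> (W \<omega>)))
    = (LINT \<omega>|M. U \<omega>)"
proof -
  let ?X = "\<lambda>\<omega>. Z t \<omega> - Z s \<omega>"
  have [measurable]: "Z t \<in> borel_measurable M" "Z s \<in> borel_measurable M"
    using Z_measurable_M st by auto
  have id_meas: "(\<lambda>\<omega>. \<omega>) \<in> measurable M (F s)"
  proof (rule measurableI)
    fix A assume A: "A \<in> sets (F s)"
    then have "(\<lambda>\<omega>. \<omega>) -` A \<inter> space M = A" using sets.sets_into_space[OF A] by (auto simp: space_F)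
    with A show "(\<lambda>\<omega>. \<omega>) -` A \<inter> space M \<in> sets M" using sets_F_subset by auto
  qed (simp add: space_F)
  have "indep_set (sets (F s)) {?X -` B \<inter> space M | B. B \<in> sets borel}"
    using levy st by (simp add: levy_process_def)
  then have indep: "prob (A \<inter> (?X -` B \<inter> space M)) = prob A * prob (?X -` B \<inter> space M)"
    if "A \<in> sets (F s)" "B \<in> sets borel" for A B
    using that unfolding indep_sets2_eq by blast
  let ?P = "distr M (F s) (\<lambda>\<omega>. \<omega>)" and ?Q = "distr M borel ?X"
  interpret P: prob_space ?P by (rule prob_space_distr[OF id_meas])
  interpret Q: prob_space ?Q by (rule prob_space_distr) measurable
  interpret PQ: pair_prob_space ?P ?Q ..
  have joint: "?P \<Otimes>\<^sub>M ?Q = distr M (F s \<Otimes>\<^sub>M borel) (\<lambda>\<omega>. (\<omega>, ?X \<omega>))"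
  proof (rule pair_measure_eqI)
    fix A B assume AB: "A \<in> sets ?P" "B \<in> sets ?Q"
    then have A: "(\<lambda>\<omega>. \<omega>) -` A \<inter> space M = A" "A \<in> sets M"
      using sets.sets_into_space[of A "F s"] sets_F_subset by (auto simp: space_F)
    have "emeasure ?P A * emeasure ?Q B = ennreal (prob A * prob (?X -` B \<inter> space M))"
      using AB A id_meas by (simp add: emeasure_distr emeasure_eq_measure ennreal_mult)
    also have "\<dots> = emeasure M (A \<inter> (?X -` B \<inter> space M))"
      using AB by (simp add: indep emeasure_eq_measure)
    also have "A \<inter> (?X -` B \<inter> space M) = (\<lambda>\<omega>. (\<omega>, ?X \<omega>)) -` (A \<times> B) \<inter> space M"
      using A by auto
    also have "emeasure M \<dots> = emeasure (distr M (F s \<Otimes>\<^sub>M borel) (\<lambda>\<omega>. (\<omega>, ?X \<omega>))) (A \<times> B)"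
      using AB by (subst emeasure_distr) (auto intro!: measurable_Pair id_meas)
    finally show "emeasure ?P A * emeasure ?Q B
        = emeasure (distr M (F s \<Otimes>\<^sub>M borel) (\<lambda>\<omega>. (\<omega>, ?X \<omega>))) (A \<times> B)" .
  qed (auto intro: P.sigma_finite_measure_axioms Q.sigma_finite_measure_axioms)
  let ?f = "\<lambda>p. U (fst p) * exp (\<i> * complex_of_real (W (fst p) \<bullet> snd p) + complex_of_real (t - s) * \<psi> (W (fst p)))"
  have f_meas: "?f \<in> borel_measurable (F s \<Otimes>\<^sub>M borel)" by measurable
  \<comment> \<open>The compensator is not of modulus one; it is bounded because \<open>W\<close>
    stays in a ball, and this makes Fubini applicable.\<close>
  obtain B where B: "0 < B" "\<And>y. norm y \<le> D \<Longrightarrow> cmod (\<psi> y) \<le> B"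
    using \<psi>_bounded_on_cball[of D] by blast
  have C: "0 \<le> C" using Ub by (rule order_trans[OF norm_ge_zero])
  have f_bound: "cmod (?f p) \<le> C * exp ((t - s) * B)" for p
  proof -
    have "Re (\<psi> (W (fst p))) \<le> B"
      using complex_Re_le_cmod[of "\<psi> (W (fst p))"] B(2)[OF Wb, of "fst p"] by linarith
    then show ?thesis using st C
      by (simp only: norm_mult norm_exp_eq_Re) (intro mult_mono Ub, auto intro!: mult_left_mono)
  qed
  have "(LINT \<omega>|M. U \<omega> * exp (\<i> * complex_of_real (W \<omega> \<bullet> ?X \<omega>) + complex_of_real (t - s) * \<psi> (W \<omega>)))
      = (LINT p|distr M (F s \<Otimes>\<^sub>M borel) (\<lambda>\<omega>. (\<omega>, ?X \<omega>)). ?f p)"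
    by (subst integral_distr[OF _ f_meas]) (auto intro!: measurable_Pair id_meas)
  also have "\<dots> = (LINT p|(?P \<Otimes>\<^sub>M ?Q). ?f p)" by (simp only: joint)
  also have "\<dots> = (LINT \<omega>|?P. LINT z|?Q. ?f (\<omega>, z))"
    by (rule PQ.integral_fst'[symmetric])
      (rule PQ.integrable_const_bound[where B="C * exp ((t - s) * B)"], use f_meas f_bound in \<open>auto cong: measurable_cong_sets\<close>)
  also have "\<dots> = (LINT \<omega>|?P. U \<omega>)"
  proof (rule Bochner_Integration.integral_cong[OF refl])
    fix \<omega>
    have "?Q = distr M borel (Z (t - s))" using levy st by (simp add: levy_process_def)
    then have "(LINT z|?Q. iexp (W \<omega> \<bullet> z)) = (LINT z|distr M borel (Z (t - s)). iexp (W \<omega> \<bullet> z))"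
      by simp
    also have "\<dots> = exp (- (complex_of_real (t - s) * \<psi> (W \<omega>)))"
      using Z_measurable_M[of "t - s"] st
      by (subst integral_distr) (auto simp: characteristic_function)
    finally have "(LINT z|?Q. iexp (W \<omega> \<bullet> z)) = exp (- (complex_of_real (t - s) * \<psi> (W \<omega>)))" .
    then show "(LINT z|?Q. ?f (\<omega>, z)) = U \<omega>"
      by (simp add: exp_add mult.assoc[symmetric] mult_exp_exp[symmetric] exp_minus del: of_real_diff)
  qed
  also have "\<dots> = (LINT \<omega>|M. U \<omega>)" by (rule integral_distr[OF id_meas U])
  finally show ?thesis .
qed

end

section \<open>Stopping at random times\<close>

text \<open>For \<open>x \<ge> 0\<close> this is the least multiple of \<open>1 / 2 ^ j\<close>
  strictly above \<open>x\<close>. Strictness makes the approximation converge within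
  \<open>at_right x\<close>, where right continuity applies.\<close>

definition dyadic_above :: "nat \<Rightarrow> real \<Rightarrow> real" where
  "dyadic_above j x = (real (nat \<lfloor>2 ^ j * x\<rfloor>) + 1) / 2 ^ j"

lemma dyadic_above_gt: "x < dyadic_above j x"
proof -
  have "2 ^ j * x < real (nat \<lfloor>2 ^ j * x\<rfloor>) + 1" by linarith
  then show ?thesis by (simp add: dyadic_above_def pos_less_divide_eq mult.commute)
qed

lemma dyadic_above_le: "0 \<le> x \<Longrightarrow> dyadic_above j x \<le> x + 1 / 2 ^ j"
proof -
  assume "0 \<le> x"
  then have "0 \<le> 2 ^ j * x" by simp
  then have "real (nat \<lfloor>2 ^ j * x\<rfloor>) \<le> 2 ^ j * x" by linarith
  then show ?thesis by (simp add: dyadic_above_def add_divide_distrib pos_divide_le_eq mult.commute)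
qed

lemma filterlim_dyadic_above:
  assumes "0 \<le> x"
  shows "filterlim (\<lambda>j. dyadic_above j x) (at_right x) sequentially"
  unfolding filterlim_at
proof
  show "(\<lambda>j. dyadic_above j x) \<longlonglongrightarrow> x"
  proof (rule tendsto_sandwich[of "\<lambda>_. x"])
    show "(\<lambda>j. x + 1 / 2 ^ j) \<longlonglongrightarrow> x"
      using tendsto_add[OF tendsto_const[of x] LIMSEQ_inverse_realpow_zero[of 2]]
      by (simp add: divide_inverse power_inverse)
  qed (use assms in \<open>auto intro!: always_eventually dyadic_above_le less_imp_le[OF dyadic_above_gt]\<close>)
  show "\<forall>\<^sub>F j in sequentially. dyadic_above j x \<in> {x<..} \<and> dyadic_above j x \<noteq> x"
    using dyadic_above_gt by (auto intro!: always_eventually simp: less_imp_neq[symmetric])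
qed

lemma right_continuous_dyadic_above:
  "0 \<le> t \<Longrightarrow> continuous (at_right t) f \<Longrightarrow> (\<lambda>j. f (dyadic_above j t)) \<longlonglongrightarrow> f t"
  unfolding continuous_within by (rule filterlim_compose[OF _ filterlim_dyadic_above])

context levy_basis
begin

text \<open>Evaluation at the dyadic approximations involves only countably many times; right
  continuity identifies the limit almost surely, and completeness covers the exceptional
  set.\<close>

lemma measurable_at_random_time:
  fixes Y :: "real \<Rightarrow> 'w \<Rightarrow> 'b::{banach, second_countable_topology}"
  assumes Y: "\<And>t. 0 \<le> t \<Longrightarrow> Y t \<in> borel_measurable M"
    and rc: "AE \<omega> in M. \<forall>t\<ge>0. continuous (at_right t) (\<lambda>s. Y s \<omega>)"
    and T [measurable]: "T \<in> borel_measurable M" and T0: "\<And>\<omega>. 0 \<le> T \<omega>"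
  shows "(\<lambda>\<omega>. Y (T \<omega>) \<omega>) \<in> borel_measurable M"
proof (rule borel_measurable_AE_limit)
  fix j
  have "(\<lambda>\<omega>. Y ((real (nat \<lfloor>2 ^ j * T \<omega>\<rfloor>) + 1) / 2 ^ j) \<omega>) \<in> borel_measurable M"
    by (rule measurable_compose_countable[where f="\<lambda>i \<omega>. Y ((real i + 1) / 2 ^ j) \<omega>"])
      (measurable, auto intro: Y)
  then show "(\<lambda>\<omega>. Y (dyadic_above j (T \<omega>)) \<omega>) \<in> borel_measurable M"
    by (simp add: dyadic_above_def)
next
  show "AE \<omega> in M. (\<lambda>j. Y (dyadic_above j (T \<omega>)) \<omega>) \<longlonglongrightarrow> Y (T \<omega>) \<omega>"
    using rc
  proof eventually_elim
    case (elim \<omega>)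
    with T0[of \<omega>] show ?case by (intro right_continuous_dyadic_above[of _ "\<lambda>s. Y s \<omega>"]) auto
  qed
qed

lemma stopping_time_measurable_M: "stopping_time F T \<Longrightarrow> T \<in> borel_measurable M"
  for T :: "'w \<Rightarrow> real"
  by (rule measurable_stopping_time[OF _ sets_F_subset space_F])

text \<open>The approximation \<open>dyadic_above j (T \<omega>)\<close> takes finitely many values,
  and the event that it equals \<open>?t i\<close> belongs to \<open>F (?t i)\<close>; on that event
  \<open>mart\<close> moves the time to the fixed horizon. Right continuity and the uniform bound
  then give \<open>T\<close> itself. The horizon is \<open>b + 1\<close> because the approximation
  overshoots by up to \<open>1 / 2 ^ j\<close>.\<close>

lemma optional_stopping:
  fixes V :: "real \<Rightarrow> 'w \<Rightarrow> complex"
  assumes V: "\<And>t. 0 \<le> t \<Longrightarrow> V t \<in> borel_measurable (F t)"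
    and bd: "\<And>t \<omega>. 0 \<le> t \<Longrightarrow> t \<le> b + 1 \<Longrightarrow> cmod (V t \<omega>) \<le> C"
    and rc: "AE \<omega> in M. \<forall>t\<ge>0. continuous (at_right t) (\<lambda>s. V s \<omega>)"
    and mart: "\<And>s t A. 0 \<le> s \<Longrightarrow> s \<le> t \<Longrightarrow> A \<in> sets (F s) \<Longrightarrow>
      (LINT \<omega>|M. indicator A \<omega> * V t \<omega>) = (LINT \<omega>|M. indicator A \<omega> * V s \<omega>)"
    and T: "stopping_time F T" and T0: "\<And>\<omega>. 0 \<le> T \<omega>" and Tb: "\<And>\<omega>. T \<omega> \<le> b"
  shows "(LINT \<omega>|M. V (T \<omega>) \<omega>) = (LINT \<omega>|M. V 0 \<omega>)"
proof -
  have [measurable]: "T \<in> borel_measurable M" using T by (rule stopping_time_measurable_M)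
  have VM: "V t \<in> borel_measurable M" if "0 \<le> t" for t using V[OF that] by (rule measurable_F_imp_M)
  have b0: "0 \<le> b" using T0 Tb order_trans by blast
  have const: "(LINT \<omega>|M. V t \<omega>) = (LINT \<omega>|M. V 0 \<omega>)" if "0 \<le> t" for t
  proof -
    have "(LINT \<omega>|M. V t \<omega>) = (LINT \<omega>|M. indicator (space M) \<omega> * V t \<omega>)"
      by (rule Bochner_Integration.integral_cong) auto
    also have "\<dots> = (LINT \<omega>|M. indicator (space M) \<omega> * V 0 \<omega>)"
      using that by (intro mart) (auto simp: space_F[of 0, symmetric])
    also have "\<dots> = (LINT \<omega>|M. V 0 \<omega>)"
      by (rule Bochner_Integration.integral_cong) auto
    finally show ?thesis .
  qed
  have dyadic: "(LINT \<omega>|M. V (dyadic_above j (T \<omega>)) \<omega>) = (LINT \<omega>|M. V (b + 1) \<omega>)" for j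
  proof -
    let ?N = "nat \<lfloor>2 ^ j * b\<rfloor>" and ?I = "\<lambda>\<omega>. nat \<lfloor>2 ^ j * T \<omega>\<rfloor>"
    let ?A = "\<lambda>i. {\<omega> \<in> space M. ?I \<omega> = i}" and ?t = "\<lambda>i. (real i + 1) / 2 ^ j"
    have IN: "?I \<omega> \<le> ?N" for \<omega>
      using Tb[of \<omega>] by (intro nat_mono floor_mono) auto
    have tN: "0 \<le> ?t i" "i \<le> ?N \<Longrightarrow> ?t i \<le> b + 1" for i
    proof -
      assume "i \<le> ?N"
      moreover have "real ?N \<le> 2 ^ j * b" using b0 by (simp add: of_nat_floor)
      ultimately have "real i + 1 \<le> 2 ^ j * b + 2 ^ j"
        by (smt (verit) of_nat_mono one_le_power)
      then show "?t i \<le> b + 1" by (simp add: pos_divide_le_eq algebra_simps)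
    qed simp
    have A: "?A i \<in> sets (F (?t i))" for i
    proof -
      \<comment> \<open>Written with strict comparisons of \<open>T\<close> only, the event is
        decided by time \<open>?t i\<close>.\<close>
      have eq: "?I \<omega> = i \<longleftrightarrow> \<not> T \<omega> < real i / 2 ^ j \<and> T \<omega> < ?t i" for \<omega>
      proof -
        have "0 \<le> 2 ^ j * T \<omega>" using T0[of \<omega>] by simp
        then have "?I \<omega> = i \<longleftrightarrow> real i \<le> 2 ^ j * T \<omega> \<and> 2 ^ j * T \<omega> < real i + 1"
          by (auto simp: nat_eq_iff floor_eq_iff)
        then show ?thesis by (simp add: not_less pos_divide_le_eq pos_less_divide_eq mult.commute)
      qed
      have "Measurable.pred (F (real i / 2 ^ j)) (\<lambda>\<omega>. \<not> T \<omega> < real i / 2 ^ j)"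
        using stopping_time_less_const[OF T] by (rule pred_intros_logic)
      then have "Measurable.pred (F (?t i)) (\<lambda>\<omega>. \<not> T \<omega> < real i / 2 ^ j)"
        by (rule measurable_F_mono) (simp add: divide_right_mono)
      from this stopping_time_less_const[OF T, of "?t i"]
      have "Measurable.pred (F (?t i)) (\<lambda>\<omega>. \<not> T \<omega> < real i / 2 ^ j \<and> T \<omega> < ?t i)"
        by (rule pred_intros_logic)
      then show ?thesis unfolding eq pred_def space_F .
    qed
    have split: "V (dyadic_above j (T \<omega>)) \<omega> = (\<Sum>i\<le>?N. indicator (?A i) \<omega> * V (?t i) \<omega>)"
      if "\<omega> \<in> space M" for \<omega>
      using that IN[of \<omega>] by (simp add: indicator_def dyadic_above_def sum.delta' if_distrib[of "\<lambda>x. x * _"] cong: if_cong)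
    have split1: "V (b + 1) \<omega> = (\<Sum>i\<le>?N. indicator (?A i) \<omega> * V (b + 1) \<omega>)"
      if "\<omega> \<in> space M" for \<omega>
      using that IN[of \<omega>] by (simp add: indicator_def sum.delta' if_distrib[of "\<lambda>x. x * _"] cong: if_cong)
    have int: "integrable M (\<lambda>\<omega>. indicator (?A i) \<omega> * V s \<omega>)" if "0 \<le> s" "s \<le> b + 1" for i s
    proof (rule integrable_const_bound)
      have [measurable]: "V s \<in> borel_measurable M" using VM that by simp
      show "(\<lambda>\<omega>. indicator (?A i) \<omega> * V s \<omega>) \<in> borel_measurable M" by measurable
      show "AE \<omega> in M. cmod (indicator (?A i) \<omega> * V s \<omega>) \<le> C"
        using bd[OF that] order_trans[OF norm_ge_zero bd[OF that]] by (intro AE_I2) (auto simp: indicator_def)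
    qed
    have "(LINT \<omega>|M. V (dyadic_above j (T \<omega>)) \<omega>) = (LINT \<omega>|M. (\<Sum>i\<le>?N. indicator (?A i) \<omega> * V (?t i) \<omega>))"
      by (rule Bochner_Integration.integral_cong[OF refl split])
    also have "\<dots> = (\<Sum>i\<le>?N. LINT \<omega>|M. indicator (?A i) \<omega> * V (?t i) \<omega>)"
      using tN by (intro Bochner_Integration.integral_sum int) auto
    also have "\<dots> = (\<Sum>i\<le>?N. LINT \<omega>|M. indicator (?A i) \<omega> * V (b + 1) \<omega>)"
      using tN A by (intro sum.cong refl mart[symmetric]) auto
    also have "\<dots> = (LINT \<omega>|M. (\<Sum>i\<le>?N. indicator (?A i) \<omega> * V (b + 1) \<omega>))"
      using b0 by (intro Bochner_Integration.integral_sum[symmetric] int) auto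
    also have "\<dots> = (LINT \<omega>|M. V (b + 1) \<omega>)"
      by (rule Bochner_Integration.integral_cong[OF refl split1[symmetric]])
    finally show ?thesis .
  qed
  have "(\<lambda>j. LINT \<omega>|M. V (dyadic_above j (T \<omega>)) \<omega>) \<longlonglongrightarrow> (LINT \<omega>|M. V (T \<omega>) \<omega>)"
  proof (rule integral_dominated_convergence[where w="\<lambda>_. C"])
    show "(\<lambda>\<omega>. V (T \<omega>) \<omega>) \<in> borel_measurable M"
      by (rule measurable_at_random_time[OF VM rc _ T0]) auto
    show "(\<lambda>\<omega>. V (dyadic_above j (T \<omega>)) \<omega>) \<in> borel_measurable M" for j
      unfolding dyadic_above_def
      by (rule measurable_compose_countable[where f="\<lambda>i \<omega>. V ((real i + 1) / 2 ^ j) \<omega>"])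
        (measurable, auto intro: VM)
    show "AE \<omega> in M. (\<lambda>j. V (dyadic_above j (T \<omega>)) \<omega>) \<longlonglongrightarrow> V (T \<omega>) \<omega>"
      using rc
    proof eventually_elim
      case (elim \<omega>)
      with T0[of \<omega>] show ?case by (intro right_continuous_dyadic_above[of _ "\<lambda>s. V s \<omega>"]) auto
    qed
    have "dyadic_above j (T \<omega>) \<le> b + 1" for j \<omega>
    proof -
      have "1 / 2 ^ j \<le> (1::real)" by simp
      then show ?thesis using dyadic_above_le[OF T0, of j \<omega>] Tb[of \<omega>] by linarith
    qed
    moreover have "0 \<le> dyadic_above j (T \<omega>)" for j \<omega>
      using T0[of \<omega>] dyadic_above_gt[of "T \<omega>" j] by linarith
    ultimately show "AE \<omega> in M. cmod (V (dyadic_above j (T \<omega>)) \<omega>) \<le> C" for j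
      using bd by (intro AE_I2) blast
  qed simp
  then have "(LINT \<omega>|M. V (b + 1) \<omega>) = (LINT \<omega>|M. V (T \<omega>) \<omega>)"
    unfolding dyadic by (simp add: LIMSEQ_const_iff)
  with const[of "b + 1"] b0 show ?thesis by simp
qed

end

section \<open>The exponential martingale\<close>

lemma transpose_mult_inner: "(transpose A *v x) \<bullet> y = x \<bullet> (A *v y)"
  for A :: "real ^ 'm ^ 'd"
  by (simp add: dot_lmul_matrix)

lemma linear_transpose_mult: "linear (\<lambda>A :: real ^ 'm ^ 'd. transpose A *v x)"
  by (auto simp: linear_iff vector_matrix_mult_def vec_eq_iff algebra_simps sum.distrib sum_distrib_left)

lemma continuous_on_transpose_mult: "continuous_on S (\<lambda>A :: real ^ 'm ^ 'd. transpose A *v x)"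
  by (rule linear_continuous_on[OF linear_conv_bounded_linear[THEN iffD1, OF linear_transpose_mult]])

lemma borel_measurable_matrix_vector_mult [measurable (raw)]:
  fixes f :: "'a \<Rightarrow> real ^ 'm ^ 'd"
  assumes "f \<in> borel_measurable N" "g \<in> borel_measurable N"
  shows "(\<lambda>x. f x *v g x) \<in> borel_measurable N"
  using assms
  by (rule borel_measurable_continuous_Pair) (simp add: matrix_vector_mult_def, intro continuous_intros)

lemma borel_measurable_transpose_mult:
  fixes f :: "'a \<Rightarrow> real ^ 'm ^ 'd"
  shows "f \<in> borel_measurable N \<Longrightarrow> (\<lambda>x. transpose (f x) *v \<xi>) \<in> borel_measurable N"
  by (rule measurable_compose[OF _ borel_measurable_continuous_onI[OF continuous_on_transpose_mult]])

lemma bounded_transpose_mult: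
  fixes \<xi> :: "real ^ 'd"
  obtains D where "\<And>A :: real ^ 'm ^ 'd. norm A \<le> c \<Longrightarrow> norm (transpose A *v \<xi>) \<le> D"
proof -
  obtain B where B: "0 < B" "\<And>A :: real ^ 'm ^ 'd. norm (transpose A *v \<xi>) \<le> B * norm A"
    using linear_bounded_pos[OF linear_transpose_mult[of \<xi>]] by blast
  then have "norm (transpose A *v \<xi>) \<le> B * c" if "norm A \<le> c" for A :: "real ^ 'm ^ 'd"
    using that by (meson less_imp_le mult_left_mono order_trans)
  with that show thesis by blast
qed

lemma right_continuous_min:
  fixes f :: "real \<Rightarrow> 'b::t2_space"
  assumes "continuous (at_right t) f"
  shows "continuous (at_right t) (\<lambda>s. f (min s c))"
proof (cases "t < c")
  case True
  then have "eventually (\<lambda>s. f s = f (min s c)) (at_right t)"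
    unfolding eventually_at_right_field by (intro exI[of _ c]) auto
  with assms True show ?thesis
    unfolding continuous_within by (auto simp: tendsto_cong)
next
  case False
  then have "eventually (\<lambda>s. f c = f (min s c)) (at_right t)"
    by (auto simp: eventually_at_filter)
  with False show ?thesis
    unfolding continuous_within using tendsto_cong by fastforce
qed

lemma left_limit_min:
  fixes f :: "real \<Rightarrow> 'b::t2_space"
  assumes "(f \<longlongrightarrow> l) (at_left t)"
  shows "\<exists>l. ((\<lambda>s. f (min s c)) \<longlongrightarrow> l) (at_left t)"
proof (cases "t \<le> c")
  case True
  then have "eventually (\<lambda>s. f s = f (min s c)) (at_left t)"
    by (auto simp: eventually_at_filter)
  with assms show ?thesis by (auto simp: tendsto_cong)
next
  case False
  then have "eventually (\<lambda>s. f c = f (min s c)) (at_left t)"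
    unfolding eventually_at_left_field by (intro exI[of _ c]) auto
  with tendsto_cong show ?thesis by fastforce
qed

section \<open>Elementary integrands\<close>

context levy_basis
begin

lemma AE_Z_right_continuous: "AE \<omega> in M. \<forall>t\<ge>0. continuous (at_right t) (\<lambda>s. Z s \<omega>)"
  using levy unfolding levy_process_def cadlag_def by auto

text \<open>Exponent of the exponential martingale of an elementary integrand, with
  \<open>w k\<close> in the role of \<open>transpose (A k \<omega>) *v \<xi>\<close>. The minima
  make the \<open>k\<close>-th term vanish before \<open>\<tau> k\<close> and freeze it after
  \<open>\<tau> (Suc k)\<close>.\<close>

definition elementary_exponent ::
    "nat \<Rightarrow> (nat \<Rightarrow> real) \<Rightarrow> (nat \<Rightarrow> 'w \<Rightarrow> real ^ 'm) \<Rightarrow> real \<Rightarrow> 'w \<Rightarrow> complex" where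
  "elementary_exponent n \<tau> w t \<omega> = (\<Sum>k<n.
     \<i> * complex_of_real (w k \<omega> \<bullet> (Z (min t (\<tau> (Suc k))) \<omega> - Z (min t (\<tau> k)) \<omega>))
     + complex_of_real (min t (\<tau> (Suc k)) - min t (\<tau> k)) * \<psi> (w k \<omega>))"

context
  fixes \<tau> :: "nat \<Rightarrow> real" and w :: "nat \<Rightarrow> 'w \<Rightarrow> real ^ 'm" and D :: "nat \<Rightarrow> real"
  assumes \<tau>0: "0 \<le> \<tau> 0" and \<tau>: "incseq \<tau>"
    and w: "\<And>k. w k \<in> borel_measurable (F (\<tau> k))"
    and D: "\<And>k \<omega>. norm (w k \<omega>) \<le> D k"
begin

lemma \<tau>_nonneg: "0 \<le> \<tau> k"
  using \<tau>0 incseqD[OF \<tau>, of 0 k] by simp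

lemma \<tau>_Suc: "\<tau> k \<le> \<tau> (Suc k)"
  using \<tau> by (rule incseq_SucD)

text \<open>For \<open>t < \<tau> k\<close> the weight \<open>w k\<close> need not be known at time
  \<open>t\<close>, but then both minima equal \<open>t\<close> and the term is zero.\<close>

lemma elementary_exponent_measurable:
  assumes "0 \<le> t"
  shows "elementary_exponent n \<tau> w t \<in> borel_measurable (F t)"
  unfolding elementary_exponent_def
proof (rule borel_measurable_sum)
  fix k
  show "(\<lambda>\<omega>. \<i> * complex_of_real (w k \<omega> \<bullet> (Z (min t (\<tau> (Suc k))) \<omega> - Z (min t (\<tau> k)) \<omega>))
     + complex_of_real (min t (\<tau> (Suc k)) - min t (\<tau> k)) * \<psi> (w k \<omega>)) \<in> borel_measurable (F t)"
  proof (cases "\<tau> k \<le> t")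
    case True
    have [measurable]: "w k \<in> borel_measurable (F t)" using w True by (rule measurable_F_mono)
    have Zm: "Z (min t (\<tau> i)) \<in> borel_measurable (F t)" for i
      using Z_measurable[of "min t (\<tau> i)"] assms \<tau>_nonneg by (auto intro: measurable_F_mono)
    note [measurable] = Zm[of k] Zm[of "Suc k"]
    show ?thesis by measurable
  next
    case False
    then have "min t (\<tau> (Suc k)) = t" "min t (\<tau> k) = t" using \<tau>_Suc[of k] by auto
    then show ?thesis by simp
  qed
qed

text \<open>The stochastic terms are purely imaginary; only the real part of \<open>\<psi>\<close>
  at the bounded weights, times lengths at most \<open>b\<close>, affects the modulus.\<close>

lemma exp_elementary_exponent_bounded:
  "\<exists>C. \<forall>t \<omega>. 0 \<le> t \<longrightarrow> t \<le> b \<longrightarrow> cmod (exp (elementary_exponent n \<tau> w t \<omega>)) \<le> C"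
proof (induction n)
  case 0
  show ?case by (auto simp: elementary_exponent_def intro!: exI[of _ 1])
next
  case (Suc n)
  then obtain C where C: "\<And>t \<omega>. 0 \<le> t \<Longrightarrow> t \<le> b \<Longrightarrow> cmod (exp (elementary_exponent n \<tau> w t \<omega>)) \<le> C"
    by blast
  obtain B where B: "0 < B" "\<And>y. norm y \<le> D n \<Longrightarrow> cmod (\<psi> y) \<le> B"
    using \<psi>_bounded_on_cball[of "D n"] by blast
  have "cmod (exp (elementary_exponent (Suc n) \<tau> w t \<omega>)) \<le> C * exp (b * B)" if t: "0 \<le> t" "t \<le> b" for t \<omega>
  proof -
    have r: "Re (\<psi> (w n \<omega>)) \<le> B"
      using complex_Re_le_cmod[of "\<psi> (w n \<omega>)"] B(2)[OF D, of \<omega>] by linarith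
    have "0 \<le> min t (\<tau> (Suc n)) - min t (\<tau> n)" "min t (\<tau> (Suc n)) - min t (\<tau> n) \<le> b"
      using t \<tau>_Suc[of n] \<tau>_nonneg[of n] by linarith+
    then have "(min t (\<tau> (Suc n)) - min t (\<tau> n)) * Re (\<psi> (w n \<omega>)) \<le> b * B"
      using r Re_\<psi>_nonneg B(1) by (intro mult_mono) auto
    with C[OF t, of \<omega>] order_trans[OF norm_ge_zero C[OF t, of \<omega>]] show ?thesis
      by (simp add: elementary_exponent_def exp_add norm_mult del: of_real_diff)
        (intro mult_mono, auto)
  qed
  then show ?case by blast
qed

text \<open>Induction on the number of pieces. Up to \<open>\<tau> n\<close> the last piece is
  absent and the induction hypothesis applies; from \<open>\<tau> n\<close> on all earlier pieces
  are frozen, so the exponential at time \<open>s\<close> joins the weight \<open>U\<close> and the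
  independent increment does the rest. An interval containing \<open>\<tau> n\<close> is split
  there.\<close>

lemma exp_elementary_exponent_martingale:
  fixes U :: "'w \<Rightarrow> complex"
  assumes "0 \<le> s" "s \<le> t" "U \<in> borel_measurable (F s)" "\<And>\<omega>. cmod (U \<omega>) \<le> 1"
  shows "(LINT \<omega>|M. U \<omega> * exp (elementary_exponent n \<tau> w t \<omega>))
    = (LINT \<omega>|M. U \<omega> * exp (elementary_exponent n \<tau> w s \<omega>))"
  using assms
proof (induction n arbitrary: U s t)
  case 0
  then show ?case by (simp add: elementary_exponent_def)
next
  case (Suc n)
  let ?V = "\<lambda>m t \<omega>. exp (elementary_exponent m \<tau> w t \<omega>)"
  have Suc_eq: "elementary_exponent (Suc n) \<tau> w t \<omega> = elementary_exponent n \<tau> w t \<omega> +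
      (\<i> * complex_of_real (w n \<omega> \<bullet> (Z (min t (\<tau> (Suc n))) \<omega> - Z (min t (\<tau> n)) \<omega>))
       + complex_of_real (min t (\<tau> (Suc n)) - min t (\<tau> n)) * \<psi> (w n \<omega>))" for t \<omega>
    by (simp add: elementary_exponent_def)
  have before: "?V (Suc n) t \<omega> = ?V n t \<omega>" if "t \<le> \<tau> n" for t \<omega>
  proof -
    have "min t (\<tau> (Suc n)) = t" "min t (\<tau> n) = t" using that \<tau>_Suc[of n] by auto
    then show ?thesis by (simp add: Suc_eq)
  qed
  have frozen: "elementary_exponent n \<tau> w t = elementary_exponent n \<tau> w (\<tau> n)" if "\<tau> n \<le> t" for t
  proof -
    have "min t (\<tau> k) = min (\<tau> n) (\<tau> k)" if "k \<le> n" for k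
      using incseqD[OF \<tau> that] \<open>\<tau> n \<le> t\<close> by simp
    then show ?thesis by (auto simp: elementary_exponent_def fun_eq_iff intro!: sum.cong)
  qed
  have late: "(LINT \<omega>|M. U \<omega> * ?V (Suc n) t \<omega>) = (LINT \<omega>|M. U \<omega> * ?V (Suc n) s \<omega>)"
    if s: "\<tau> n \<le> s" "s \<le> t" and U: "U \<in> borel_measurable (F s)" "\<And>\<omega>. cmod (U \<omega>) \<le> 1" for U s t
  proof -
    have s0: "0 \<le> s" using \<tau>_nonneg[of n] s by linarith
    \<comment> \<open>The last piece evolves only between \<open>s'\<close> and \<open>t'\<close>;
      beyond \<open>\<tau> (Suc n)\<close> these coincide and the additional factor is 1.\<close>
    define s' t' where "s' = min s (\<tau> (Suc n))" and "t' = min t (\<tau> (Suc n))"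
    have [measurable]: "elementary_exponent (Suc n) \<tau> w s \<in> borel_measurable (F s)"
      by (rule elementary_exponent_measurable[OF s0])
    obtain C where C: "\<And>\<omega>. cmod (?V (Suc n) s \<omega>) \<le> C"
      using exp_elementary_exponent_bounded[of s "Suc n"] s0 by blast
    have UV: "cmod (U \<omega> * ?V (Suc n) s \<omega>) \<le> 1 * C" for \<omega>
      unfolding norm_mult using U(2)[of \<omega>] C[of \<omega>] by (intro mult_mono) auto
    have step: "U \<omega> * ?V (Suc n) t \<omega> = (U \<omega> * ?V (Suc n) s \<omega>) *
        exp (\<i> * complex_of_real (w n \<omega> \<bullet> (Z t' \<omega> - Z s' \<omega>)) + complex_of_real (t' - s') * \<psi> (w n \<omega>))" for \<omega>
    proof -
      have "min s (\<tau> n) = \<tau> n" "min t (\<tau> n) = \<tau> n" using s by auto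
      then show ?thesis
        using frozen[of s] frozen[of t] s
        by (simp add: Suc_eq mult.assoc exp_add[symmetric] t'_def[symmetric] s'_def[symmetric])
          (simp add: algebra_simps inner_diff_right)
    qed
    show ?thesis
    proof (cases "s \<le> \<tau> (Suc n)")
      case True
      then have st': "s' = s" "s \<le> t'" using s by (auto simp: s'_def t'_def)
      show ?thesis unfolding step st'(1)
        using U(1) measurable_F_mono[OF w s(1)] UV D s0 st'(2)
        by (intro independent_increment_exp[where C = "1 * C" and D = "D n"]) auto
    next
      case False
      then have "s' = t'" using s by (auto simp: s'_def t'_def)
      then show ?thesis unfolding step by simp
    qed
  qed
  show ?case
  proof (cases "\<tau> n \<le> s")
    case True
    then show ?thesis by (rule late[OF _ Suc.prems(2-4)])
  next
    case s: False
    show ?thesis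
    proof (cases "t \<le> \<tau> n")
      case True
      with s show ?thesis using Suc.IH[OF Suc.prems] by (simp add: before)
    next
      case False
      have U: "U \<in> borel_measurable (F (\<tau> n))"
        using Suc.prems(3) s by (elim measurable_F_mono) simp
      have "(LINT \<omega>|M. U \<omega> * ?V (Suc n) t \<omega>) = (LINT \<omega>|M. U \<omega> * ?V (Suc n) (\<tau> n) \<omega>)"
        using False by (intro late[OF order_refl _ U Suc.prems(4)]) simp
      also have "\<dots> = (LINT \<omega>|M. U \<omega> * ?V n s \<omega>)"
        using s Suc.IH[OF Suc.prems(1) _ Suc.prems(3,4), of "\<tau> n"] by (simp add: before)
      also have "\<dots> = (LINT \<omega>|M. U \<omega> * ?V (Suc n) s \<omega>)" using s by (simp add: before)
      finally show ?thesis .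
    qed
  qed
qed

lemma elementary_exponent_right_continuous:
  "AE \<omega> in M. \<forall>t\<ge>0. continuous (at_right t) (\<lambda>s. elementary_exponent n \<tau> w s \<omega>)"
  using AE_Z_right_continuous
proof eventually_elim
  case (elim \<omega>)
  then have "continuous (at_right t) (\<lambda>s. Z (min s c) \<omega>)" if "0 \<le> t" for t c
    using that right_continuous_min[of t "\<lambda>s. Z s \<omega>"] by blast
  then show ?case
    unfolding elementary_exponent_def by (intro allI impI continuous_intros)
qed

lemma expectation_exp_elementary_exponent:
  assumes T: "stopping_time F T" and T0: "\<And>\<omega>. 0 \<le> T \<omega>" and Tb: "\<And>\<omega>. T \<omega> \<le> b"
  shows "(LINT \<omega>|M. exp (elementary_exponent n \<tau> w (T \<omega>) \<omega>)) = 1"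
proof -
  obtain C where C: "\<And>t \<omega>. 0 \<le> t \<Longrightarrow> t \<le> b + 1 \<Longrightarrow> cmod (exp (elementary_exponent n \<tau> w t \<omega>)) \<le> C"
    using exp_elementary_exponent_bounded[of "b + 1" n] by blast
  have "(LINT \<omega>|M. exp (elementary_exponent n \<tau> w (T \<omega>) \<omega>)) = (LINT \<omega>|M. exp (elementary_exponent n \<tau> w 0 \<omega>))"
  proof (rule optional_stopping[where V="\<lambda>t \<omega>. exp (elementary_exponent n \<tau> w t \<omega>)", OF _ C _ _ T T0 Tb])
    show "(\<lambda>\<omega>. exp (elementary_exponent n \<tau> w t \<omega>)) \<in> borel_measurable (F t)" if "0 \<le> t" for t
      using elementary_exponent_measurable[OF that] by measurable
    show "AE \<omega> in M. \<forall>t\<ge>0. continuous (at_right t) (\<lambda>s. exp (elementary_exponent n \<tau> w s \<omega>))"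
      using elementary_exponent_right_continuous by eventually_elim (auto intro!: continuous_intros)
    show "(LINT \<omega>|M. indicator A \<omega> * exp (elementary_exponent n \<tau> w t \<omega>))
        = (LINT \<omega>|M. indicator A \<omega> * exp (elementary_exponent n \<tau> w s \<omega>))"
      if "0 \<le> s" "s \<le> t" "A \<in> sets (F s)" for s t A
      using that by (intro exp_elementary_exponent_martingale) (auto simp: indicator_def)
  qed
  also have "\<dots> = 1"
  proof -
    have "min 0 (\<tau> k) = 0" for k using \<tau>_nonneg[of k] by simp
    then show ?thesis by (simp add: elementary_exponent_def prob_space)
  qed
  finally show ?thesis .
qed

end

end

section \<open>Estimates for the passage to the limit\<close>

text \<open>Integrability is not assumed: otherwise the integral has the default value 0, and
  \<open>u * B\<close> is nonnegative. Exponents can thus be bounded before their integrands are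
  known to be measurable.\<close>

lemma norm_LINT_Ioc_le:
  fixes f :: "real \<Rightarrow> complex"
  assumes "0 \<le> u" "\<And>s. 0 < s \<Longrightarrow> s \<le> u \<Longrightarrow> cmod (f s) \<le> B"
  shows "cmod (LINT s|lborel. indicator {0<..u} s *\<^sub>R f s) \<le> u * B"
proof (cases "integrable lborel (\<lambda>s. indicator {0<..u} s *\<^sub>R f s)")
  case True
  have "cmod (LINT s|lborel. indicator {0<..u} s *\<^sub>R f s) \<le> (LINT s|lborel. cmod (indicator {0<..u} s *\<^sub>R f s))"
    by (rule integral_norm_bound)
  also have "\<dots> \<le> (LINT s|lborel. B * indicator {0<..u} s)"
  proof (rule integral_mono)
    show "integrable lborel (\<lambda>s. B * indicator {0<..u} s)"
      using assms(1) by (intro integrable_mult_right integrable_real_indicator) auto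
    show "integrable lborel (\<lambda>s. cmod (indicator {0<..u} s *\<^sub>R f s))" using True by (rule integrable_norm)
  qed (use assms in \<open>auto simp: indicator_def\<close>)
  also have "\<dots> = u * B" using assms(1) by simp
  finally show ?thesis .
next
  case False
  have "0 \<le> u * B"
  proof (cases "u = 0")
    case False
    then have "0 \<le> B" using assms by (intro order_trans[OF norm_ge_zero assms(2)[of u]]) auto
    with assms show ?thesis by simp
  qed simp
  with False show ?thesis by (simp add: not_integrable_integral_eq)
qed

text \<open>The difference is at most 2 where the arguments are more than \<open>e\<close> apart
  and, \<open>iexp\<close> being 1-Lipschitz, at most \<open>e\<close> elsewhere.\<close>

lemma (in prob_space) expectation_iexp_diff_tendsto_0:
  fixes X :: "nat \<Rightarrow> 'a \<Rightarrow> real"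
  assumes [measurable]: "\<And>n. X n \<in> borel_measurable M" "X' \<in> borel_measurable M"
    and conv: "\<And>e. 0 < e \<Longrightarrow> (\<lambda>n. prob {\<omega> \<in> space M. e < \<bar>X n \<omega> - X' \<omega>\<bar>}) \<longlonglongrightarrow> 0"
  shows "(\<lambda>n. expectation (\<lambda>\<omega>. cmod (iexp (X n \<omega>) - iexp (X' \<omega>)))) \<longlonglongrightarrow> 0"
proof (rule LIMSEQ_I)
  fix r :: real assume r: "0 < r"
  \<comment> \<open>For large \<open>n\<close> the bound is below \<open>2 * e + e\<close>, three
    quarters of \<open>r\<close>.\<close>
  define e where "e = r / 4"
  have e: "0 < e" using r by (simp add: e_def)
  have bound: "expectation (\<lambda>\<omega>. cmod (iexp (X n \<omega>) - iexp (X' \<omega>)))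
      \<le> 2 * prob {\<omega> \<in> space M. e < \<bar>X n \<omega> - X' \<omega>\<bar>} + e" for n
  proof -
    let ?A = "{\<omega> \<in> space M. e < \<bar>X n \<omega> - X' \<omega>\<bar>}"
    have "expectation (\<lambda>\<omega>. cmod (iexp (X n \<omega>) - iexp (X' \<omega>)))
        \<le> expectation (\<lambda>\<omega>. 2 * indicator ?A \<omega> + e)"
    proof (rule integral_mono)
      show "integrable M (\<lambda>\<omega>. cmod (iexp (X n \<omega>) - iexp (X' \<omega>)))"
        by (rule integrable_const_bound[where B=2])
          (auto intro!: order_trans[OF norm_triangle_ineq4])
      show "integrable M (\<lambda>\<omega>. 2 * indicator ?A \<omega> + e)"
        by (intro Bochner_Integration.integrable_add integrable_mult_right) (auto simp: emeasure_eq_measure)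
      fix \<omega> assume \<omega>: "\<omega> \<in> space M"
      have 1: "cmod (iexp (X n \<omega>) - iexp (X' \<omega>)) \<le> 2"
        by (rule order_trans[OF norm_triangle_ineq4]) simp
      have "iexp (X n \<omega>) - iexp (X' \<omega>) = iexp (X' \<omega>) * (iexp (X n \<omega> - X' \<omega>) - 1)"
        by (simp add: algebra_simps exp_add[symmetric])
      then have 2: "cmod (iexp (X n \<omega>) - iexp (X' \<omega>)) \<le> \<bar>X n \<omega> - X' \<omega>\<bar>"
        using iexp_approx1[of "X n \<omega> - X' \<omega>" 0] by (simp add: norm_mult)
      show "cmod (iexp (X n \<omega>) - iexp (X' \<omega>)) \<le> 2 * indicator ?A \<omega> + e"
        using \<omega> 1 2 e by (cases "\<omega> \<in> ?A") auto
    qed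
    also have "\<dots> = 2 * prob ?A + e"
      by (subst Bochner_Integration.integral_add) (auto simp: prob_space emeasure_eq_measure)
    finally show ?thesis .
  qed
  from LIMSEQ_D[OF conv[OF e], of e] e obtain N
    where N: "\<And>n. N \<le> n \<Longrightarrow> prob {\<omega> \<in> space M. e < \<bar>X n \<omega> - X' \<omega>\<bar>} < e" by auto
  have "norm (expectation (\<lambda>\<omega>. cmod (iexp (X n \<omega>) - iexp (X' \<omega>))) - 0) < r" if "N \<le> n" for n
  proof -
    have "0 \<le> expectation (\<lambda>\<omega>. cmod (iexp (X n \<omega>) - iexp (X' \<omega>)))" by simp
    moreover have "expectation (\<lambda>\<omega>. cmod (iexp (X n \<omega>) - iexp (X' \<omega>))) < r"
      using bound[of n] N[OF that] r unfolding e_def by linarith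
    ultimately show ?thesis by simp
  qed
  then show "\<exists>N. \<forall>n\<ge>N. norm (expectation (\<lambda>\<omega>. cmod (iexp (X n \<omega>) - iexp (X' \<omega>))) - 0) < r" by blast
qed

context levy_basis
begin

text \<open>By right continuity a strict excess at \<open>s\<close> persists shortly after
  \<open>s\<close>, so rational times suffice, together with the endpoint \<open>t\<close>, to the
  right of which there is no room. This gives \<open>ucp_tendsto\<close> its content:
  \<open>measure\<close> is 0 by default on nonmeasurable sets.\<close>

lemma supremum_event_measurable:
  fixes V :: "real \<Rightarrow> 'w \<Rightarrow> 'b::{real_normed_vector, second_countable_topology}"
  assumes V: "\<And>t. 0 \<le> t \<Longrightarrow> V t \<in> borel_measurable M"
    and rc: "AE \<omega> in M. \<forall>t\<ge>0. continuous (at_right t) (\<lambda>s. V s \<omega>)"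
    and "0 \<le> t"
  shows "{\<omega> \<in> space M. \<exists>s\<in>{0..t}. norm (V s \<omega>) > e} \<in> sets M"
proof (rule in_sets_AE)
  let ?I = "{0..t} \<inter> (\<rat> \<union> {t})"
  have "countable ?I" by (intro countable_Int2) (auto intro: countable_rat)
  moreover have "{\<omega> \<in> space M. norm (V s \<omega>) > e} \<in> sets M" if "s \<in> ?I" for s
  proof -
    have [measurable]: "V s \<in> borel_measurable M" using V that by auto
    show ?thesis by measurable
  qed
  ultimately show "{\<omega> \<in> space M. \<exists>s\<in>?I. norm (V s \<omega>) > e} \<in> sets M"
    by (rule sets.sets_Collect_countable_Ex'[rotated])
  show "AE \<omega> in M. \<omega> \<in> {\<omega> \<in> space M. \<exists>s\<in>?I. norm (V s \<omega>) > e} \<longleftrightarrow>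
      \<omega> \<in> {\<omega> \<in> space M. \<exists>s\<in>{0..t}. norm (V s \<omega>) > e}"
    using rc
  proof eventually_elim
    case (elim \<omega>)
    have "\<exists>s\<in>?I. norm (V s \<omega>) > e" if s: "s \<in> {0..t}" "norm (V s \<omega>) > e" for s
    proof (cases "s = t")
      case False
      have "((\<lambda>u. norm (V u \<omega>)) \<longlongrightarrow> norm (V s \<omega>)) (at_right s)"
        using elim s(1) by (intro tendsto_norm) (auto simp: continuous_within)
      from order_tendstoD(1)[OF this s(2)] obtain b where b: "s < b" "\<And>u. s < u \<Longrightarrow> u < b \<Longrightarrow> e < norm (V u \<omega>)"
        unfolding eventually_at_right_field by blast
      obtain q where "q \<in> \<rat>" "s < q" "q < min b t"
        using Rats_dense_in_real[of s "min b t"] b(1) s(1) False by auto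
      with b s(1) show ?thesis by (intro bexI[of _ q]) auto
    qed (use s \<open>0 \<le> t\<close> in auto)
    then show ?case by blast
  qed
qed auto

text \<open>Rule induction. For limits, adaptedness and path regularity are premises of the rule,
  while the initial value and the measurability of the integrand in time have to be carried through.
  The indicator is there because integrands are specified at positive times only.\<close>

lemma stochastic_integral_regular:
  fixes H :: "real \<Rightarrow> 'w \<Rightarrow> real ^ 'm ^ 'd" and Y :: "real \<Rightarrow> 'w \<Rightarrow> real ^ 'd"
  assumes "stochastic_integral M F Z H Y"
  shows "adapted F Y \<and> (AE \<omega> in M. cadlag (\<lambda>t. Y t \<omega>)) \<and> (AE \<omega> in M. Y 0 \<omega> = 0)
    \<and> (AE \<omega> in M. (\<lambda>t. indicator {0<..} t *\<^sub>R H t \<omega>) \<in> borel_measurable borel)"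
  using assms
proof (induction rule: stochastic_integral.induct)
  case (elementary \<tau> A n)
  have \<tau>0: "0 \<le> \<tau> k" for k using elementary(1) incseqD[OF elementary(2), of 0 k] by simp
  have "elementary_integral Z n \<tau> A t \<in> borel_measurable (F t)" if "0 \<le> t" for t
    unfolding elementary_integral_def
  proof (rule borel_measurable_sum)
    fix k
    show "(\<lambda>\<omega>. A k \<omega> *v (Z (min t (\<tau> (Suc k))) \<omega> - Z (min t (\<tau> k)) \<omega>)) \<in> borel_measurable (F t)"
    proof (cases "\<tau> k \<le> t")
      case True
      have [measurable]: "A k \<in> borel_measurable (F t)" using elementary(3) True by (rule measurable_F_mono)
      have Zm: "Z (min t (\<tau> i)) \<in> borel_measurable (F t)" for i
        using Z_measurable[of "min t (\<tau> i)"] that \<tau>0 by (auto intro: measurable_F_mono)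
      note [measurable] = Zm[of k] Zm[of "Suc k"]
      show ?thesis by measurable
    next
      case False
      then have "min t (\<tau> (Suc k)) = t" "min t (\<tau> k) = t" using incseq_SucD[OF elementary(2), of k] by auto
      then show ?thesis by simp
    qed
  qed
  moreover have "AE \<omega> in M. cadlag (\<lambda>t. Z t \<omega>)" using levy by (simp add: levy_process_def)
  then have "AE \<omega> in M. cadlag (\<lambda>t. elementary_integral Z n \<tau> A t \<omega>)"
  proof eventually_elim
    case (elim \<omega>)
    have lin: "bounded_linear (\<lambda>x. A k \<omega> *v x)" for k
      using linear_conv_bounded_linear matrix_vector_mul_linear by blast
    show ?case unfolding cadlag_def
    proof (intro conjI allI impI)
      fix t :: real assume "0 \<le> t"
      then have "continuous (at_right t) (\<lambda>s. Z (min s c) \<omega>)" for c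
        using elim right_continuous_min[of t "\<lambda>s. Z s \<omega>"] by (simp add: cadlag_def)
      then show "continuous (at_right t) (\<lambda>t. elementary_integral Z n \<tau> A t \<omega>)"
        unfolding elementary_integral_def
        by (intro continuous_intros bounded_linear.continuous[OF lin])
    next
      fix t :: real assume "0 < t"
      then have "\<exists>l. ((\<lambda>s. Z (min s c) \<omega>) \<longlongrightarrow> l) (at_left t)" for c
        using elim left_limit_min[of "\<lambda>s. Z s \<omega>" _ t] by (auto simp: cadlag_def)
      then obtain l where l: "\<And>c. ((\<lambda>s. Z (min s c) \<omega>) \<longlongrightarrow> l c) (at_left t)" by metis
      have "((\<lambda>t. elementary_integral Z n \<tau> A t \<omega>) \<longlongrightarrow>
          (\<Sum>k<n. A k \<omega> *v (l (\<tau> (Suc k)) - l (\<tau> k)))) (at_left t)"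
        unfolding elementary_integral_def
        by (intro tendsto_intros bounded_linear.tendsto[OF lin] l)
      then show "\<exists>l. ((\<lambda>t. elementary_integral Z n \<tau> A t \<omega>) \<longlongrightarrow> l) (at_left t)" by blast
    qed
  qed
  moreover have "elementary_integral Z n \<tau> A 0 \<omega> = 0" for \<omega>
    using \<tau>0 by (simp add: elementary_integral_def min_def)
  moreover have "(\<lambda>t. indicator {0<..} t *\<^sub>R elementary_integrand n \<tau> A t \<omega>) \<in> borel_measurable borel" for \<omega>
    unfolding elementary_integrand_def by measurable
  ultimately show ?case by (auto simp: adapted_def)
next
  case (dominated_limit H Y H' Y')
  have IH: "adapted F (Y n)" "AE \<omega> in M. cadlag (\<lambda>t. Y n t \<omega>)" "AE \<omega> in M. Y n 0 \<omega> = 0"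
    "AE \<omega> in M. (\<lambda>t. indicator {0<..} t *\<^sub>R H n t \<omega>) \<in> borel_measurable borel" for n
    using dominated_limit.IH by blast+
  have "AE \<omega> in M. \<forall>n. (\<lambda>t. indicator {0<..} t *\<^sub>R H n t \<omega>) \<in> borel_measurable borel"
    using IH(4) by (simp add: AE_all_countable)
  with dominated_limit.hyps(3)
  have "AE \<omega> in M. (\<lambda>t. indicator {0<..} t *\<^sub>R H' t \<omega>) \<in> borel_measurable borel"
  proof eventually_elim
    case (elim \<omega>)
    show ?case
      by (rule borel_measurable_LIMSEQ_metric[where f="\<lambda>n t. indicator {0<..} t *\<^sub>R H n t \<omega>"])
        (use elim in \<open>auto simp: indicator_def\<close>)
  qed
  \<comment> \<open>Taking the horizon 0 in the ucp convergence, with \<open>Y n 0\<close> almost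
    surely zero, the probability that \<open>Y' 0\<close> exceeds a given level is a constant
    sequence tending to 0.\<close>
  moreover have "AE \<omega> in M. Y' 0 \<omega> = 0"
  proof -
    have [measurable]: "Y' 0 \<in> borel_measurable M" "Y n 0 \<in> borel_measurable M" for n
      using dominated_limit.hyps(4) IH(1)[of n]
      by (auto simp: adapted_def intro: measurable_F_imp_M[of _ 0])
    have "AE \<omega> in M. norm (Y' 0 \<omega>) \<le> 1 / real (Suc i)" for i
    proof -
      let ?A = "{\<omega> \<in> space M. norm (Y' 0 \<omega>) > 1 / real (Suc i)}"
      have "measure M {\<omega> \<in> space M. norm (Y n 0 \<omega> - Y' 0 \<omega>) > 1 / real (Suc i)} = measure M ?A" for n
      proof (rule measure_eq_AE)
        show "AE \<omega> in M. \<omega> \<in> {\<omega> \<in> space M. norm (Y n 0 \<omega> - Y' 0 \<omega>) > 1 / real (Suc i)} \<longleftrightarrow> \<omega> \<in> ?A"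
          using IH(3)[of n] by eventually_elim simp
      qed measurable
      moreover have "0 < 1 / real (Suc i)" by simp
      then have "(\<lambda>n. measure M {\<omega> \<in> space M. \<exists>s\<in>{0..0}. norm (Y n s \<omega> - Y' s \<omega>) > 1 / real (Suc i)}) \<longlonglongrightarrow> 0"
        using dominated_limit.hyps(6) unfolding ucp_tendsto_def by blast
      then have "(\<lambda>n. measure M {\<omega> \<in> space M. norm (Y n 0 \<omega> - Y' 0 \<omega>) > 1 / real (Suc i)}) \<longlonglongrightarrow> 0"
        by simp
      ultimately have "measure M ?A = 0" by (simp add: LIMSEQ_const_iff)
      then have "AE \<omega> in M. \<not> norm (Y' 0 \<omega>) > 1 / real (Suc i)"
        by (subst AE_iff_measurable[OF _ refl]) (auto simp: emeasure_eq_measure)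
      then show ?thesis by (simp add: not_less)
    qed
    then have "AE \<omega> in M. \<forall>i. norm (Y' 0 \<omega>) \<le> 1 / real (Suc i)" by (simp add: AE_all_countable)
    then show ?thesis
    proof eventually_elim
      case (elim \<omega>)
      have "norm (Y' 0 \<omega>) \<le> 0"
      proof (rule field_le_epsilon)
        fix e :: real assume "0 < e"
        then obtain i where "1 / real (Suc i) < e" by (rule nat_approx_posE)
        with elim[rule_format, of i] show "norm (Y' 0 \<omega>) \<le> 0 + e" by linarith
      qed
      then show ?case by simp
    qed
  qed
  ultimately show ?case using dominated_limit.hyps(4,5) by blast
qed

end

section \<open>From elementary to general integrands\<close>

context levy_basis
begin

definition exponent_integral ::
    "(real \<Rightarrow> 'w \<Rightarrow> real ^ 'm ^ 'd) \<Rightarrow> real ^ 'd \<Rightarrow> 'w \<Rightarrow> real \<Rightarrow> complex" where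
  "exponent_integral H \<xi> \<omega> u =
     (LINT s|lborel. indicator {0<..u} s *\<^sub>R \<psi> (transpose (H s \<omega>) *v \<xi>))"

lemma borel_measurable_exponent_integrand:
  fixes H :: "real \<Rightarrow> 'w \<Rightarrow> real ^ 'm ^ 'd"
  assumes [measurable]: "(\<lambda>t. indicator {0<..} t *\<^sub>R H t \<omega>) \<in> borel_measurable borel"
  shows "(\<lambda>s. indicator {0<..u} s *\<^sub>R \<psi> (transpose (H s \<omega>) *v \<xi>)) \<in> borel_measurable borel"
proof -
  have "(\<lambda>s. transpose (indicator {0<..} s *\<^sub>R H s \<omega>) *v \<xi>) \<in> borel_measurable borel"
    by (rule borel_measurable_transpose_mult) measurable
  then have "(\<lambda>s. indicator {0<..u} s *\<^sub>R \<psi> (transpose (indicator {0<..} s *\<^sub>R H s \<omega>) *v \<xi>)) \<in> borel_measurable borel"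
    by measurable
  also have "(\<lambda>s. indicator {0<..u} s *\<^sub>R \<psi> (transpose (indicator {0<..} s *\<^sub>R H s \<omega>) *v \<xi>))
      = (\<lambda>s. indicator {0<..u} s *\<^sub>R \<psi> (transpose (H s \<omega>) *v \<xi>))"
    by (auto simp: fun_eq_iff indicator_def)
  finally show ?thesis .
qed

text \<open>The nonlinear \<open>\<psi>\<close> passes through the sum because the intervals are
  disjoint, so at most one term is active, and because \<open>\<psi>\<close> vanishes at 0.\<close>

lemma exponent_of_elementary_integrand:
  fixes A :: "nat \<Rightarrow> 'w \<Rightarrow> real ^ 'm ^ 'd"
  assumes "incseq \<tau>"
  shows "\<psi> (transpose (elementary_integrand n \<tau> A s \<omega>) *v \<xi>)
    = (\<Sum>k<n. indicator {\<tau> k<..\<tau> (Suc k)} s *\<^sub>R \<psi> (transpose (A k \<omega>) *v \<xi>))"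
proof (induction n)
  case 0
  have "transpose (0 :: real ^ 'm ^ 'd) *v \<xi> = 0" using linear_0[OF linear_transpose_mult] .
  then show ?case by (simp add: elementary_integrand_def \<psi>_0)
next
  case (Suc n)
  show ?case
  proof (cases "\<tau> n < s \<and> s \<le> \<tau> (Suc n)")
    case True
    have "\<not> s \<le> \<tau> (Suc k)" if "k < n" for k
      using incseqD[OF assms, of "Suc k" n] that True by auto
    with True show ?thesis by (simp add: elementary_integrand_def)
  next
    case False
    then have "elementary_integrand (Suc n) \<tau> A s \<omega> = elementary_integrand n \<tau> A s \<omega>"
      by (auto simp: elementary_integrand_def)
    with Suc False show ?thesis by (simp add: indicator_def)
  qed
qed

lemma exponent_integral_elementary:
  fixes A :: "nat \<Rightarrow> 'w \<Rightarrow> real ^ 'm ^ 'd"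
  assumes \<tau>: "incseq \<tau>" and \<tau>0: "0 \<le> \<tau> 0"
  shows "exponent_integral (elementary_integrand n \<tau> A) \<xi> \<omega> u
    = (\<Sum>k<n. complex_of_real (min u (\<tau> (Suc k)) - min u (\<tau> k)) * \<psi> (transpose (A k \<omega>) *v \<xi>))"
proof -
  have fin: "emeasure lborel {x<..y} < \<infinity>" for x y :: real
    by (cases "x \<le> y") auto
  have \<tau>_nonneg: "0 \<le> \<tau> k" for k using \<tau>0 incseqD[OF \<tau>, of 0 k] by simp
  have "indicator {0<..u} s *\<^sub>R \<psi> (transpose (elementary_integrand n \<tau> A s \<omega>) *v \<xi>)
      = (\<Sum>k<n. indicator {min u (\<tau> k)<..min u (\<tau> (Suc k))} s *\<^sub>R \<psi> (transpose (A k \<omega>) *v \<xi>))" for s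
  proof -
    have "0 < s \<and> s \<le> u \<and> \<tau> k < s \<and> s \<le> \<tau> (Suc k) \<longleftrightarrow> min u (\<tau> k) < s \<and> s \<le> min u (\<tau> (Suc k))" for k
      using \<tau>_nonneg[of k] by auto
    then show ?thesis
      unfolding exponent_of_elementary_integrand[OF \<tau>] scaleR_sum_right
      by (intro sum.cong refl) (auto simp: indicator_def)
  qed
  then have "exponent_integral (elementary_integrand n \<tau> A) \<xi> \<omega> u = (LINT s|lborel.
      (\<Sum>k<n. indicator {min u (\<tau> k)<..min u (\<tau> (Suc k))} s *\<^sub>R \<psi> (transpose (A k \<omega>) *v \<xi>)))"
    by (simp add: exponent_integral_def)
  also have "\<dots> = (\<Sum>k<n. LINT s|lborel. indicator {min u (\<tau> k)<..min u (\<tau> (Suc k))} s *\<^sub>R \<psi> (transpose (A k \<omega>) *v \<xi>))"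
    by (intro Bochner_Integration.integral_sum integrable_scaleR_left integrable_real_indicator fin) simp
  also have "\<dots> = (\<Sum>k<n. complex_of_real (min u (\<tau> (Suc k)) - min u (\<tau> k)) * \<psi> (transpose (A k \<omega>) *v \<xi>))"
  proof (intro sum.cong refl)
    fix k
    have "min u (\<tau> k) \<le> min u (\<tau> (Suc k))" using incseq_SucD[OF \<tau>, of k] by auto
    then have "measure lborel {min u (\<tau> k)<..min u (\<tau> (Suc k))} = min u (\<tau> (Suc k)) - min u (\<tau> k)"
      by (rule measure_lborel_Ioc)
    then show "(LINT s|lborel. indicator {min u (\<tau> k)<..min u (\<tau> (Suc k))} s *\<^sub>R \<psi> (transpose (A k \<omega>) *v \<xi>))
        = complex_of_real (min u (\<tau> (Suc k)) - min u (\<tau> k)) * \<psi> (transpose (A k \<omega>) *v \<xi>)"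
      by (simp add: scaleR_conv_of_real)
  qed
  finally show ?thesis .
qed

lemma exponential_martingale_elementary:
  fixes A :: "nat \<Rightarrow> 'w \<Rightarrow> real ^ 'm ^ 'd"
  assumes \<tau>0: "0 \<le> \<tau> 0" and \<tau>: "incseq \<tau>"
    and A: "\<And>k. A k \<in> borel_measurable (F (\<tau> k))" and Ab: "\<And>k. bounded (range (A k))"
    and T: "stopping_time F T" "\<And>\<omega>. 0 \<le> T \<omega>" "\<And>\<omega>. T \<omega> \<le> b"
  shows "(\<lambda>\<omega>. exponent_integral (elementary_integrand n \<tau> A) \<xi> \<omega> (T \<omega>)) \<in> borel_measurable M"
    and "(LINT \<omega>|M. exp (\<i> * complex_of_real (\<xi> \<bullet> elementary_integral Z n \<tau> A (T \<omega>) \<omega>)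
            + exponent_integral (elementary_integrand n \<tau> A) \<xi> \<omega> (T \<omega>))) = 1"
proof -
  \<comment> \<open>By adjointness \<open>\<xi> \<bullet> (A z) = (A' \<xi>) \<bullet> z\<close>, so
    the matrix weights enter only through these vectors.\<close>
  define w where "w k \<omega> = transpose (A k \<omega>) *v \<xi>" for k \<omega>
  have w: "w k \<in> borel_measurable (F (\<tau> k))" for k
    unfolding w_def[abs_def] using A by (rule borel_measurable_transpose_mult)
  have "\<exists>D. \<forall>\<omega>. norm (w k \<omega>) \<le> D" for k
  proof -
    obtain c where c: "\<And>\<omega>. norm (A k \<omega>) \<le> c" using Ab[of k] by (auto simp: bounded_iff)
    obtain D where "\<And>B :: real ^ 'm ^ 'd. norm B \<le> c \<Longrightarrow> norm (transpose B *v \<xi>) \<le> D"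
      using bounded_transpose_mult[of c \<xi>] by blast
    with c show ?thesis unfolding w_def by blast
  qed
  then obtain D where D: "\<And>k \<omega>. norm (w k \<omega>) \<le> D k" by metis
  have [measurable]: "T \<in> borel_measurable M" using T(1) by (rule stopping_time_measurable_M)
  have [measurable]: "w k \<in> borel_measurable M" for k using w by (rule measurable_F_imp_M)
  show "(\<lambda>\<omega>. exponent_integral (elementary_integrand n \<tau> A) \<xi> \<omega> (T \<omega>)) \<in> borel_measurable M"
    unfolding exponent_integral_elementary[OF \<tau> \<tau>0] w_def[symmetric] by measurable
  have "\<i> * complex_of_real (\<xi> \<bullet> elementary_integral Z n \<tau> A t \<omega>)
      + exponent_integral (elementary_integrand n \<tau> A) \<xi> \<omega> t = elementary_exponent n \<tau> w t \<omega>" for t \<omega>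
    unfolding exponent_integral_elementary[OF \<tau> \<tau>0] elementary_integral_def elementary_exponent_def
      w_def transpose_mult_inner inner_sum_right sum.distrib of_real_sum sum_distrib_left ..
  then show "(LINT \<omega>|M. exp (\<i> * complex_of_real (\<xi> \<bullet> elementary_integral Z n \<tau> A (T \<omega>) \<omega>)
      + exponent_integral (elementary_integrand n \<tau> A) \<xi> \<omega> (T \<omega>))) = 1"
    using expectation_exp_elementary_exponent[OF \<tau>0 \<tau> w D T] by simp
qed

text \<open>\<open>Y n\<close> converges only in probability, the exponents almost surely, so the
  two limits are separated. Replacing \<open>Y n\<close> by \<open>Y'\<close> under the unchanged
  exponent costs at most \<open>exp (b * B)\<close> times the mean distance of the two characters;
  afterwards dominated convergence treats the exponent.\<close>

lemma exponential_martingale_bounded_limit: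
  fixes H :: "nat \<Rightarrow> real \<Rightarrow> 'w \<Rightarrow> real ^ 'm ^ 'd" and Y :: "nat \<Rightarrow> real \<Rightarrow> 'w \<Rightarrow> real ^ 'd"
  assumes SI: "\<And>n. stochastic_integral M F Z (H n) (Y n)"
    and a: "\<And>n. (\<lambda>\<omega>. exponent_integral (H n) \<xi> \<omega> (S \<omega>)) \<in> borel_measurable M"
    and E: "\<And>n. (LINT \<omega>|M. exp (\<i> * complex_of_real (\<xi> \<bullet> Y n (S \<omega>) \<omega>) + exponent_integral (H n) \<xi> \<omega> (S \<omega>))) = 1"
    and Hb: "AE \<omega> in M. \<forall>n t. 0 < t \<and> t \<le> S \<omega> \<longrightarrow> norm (H n t \<omega>) \<le> c"
    and lim: "AE \<omega> in M. \<forall>t>0. (\<lambda>n. H n t \<omega>) \<longlonglongrightarrow> H' t \<omega>"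
    and Y': "adapted F Y'" "AE \<omega> in M. cadlag (\<lambda>t. Y' t \<omega>)" and ucp: "ucp_tendsto M Y Y'"
    and S: "stopping_time F S" and S0: "\<And>\<omega>. 0 \<le> S \<omega>" and Sb: "\<And>\<omega>. S \<omega> \<le> b"
  shows "(\<lambda>\<omega>. exponent_integral H' \<xi> \<omega> (S \<omega>)) \<in> borel_measurable M"
    and "(LINT \<omega>|M. exp (\<i> * complex_of_real (\<xi> \<bullet> Y' (S \<omega>) \<omega>) + exponent_integral H' \<xi> \<omega> (S \<omega>))) = 1"
proof -
  have b0: "0 \<le> b" using S0 Sb order_trans by blast
  have [measurable]: "S \<in> borel_measurable M" using S by (rule stopping_time_measurable_M)
  note reg = stochastic_integral_regular[OF SI]
  have YM: "Y n t \<in> borel_measurable M" "Y' t \<in> borel_measurable M" if "0 \<le> t" for n t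
    using reg[of n] Y'(1) that by (auto simp: adapted_def intro: measurable_F_imp_M[of _ t])
  have rc: "AE \<omega> in M. \<forall>t\<ge>0. continuous (at_right t) (\<lambda>s. Y n s \<omega>)"
    "AE \<omega> in M. \<forall>t\<ge>0. continuous (at_right t) (\<lambda>s. Y' s \<omega>)" for n
    using reg[of n] Y'(2) by (auto simp: cadlag_def)
  have YS [measurable]: "(\<lambda>\<omega>. Y n (S \<omega>) \<omega>) \<in> borel_measurable M" "(\<lambda>\<omega>. Y' (S \<omega>) \<omega>) \<in> borel_measurable M" for n
    using measurable_at_random_time[of "Y n" S] measurable_at_random_time[of Y' S] YM rc S0 by auto
  obtain c' where c': "\<And>A :: real ^ 'm ^ 'd. norm A \<le> c \<Longrightarrow> norm (transpose A *v \<xi>) \<le> c'"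
    using bounded_transpose_mult[of c \<xi>] by blast
  obtain B where B: "0 < B" "\<And>y. norm y \<le> c' \<Longrightarrow> cmod (\<psi> y) \<le> B"
    using \<psi>_bounded_on_cball[of c'] by blast
  let ?a = "\<lambda>n \<omega>. exponent_integral (H n) \<xi> \<omega> (S \<omega>)" and ?a' = "\<lambda>\<omega>. exponent_integral H' \<xi> \<omega> (S \<omega>)"
  note [measurable] = a
  have meas: "AE \<omega> in M. \<forall>n. (\<lambda>t. indicator {0<..} t *\<^sub>R H n t \<omega>) \<in> borel_measurable borel"
    using reg by (simp add: AE_all_countable)
  have ab: "AE \<omega> in M. \<forall>n. cmod (?a n \<omega>) \<le> b * B"
    using Hb
  proof eventually_elim
    case (elim \<omega>)
    have "cmod (?a n \<omega>) \<le> S \<omega> * B" for n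
      unfolding exponent_integral_def using elim by (intro norm_LINT_Ioc_le S0 B(2) c') auto
    also have "S \<omega> * B \<le> b * B" using Sb B(1) by (intro mult_right_mono) auto
    finally show ?case by blast
  qed
  have alim: "AE \<omega> in M. (\<lambda>n. ?a n \<omega>) \<longlonglongrightarrow> ?a' \<omega>"
    using Hb lim meas
  proof eventually_elim
    case (elim \<omega>)
    have conv: "(\<lambda>n. \<psi> (transpose (H n s \<omega>) *v \<xi>)) \<longlonglongrightarrow> \<psi> (transpose (H' s \<omega>) *v \<xi>)" if "0 < s" for s
    proof -
      have "isCont (\<lambda>A :: real ^ 'm ^ 'd. \<psi> (transpose A *v \<xi>)) (H' s \<omega>)"
        using continuous_on_compose2[OF continuous_on_\<psi> continuous_on_transpose_mult[of UNIV \<xi>] subset_UNIV]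
        by (simp add: continuous_on_eq_continuous_at)
      from isCont_tendsto_compose[OF this] elim(2) that show ?thesis by blast
    qed
    show ?case unfolding exponent_integral_def
    proof (rule integral_dominated_convergence[where w="\<lambda>s. indicator {0<..b} s * B"])
      have "(\<lambda>t. indicator {0<..} t *\<^sub>R H' t \<omega>) \<in> borel_measurable borel"
        by (rule borel_measurable_LIMSEQ_metric[where f="\<lambda>n t. indicator {0<..} t *\<^sub>R H n t \<omega>"])
          (use elim in \<open>auto simp: indicator_def\<close>)
      then show "(\<lambda>s. indicator {0<..S \<omega>} s *\<^sub>R \<psi> (transpose (H' s \<omega>) *v \<xi>)) \<in> borel_measurable lborel"
        unfolding measurable_cong_sets[OF sets_lborel refl] by (rule borel_measurable_exponent_integrand)
      show "(\<lambda>s. indicator {0<..S \<omega>} s *\<^sub>R \<psi> (transpose (H n s \<omega>) *v \<xi>)) \<in> borel_measurable lborel" for n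
        unfolding measurable_cong_sets[OF sets_lborel refl] using elim(3) by (intro borel_measurable_exponent_integrand) blast
      show "integrable lborel (\<lambda>s. indicator {0<..b} s * B)"
        using b0 by (intro integrable_mult_left integrable_real_indicator) auto
      show "AE s in lborel. (\<lambda>n. indicator {0<..S \<omega>} s *\<^sub>R \<psi> (transpose (H n s \<omega>) *v \<xi>))
          \<longlonglongrightarrow> indicator {0<..S \<omega>} s *\<^sub>R \<psi> (transpose (H' s \<omega>) *v \<xi>)"
        using conv by (intro AE_I2) (auto simp: indicator_def)
      show "AE s in lborel. norm (indicator {0<..S \<omega>} s *\<^sub>R \<psi> (transpose (H n s \<omega>) *v \<xi>)) \<le> indicator {0<..b} s * B" for n
        using elim(1) Sb[of \<omega>] B c' by (intro AE_I2) (auto simp: indicator_def)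
    qed
  qed
  show a' [measurable]: "?a' \<in> borel_measurable M"
    by (rule borel_measurable_AE_limit[OF a alim])
  let ?e = "\<lambda>n \<omega>. iexp (\<xi> \<bullet> Y n (S \<omega>) \<omega>)" and ?e' = "\<lambda>\<omega>. iexp (\<xi> \<bullet> Y' (S \<omega>) \<omega>)"
  have bnd: "AE \<omega> in M. \<forall>n. cmod (exp (?a n \<omega>)) \<le> exp (b * B)"
    using ab by eventually_elim (auto intro: order_trans[OF complex_Re_le_cmod])
  have int: "integrable M (\<lambda>\<omega>. exp (?a n \<omega>) * ?e n \<omega>)" "integrable M (\<lambda>\<omega>. exp (?a n \<omega>) * ?e' \<omega>)" for n
    using bnd by (auto intro!: integrable_const_bound[where B="exp (b * B)"] simp: norm_mult elim!: eventually_mono)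
  have "(\<lambda>n. LINT \<omega>|M. cmod (?e n \<omega> - ?e' \<omega>)) \<longlonglongrightarrow> 0"
  proof (rule expectation_iexp_diff_tendsto_0)
    fix e :: real assume e: "0 < e"
    \<comment> \<open>The summand 1 keeps the denominator positive when \<open>\<xi>\<close> is
      zero.\<close>
    define d where "d = e / (norm \<xi> + 1)"
    have d: "0 < d" using e by (simp add: d_def add_nonneg_pos)
    let ?A = "\<lambda>n. {\<omega> \<in> space M. \<exists>s\<in>{0..b}. norm (Y n s \<omega> - Y' s \<omega>) > d}"
    have A: "?A n \<in> sets M" for n
    proof (rule supremum_event_measurable)
      show "AE \<omega> in M. \<forall>t\<ge>0. continuous (at_right t) (\<lambda>s. Y n s \<omega> - Y' s \<omega>)"
        using rc(1)[of n] rc(2) by eventually_elim (auto intro: continuous_intros)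
      show "(\<lambda>\<omega>. Y n t \<omega> - Y' t \<omega>) \<in> borel_measurable M" if "0 \<le> t" for t
        using YM[OF that] by measurable
    qed (rule b0)
    have le: "measure M {\<omega> \<in> space M. e < \<bar>\<xi> \<bullet> Y n (S \<omega>) \<omega> - \<xi> \<bullet> Y' (S \<omega>) \<omega>\<bar>} \<le> measure M (?A n)" for n
    proof (rule finite_measure_mono[OF _ A], safe)
      fix \<omega> assume "e < \<bar>\<xi> \<bullet> Y n (S \<omega>) \<omega> - \<xi> \<bullet> Y' (S \<omega>) \<omega>\<bar>"
      also have "\<dots> \<le> norm \<xi> * norm (Y n (S \<omega>) \<omega> - Y' (S \<omega>) \<omega>)"
        unfolding inner_diff_right[symmetric] by (rule Cauchy_Schwarz_ineq2)
      also have "\<dots> \<le> (norm \<xi> + 1) * norm (Y n (S \<omega>) \<omega> - Y' (S \<omega>) \<omega>)"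
        by (intro mult_right_mono) auto
      finally have "d < norm (Y n (S \<omega>) \<omega> - Y' (S \<omega>) \<omega>)"
        by (simp add: d_def pos_divide_less_eq add_nonneg_pos mult.commute)
      then show "\<exists>s\<in>{0..b}. d < norm (Y n s \<omega> - Y' s \<omega>)" using S0 Sb by (intro bexI[of _ "S \<omega>"]) auto
    qed
    have "(\<lambda>n. measure M (?A n)) \<longlonglongrightarrow> 0"
      using ucp[unfolded ucp_tendsto_def, rule_format, OF b0 d] .
    then show "(\<lambda>n. measure M {\<omega> \<in> space M. e < \<bar>\<xi> \<bullet> Y n (S \<omega>) \<omega> - \<xi> \<bullet> Y' (S \<omega>) \<omega>\<bar>}) \<longlonglongrightarrow> 0"
      by (rule Lim_null_comparison[rotated]) (intro always_eventually allI, use le in simp)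
  qed measurable
  from tendsto_mult_right[OF this, of "exp (b * B)"]
  have bound_lim: "(\<lambda>n. exp (b * B) * (LINT \<omega>|M. cmod (?e n \<omega> - ?e' \<omega>))) \<longlonglongrightarrow> 0"
    by (simp add: mult.commute)
  have bound: "cmod (1 - (LINT \<omega>|M. exp (?a n \<omega>) * ?e' \<omega>)) \<le> exp (b * B) * (LINT \<omega>|M. cmod (?e n \<omega> - ?e' \<omega>))" for n
  proof -
    have "1 - (LINT \<omega>|M. exp (?a n \<omega>) * ?e' \<omega>) = (LINT \<omega>|M. exp (?a n \<omega>) * ?e n \<omega> - exp (?a n \<omega>) * ?e' \<omega>)"
      using int[of n] E[of n] by (simp add: exp_add mult.commute)
    also have "cmod \<dots> \<le> (LINT \<omega>|M. cmod (exp (?a n \<omega>) * ?e n \<omega> - exp (?a n \<omega>) * ?e' \<omega>))"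
      by (rule integral_norm_bound)
    also have "\<dots> \<le> (LINT \<omega>|M. exp (b * B) * cmod (?e n \<omega> - ?e' \<omega>))"
    proof (rule integral_mono_AE)
      show "integrable M (\<lambda>\<omega>. exp (b * B) * cmod (?e n \<omega> - ?e' \<omega>))"
        by (intro integrable_mult_right integrable_const_bound[where B=2])
          (auto intro!: order_trans[OF norm_triangle_ineq4])
      show "AE \<omega> in M. cmod (exp (?a n \<omega>) * ?e n \<omega> - exp (?a n \<omega>) * ?e' \<omega>) \<le> exp (b * B) * cmod (?e n \<omega> - ?e' \<omega>)"
        using bnd unfolding right_diff_distrib[symmetric] norm_mult
        by eventually_elim (intro mult_right_mono, auto)
    qed (use int[of n] in \<open>intro integrable_norm Bochner_Integration.integrable_diff\<close>)
    finally show ?thesis by simp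
  qed
  have "(\<lambda>n. 1 - (LINT \<omega>|M. exp (?a n \<omega>) * ?e' \<omega>)) \<longlonglongrightarrow> 0"
    by (rule Lim_null_comparison[OF always_eventually[OF allI[OF bound]] bound_lim])
  from tendsto_diff[OF tendsto_const[of 1] this]
  have "(\<lambda>n. LINT \<omega>|M. exp (?a n \<omega>) * ?e' \<omega>) \<longlonglongrightarrow> 1" by simp
  moreover have "(\<lambda>n. LINT \<omega>|M. exp (?a n \<omega>) * ?e' \<omega>) \<longlonglongrightarrow> (LINT \<omega>|M. exp (?a' \<omega>) * ?e' \<omega>)"
  proof (rule integral_dominated_convergence[where w="\<lambda>_. exp (b * B)"])
    show "AE \<omega> in M. (\<lambda>n. exp (?a n \<omega>) * ?e' \<omega>) \<longlonglongrightarrow> exp (?a' \<omega>) * ?e' \<omega>"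
      using alim by eventually_elim (intro tendsto_intros)
    show "AE \<omega> in M. cmod (exp (?a n \<omega>) * ?e' \<omega>) \<le> exp (b * B)" for n
      using bnd by eventually_elim (simp add: norm_mult)
  qed auto
  ultimately have "(LINT \<omega>|M. exp (?a' \<omega>) * ?e' \<omega>) = 1" by (rule LIMSEQ_unique[rotated])
  then show "(LINT \<omega>|M. exp (\<i> * complex_of_real (\<xi> \<bullet> Y' (S \<omega>) \<omega>) + ?a' \<omega>)) = 1"
    by (simp add: exp_add mult.commute)
qed

text \<open>The pair \<open>(H, Y)\<close> is followed only up to stopping times before which \<open>H\<close> is bounded;
  this property survives the localized limits that generate the stochastic integral.\<close>

lemma exponential_martingale:
  fixes H :: "real \<Rightarrow> 'w \<Rightarrow> real ^ 'm ^ 'd" and Y :: "real \<Rightarrow> 'w \<Rightarrow> real ^ 'd"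
  assumes "stochastic_integral M F Z H Y"
    and "stopping_time F T" "\<And>\<omega>. 0 \<le> T \<omega>" "\<And>\<omega>. T \<omega> \<le> b"
    and "AE \<omega> in M. \<forall>t. 0 < t \<and> t \<le> T \<omega> \<longrightarrow> norm (H t \<omega>) \<le> c"
  shows "(\<lambda>\<omega>. exponent_integral H \<xi> \<omega> (T \<omega>)) \<in> borel_measurable M
    \<and> (LINT \<omega>|M. exp (\<i> * complex_of_real (\<xi> \<bullet> Y (T \<omega>) \<omega>) + exponent_integral H \<xi> \<omega> (T \<omega>))) = 1"
  using assms
proof (induction arbitrary: T b c rule: stochastic_integral.induct)
  case (elementary \<tau> A n)
  show ?case
    using exponential_martingale_elementary[OF elementary.hyps elementary.prems(1-3)] by blast
next
  case (dominated_limit H Y H' Y')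
  note T = dominated_limit.prems(1-3)
  obtain R :: "nat \<Rightarrow> 'w \<Rightarrow> real" and K :: "nat \<Rightarrow> real" where R: "\<And>k. stopping_time F (R k)" "\<And>k \<omega>. 0 \<le> R k \<omega>"
    and Rinf: "AE \<omega> in M. incseq (\<lambda>k. R k \<omega>) \<and> filterlim (\<lambda>k. R k \<omega>) at_top sequentially"
    and RK: "AE \<omega> in M. \<forall>k n t. 0 < t \<and> t \<le> R k \<omega> \<longrightarrow> norm (H n t \<omega>) \<le> K k"
    using dominated_limit.hyps(2) unfolding locally_uniformly_bounded_def by blast
  \<comment> \<open>Up to \<open>T\<close> only the limit \<open>H'\<close> is bounded. Up to
    \<open>R k\<close> all approximants share the bound \<open>K k\<close>, so at \<open>S k\<close>
    both the induction hypothesis and the limit lemma apply.\<close>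
  define S where "S k \<omega> = min (T \<omega>) (R k \<omega>)" for k \<omega>
  have S: "stopping_time F (S k)" "0 \<le> S k \<omega>" "S k \<omega> \<le> b" for k \<omega>
    using stopping_time_min[OF T(1) R(1)] T(2,3) R(2) by (auto simp: S_def[abs_def] min_le_iff_disj)
  have Sb: "AE \<omega> in M. \<forall>n t. 0 < t \<and> t \<le> S k \<omega> \<longrightarrow> norm (H n t \<omega>) \<le> K k" for k
    using RK by eventually_elim (auto simp: S_def)
  have Sb1: "AE \<omega> in M. \<forall>t. 0 < t \<and> t \<le> S k \<omega> \<longrightarrow> norm (H n t \<omega>) \<le> K k" for k n
    using Sb[of k] by eventually_elim auto
  note step = exponential_martingale_bounded_limit[OF dominated_limit.hyps(1)
      conjunct1[OF dominated_limit.IH[OF S(1-3) Sb1]] conjunct2[OF dominated_limit.IH[OF S(1-3) Sb1]]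
      Sb dominated_limit.hyps(3-6) S(1-3)]
  have b0: "0 \<le> b" using T(2,3) order_trans by blast
  obtain c' where c': "\<And>A :: real ^ 'm ^ 'd. norm A \<le> c \<Longrightarrow> norm (transpose A *v \<xi>) \<le> c'"
    using bounded_transpose_mult[of c \<xi>] by blast
  obtain B where B: "0 < B" "\<And>y. norm y \<le> c' \<Longrightarrow> cmod (\<psi> y) \<le> B"
    using \<psi>_bounded_on_cball[of c'] by blast
  let ?a = "\<lambda>k \<omega>. exponent_integral H' \<xi> \<omega> (S k \<omega>)" and ?a' = "\<lambda>\<omega>. exponent_integral H' \<xi> \<omega> (T \<omega>)"
  have ev: "AE \<omega> in M. eventually (\<lambda>k. S k \<omega> = T \<omega>) sequentially"
    using Rinf
  proof eventually_elim
    case (elim \<omega>)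
    then have "eventually (\<lambda>k. T \<omega> \<le> R k \<omega>) sequentially" by (simp add: filterlim_at_top)
    then show ?case by eventually_elim (simp add: S_def)
  qed
  \<comment> \<open>The bound now comes from \<open>c\<close>, that is from \<open>H'\<close> up to
    \<open>T\<close>. Unlike \<open>K k\<close> it does not depend on \<open>k\<close>, and so it
    dominates as \<open>S k\<close> reaches \<open>T\<close>.\<close>
  have ab: "AE \<omega> in M. \<forall>k. cmod (?a k \<omega>) \<le> b * B"
    using dominated_limit.prems(4)
  proof eventually_elim
    case (elim \<omega>)
    have "cmod (?a k \<omega>) \<le> S k \<omega> * B" for k
      unfolding exponent_integral_def using elim S(2)
      by (intro norm_LINT_Ioc_le B(2) c') (auto simp: S_def)
    also have "S k \<omega> * B \<le> b * B" for k using S(3) B(1) by (intro mult_right_mono) auto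
    finally show ?case by blast
  qed
  have a' [measurable]: "?a' \<in> borel_measurable M"
  proof (rule borel_measurable_AE_limit[OF step(1)])
    show "AE \<omega> in M. (\<lambda>k. ?a k \<omega>) \<longlonglongrightarrow> ?a' \<omega>"
      using ev by eventually_elim (rule tendsto_eventually, auto elim!: eventually_mono)
  qed
  have YM: "Y' t \<in> borel_measurable M" if "0 \<le> t" for t
    using dominated_limit.hyps(4) that by (auto simp: adapted_def intro: measurable_F_imp_M[of _ t])
  have rc: "AE \<omega> in M. \<forall>t\<ge>0. continuous (at_right t) (\<lambda>s. Y' s \<omega>)"
    using dominated_limit.hyps(5) by (auto simp: cadlag_def)
  have Y [measurable]: "(\<lambda>\<omega>. Y' (T \<omega>) \<omega>) \<in> borel_measurable M" "(\<lambda>\<omega>. Y' (S k \<omega>) \<omega>) \<in> borel_measurable M" for k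
    using measurable_at_random_time[OF YM rc stopping_time_measurable_M] T(1,2) S(1,2) by auto
  note [measurable] = step(1)
  have "(\<lambda>k. LINT \<omega>|M. exp (\<i> * complex_of_real (\<xi> \<bullet> Y' (S k \<omega>) \<omega>) + ?a k \<omega>))
      \<longlonglongrightarrow> (LINT \<omega>|M. exp (\<i> * complex_of_real (\<xi> \<bullet> Y' (T \<omega>) \<omega>) + ?a' \<omega>))"
  proof (rule integral_dominated_convergence[where w="\<lambda>_. exp (b * B)"])
    show "AE \<omega> in M. (\<lambda>k. exp (\<i> * complex_of_real (\<xi> \<bullet> Y' (S k \<omega>) \<omega>) + ?a k \<omega>))
        \<longlonglongrightarrow> exp (\<i> * complex_of_real (\<xi> \<bullet> Y' (T \<omega>) \<omega>) + ?a' \<omega>)"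
      using ev by eventually_elim (rule tendsto_eventually, auto elim!: eventually_mono)
    show "AE \<omega> in M. cmod (exp (\<i> * complex_of_real (\<xi> \<bullet> Y' (S k \<omega>) \<omega>) + ?a k \<omega>)) \<le> exp (b * B)" for k
      using ab by eventually_elim (auto intro: order_trans[OF complex_Re_le_cmod])
  qed auto
  then have "(LINT \<omega>|M. exp (\<i> * complex_of_real (\<xi> \<bullet> Y' (T \<omega>) \<omega>) + ?a' \<omega>)) = 1"
    unfolding step(2) by (simp add: LIMSEQ_const_iff)
  with a' show ?case by blast
qed

end

section \<open>The symbol of the solution\<close>

text \<open>A rational chosen in the gap to the right of each point lies below every later point of
  \<open>A\<close>, so distinct points receive distinct rationals.\<close>

lemma countable_right_isolated:
  fixes A :: "real set"
  assumes "\<And>t. t \<in> A \<Longrightarrow> \<exists>d>0. \<forall>u\<in>A. \<not> (t < u \<and> u < t + d)"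
  shows "countable A"
proof -
  obtain d where d: "\<And>t. t \<in> A \<Longrightarrow> 0 < d t" "\<And>t u. t \<in> A \<Longrightarrow> u \<in> A \<Longrightarrow> \<not> (t < u \<and> u < t + d t)"
    using assms by metis
  have "\<exists>q\<in>\<rat>. t < q \<and> q < t + d t" if "t \<in> A" for t
    using Rats_dense_in_real[of t "t + d t"] d(1)[OF that] by auto
  then obtain q where q: "\<And>t. t \<in> A \<Longrightarrow> q t \<in> \<rat>" "\<And>t. t \<in> A \<Longrightarrow> t < q t" "\<And>t. t \<in> A \<Longrightarrow> q t < t + d t"
    by metis
  have "inj_on q A"
  proof (rule inj_onI)
    fix t u assume tu: "t \<in> A" "u \<in> A" "q t = q u"
    have "\<not> t < u" using d(2)[OF tu(1,2)] q(3)[OF tu(1)] q(2)[OF tu(2)] tu(3) by auto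
    moreover have "\<not> u < t" using d(2)[OF tu(2,1)] q(3)[OF tu(2)] q(2)[OF tu(1)] tu(3) by auto
    ultimately show "t = u" by simp
  qed
  moreover have "countable (q ` A)"
    using q(1) by (intro countable_subset[OF _ countable_rat]) auto
  ultimately show ?thesis by (rule countable_image_inj_on[rotated])
qed

text \<open>Jumps larger than \<open>e\<close> are isolated from the right: shortly after
  \<open>t\<close> the path, and with it its left limits, stays within \<open>e / 2\<close> of
  \<open>f t\<close>. Let \<open>e\<close> run through \<open>1 / real (Suc n)\<close>.\<close>

lemma cadlag_countable_jumps:
  fixes f :: "real \<Rightarrow> 'b::metric_space"
  assumes "cadlag f"
  shows "countable {t. 0 < t \<and> Lim (at_left t) f \<noteq> f t}"
proof -
  define A where "A e = {t. 0 < t \<and> e < dist (Lim (at_left t) f) (f t)}" for e :: real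
  have "countable (A e)" if e: "0 < e" for e
  proof (rule countable_right_isolated)
    fix t assume "t \<in> A e"
    then have t: "0 < t" by (simp add: A_def)
    then have "(f \<longlongrightarrow> f t) (at_right t)" using assms by (simp add: cadlag_def continuous_within)
    from tendstoD[OF this, of "e / 2"] e obtain b where b: "t < b" "\<And>u. t < u \<Longrightarrow> u < b \<Longrightarrow> dist (f u) (f t) < e / 2"
      unfolding eventually_at_right_field by auto
    have "u \<notin> A e" if u: "t < u" "u < b" for u
    proof -
      have "0 < u" using t u by simp
      then obtain l where l: "(f \<longlongrightarrow> l) (at_left u)" using assms unfolding cadlag_def by blast
      have "eventually (\<lambda>v. dist (f v) (f t) \<le> e / 2) (at_left u)"
        unfolding eventually_at_left_field using b(2) u by (intro exI[of _ t]) (auto intro: less_imp_le)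
      with tendsto_dist[OF l tendsto_const[of "f t"]] have "dist l (f t) \<le> e / 2"
        by (rule tendsto_upperbound) simp
      moreover have "Lim (at_left u) f = l" using l by (intro tendsto_Lim) auto
      ultimately show ?thesis using b(2)[OF u] dist_triangle2[of l "f u" "f t"] by (auto simp: A_def)
    qed
    with b(1) show "\<exists>d>0. \<forall>u\<in>A e. \<not> (t < u \<and> u < t + d)"
      by (intro exI[of _ "b - t"]) auto
  qed
  then have "countable (\<Union>n. A (1 / real (Suc n)))" by (intro countable_UN) auto
  moreover have "{t. 0 < t \<and> Lim (at_left t) f \<noteq> f t} \<subseteq> (\<Union>n. A (1 / real (Suc n)))"
  proof
    fix t assume t: "t \<in> {t. 0 < t \<and> Lim (at_left t) f \<noteq> f t}"
    then have "0 < dist (Lim (at_left t) f) (f t)" by simp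
    then obtain n where "1 / real (Suc n) < dist (Lim (at_left t) f) (f t)" by (rule nat_approx_posE)
    with t show "t \<in> (\<Union>n. A (1 / real (Suc n)))" unfolding A_def by blast
  qed
  ultimately show ?thesis by (rule countable_subset[rotated])
qed

text \<open>Integrability is asked only for small \<open>t\<close>, because in the application the
  integrand is controlled only until the exit from \<open>K\<close>.\<close>

lemma LINT_Ioc_average_tendsto:
  fixes f :: "real \<Rightarrow> complex"
  assumes lim: "(f \<longlongrightarrow> l) (at_right 0)"
    and int: "eventually (\<lambda>t. integrable lborel (\<lambda>s. indicator {0<..t} s *\<^sub>R f s)) (at_right 0)"
  shows "((\<lambda>t. (LINT s|lborel. indicator {0<..t} s *\<^sub>R f s) / complex_of_real t) \<longlongrightarrow> l) (at_right 0)"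
proof (rule tendstoI)
  fix e :: real assume e: "0 < e"
  from tendstoD[OF lim, of "e / 2"] e obtain b where b: "0 < b" "\<And>s. 0 < s \<Longrightarrow> s < b \<Longrightarrow> dist (f s) l < e / 2"
    unfolding eventually_at_right_field by auto
  have "eventually (\<lambda>t. 0 < t \<and> t < b) (at_right 0)"
    unfolding eventually_at_right_field using b(1) by auto
  with int show "\<forall>\<^sub>F t in at_right 0. dist ((LINT s|lborel. indicator {0<..t} s *\<^sub>R f s) / complex_of_real t) l < e"
  proof eventually_elim
    case (elim t)
    have c: "integrable lborel (\<lambda>s. indicator {0<..t} s *\<^sub>R l)"
      using elim by (intro integrable_scaleR_left integrable_real_indicator) auto
    have "(LINT s|lborel. indicator {0<..t} s *\<^sub>R f s) - complex_of_real t * l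
        = (LINT s|lborel. indicator {0<..t} s *\<^sub>R f s) - (LINT s|lborel. indicator {0<..t} s *\<^sub>R l)"
      using elim by (simp add: scaleR_conv_of_real)
    also have "\<dots> = (LINT s|lborel. indicator {0<..t} s *\<^sub>R (f s - l))"
      unfolding scaleR_diff_right using elim c by (intro Bochner_Integration.integral_diff[symmetric]) auto
    also have "cmod \<dots> \<le> t * (e / 2)"
      using elim b(2) by (intro norm_LINT_Ioc_le) (auto simp: dist_norm intro!: less_imp_le)
    also have "\<dots> < t * e" using elim e by simp
    finally have "cmod ((LINT s|lborel. indicator {0<..t} s *\<^sub>R f s) - complex_of_real t * l) / t < e"
      using elim by (simp add: pos_divide_less_eq mult.commute)
    moreover have "(LINT s|lborel. indicator {0<..t} s *\<^sub>R f s) / complex_of_real t - l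
        = ((LINT s|lborel. indicator {0<..t} s *\<^sub>R f s) - complex_of_real t * l) / complex_of_real t"
      using elim by (simp add: field_simps)
    ultimately show ?case using elim by (simp add: dist_norm norm_divide)
  qed
qed

lemma exp_increment_quotient_tendsto:
  fixes a :: "real \<Rightarrow> complex"
  assumes lim: "((\<lambda>t. a t / complex_of_real t) \<longlongrightarrow> l) (at_right 0)"
  shows "((\<lambda>t. (1 - exp (a t)) / complex_of_real t) \<longlongrightarrow> - l) (at_right 0)"
proof -
  \<comment> \<open>The removable singularity is filled in, since \<open>a t\<close> may vanish at
    times \<open>t > 0\<close>.\<close>
  define E :: "complex \<Rightarrow> complex" where "E z = (if z = 0 then 1 else (exp z - 1) / z)" for z
  have "(E \<longlongrightarrow> 1) (at 0)"
    by (rule Lim_transform_eventually[OF lim_exp_minus_1]) (auto simp: E_def eventually_at_filter)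
  then have E: "isCont E 0" by (simp add: isCont_def E_def)
  have E0: "E 0 = 1" by (simp add: E_def)
  have pos: "eventually (\<lambda>t::real. 0 < t) (at_right 0)" by (rule eventually_at_right_less)
  have "((\<lambda>t. complex_of_real t) \<longlongrightarrow> complex_of_real 0) (at_right 0)" by (intro tendsto_intros)
  from tendsto_mult[OF lim this] have "((\<lambda>t. a t / complex_of_real t * complex_of_real t) \<longlongrightarrow> 0) (at_right 0)"
    by simp
  moreover have "eventually (\<lambda>t. a t / complex_of_real t * complex_of_real t = a t) (at_right 0)"
    using pos by (rule eventually_mono) simp
  ultimately have "(a \<longlongrightarrow> 0) (at_right 0)" by (rule Lim_transform_eventually)
  from tendsto_minus[OF tendsto_mult[OF lim isCont_tendsto_compose[OF E this]]]
  have "((\<lambda>t. - (a t / complex_of_real t * E (a t))) \<longlongrightarrow> - l) (at_right 0)"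
    by (simp only: E0 mult_1_right)
  moreover have "- (a t / complex_of_real t * E (a t)) = (1 - exp (a t)) / complex_of_real t" for t
    by (cases "t = 0"; cases "a t = 0") (simp_all add: E_def field_simps)
  ultimately show ?thesis by simp
qed

section \<open>Exit times as stopping times\<close>

lemma exit_time_nonneg: "0 \<le> exit_time X K \<omega>"
  unfolding exit_time_def by (rule Inf_greatest) auto

lemma exit_time_less_iff: "exit_time X K \<omega> < ereal r \<longleftrightarrow> (\<exists>t. 0 \<le> t \<and> t < r \<and> X t \<omega> \<notin> K)"
  unfolding exit_time_def Inf_less_iff by auto

lemma mem_before_exit_time: "0 \<le> t \<Longrightarrow> ereal t < exit_time X K \<omega> \<Longrightarrow> X t \<omega> \<in> K"
proof (rule ccontr)
  assume "0 \<le> t" "ereal t < exit_time X K \<omega>" "X t \<omega> \<notin> K"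
  moreover from this have "exit_time X K \<omega> \<le> ereal t"
    unfolding exit_time_def by (intro Inf_lower) blast
  ultimately show False by simp
qed

text \<open>The time at which \<open>stopped\<close> evaluates the path, as a real-valued random
  time. For \<open>t \<ge> 0\<close> the minimum is finite even if the path never exits, so the
  conversion to \<open>real\<close> loses nothing.\<close>

definition stopped_time :: "(real \<Rightarrow> 'w \<Rightarrow> 'b) \<Rightarrow> 'b set \<Rightarrow> real \<Rightarrow> 'w \<Rightarrow> real" where
  "stopped_time X K t \<omega> = real_of_ereal (min (ereal t) (exit_time X K \<omega>))"

lemma ereal_stopped_time:
  "0 \<le> t \<Longrightarrow> ereal (stopped_time X K t \<omega>) = min (ereal t) (exit_time X K \<omega>)"
  using exit_time_nonneg[of X K \<omega>] unfolding stopped_time_def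
  by (cases "exit_time X K \<omega>") (auto simp: min_def)

lemma stopped_time_bounds:
  assumes "0 \<le> t"
  shows "0 \<le> stopped_time X K t \<omega>" "stopped_time X K t \<omega> \<le> t"
    "ereal (stopped_time X K t \<omega>) \<le> exit_time X K \<omega>"
proof -
  note eq = ereal_stopped_time[OF assms, of X K \<omega>]
  have "0 \<le> ereal (stopped_time X K t \<omega>)" unfolding eq using assms exit_time_nonneg by simp
  then show "0 \<le> stopped_time X K t \<omega>" by simp
  have "ereal (stopped_time X K t \<omega>) \<le> ereal t" unfolding eq by simp
  then show "stopped_time X K t \<omega> \<le> t" by simp
  show "ereal (stopped_time X K t \<omega>) \<le> exit_time X K \<omega>" unfolding eq by simp
qed

context levy_basis
begin

text \<open>By the usual conditions \<open>F 0\<close>, hence \<open>F r\<close>, contains all null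
  sets of \<open>M\<close>.\<close>

lemma sets_F_AE:
  assumes A: "A \<in> sets (F r)" and "0 \<le> r" and B: "B \<subseteq> space M"
    and ae: "AE \<omega> in M. \<omega> \<in> A \<longleftrightarrow> \<omega> \<in> B"
  shows "B \<in> sets (F r)"
proof -
  have A_sp: "A \<subseteq> space M" using sets.sets_into_space[OF A] by (simp add: space_F)
  have "AE \<omega> in M. \<omega> \<notin> B - A \<and> \<omega> \<notin> A - B" using ae by eventually_elim auto
  then have "B - A \<in> null_sets M" "A - B \<in> null_sets M"
    using A_sp B unfolding null_sets_iff_AE by auto
  moreover have "null_sets M \<subseteq> sets (F r)"
    using basis sets_F_mono[OF \<open>0 \<le> r\<close>] unfolding stochastic_basis_def by blast
  ultimately have "A \<union> (B - A) - (A - B) \<in> sets (F r)" using A by blast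
  also have "A \<union> (B - A) - (A - B) = B" by auto
  finally show ?thesis .
qed

text \<open>The complement of \<open>K\<close> is open, so a right continuous path outside
  \<open>K\<close> at \<open>t < r\<close> is still outside at some rational time before
  \<open>r\<close>.\<close>

lemma exit_time_less_measurable:
  fixes X :: "real \<Rightarrow> 'w \<Rightarrow> 'b::topological_space"
  assumes X: "adapted F X" and rc: "AE \<omega> in M. \<forall>t\<ge>0. continuous (at_right t) (\<lambda>s. X s \<omega>)"
    and K: "closed K" and r: "0 \<le> r"
  shows "{\<omega> \<in> space M. exit_time X K \<omega> < ereal r} \<in> sets (F r)"
proof (rule sets_F_AE[OF _ r])
  let ?I = "\<rat> \<inter> {0..<r}"
  have "{\<omega> \<in> space (F r). X t \<omega> \<notin> K} \<in> sets (F r)" if "t \<in> ?I" for t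
  proof -
    have "X t \<in> borel_measurable (F t)" using X that by (simp add: adapted_def)
    then have "X t \<in> borel_measurable (F r)" by (rule measurable_F_mono) (use that in simp)
    moreover have "- K \<in> sets borel" using K by auto
    ultimately have "X t -` (- K) \<inter> space (F r) \<in> sets (F r)" by (rule measurable_sets)
    also have "X t -` (- K) \<inter> space (F r) = {\<omega> \<in> space (F r). X t \<omega> \<notin> K}" by auto
    finally show ?thesis .
  qed
  moreover have "countable ?I" using countable_rat by auto
  ultimately have "{\<omega> \<in> space (F r). \<exists>t\<in>?I. X t \<omega> \<notin> K} \<in> sets (F r)"
    by (rule sets.sets_Collect_countable_Ex')
  then show "{\<omega> \<in> space M. \<exists>t\<in>?I. X t \<omega> \<notin> K} \<in> sets (F r)" by (simp add: space_F)
  show "AE \<omega> in M. \<omega> \<in> {\<omega> \<in> space M. \<exists>t\<in>?I. X t \<omega> \<notin> K} \<longleftrightarrow>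
      \<omega> \<in> {\<omega> \<in> space M. exit_time X K \<omega> < ereal r}"
    using rc
  proof eventually_elim
    case (elim \<omega>)
    have "\<exists>q\<in>?I. X q \<omega> \<notin> K" if t: "0 \<le> t" "t < r" "X t \<omega> \<notin> K" for t
    proof -
      have "((\<lambda>s. X s \<omega>) \<longlongrightarrow> X t \<omega>) (at_right t)" using elim t(1) by (simp add: continuous_within)
      from topological_tendstoD[OF this, of "- K"] K t(3)
      have "eventually (\<lambda>s. X s \<omega> \<in> - K) (at_right t)" by auto
      then obtain b where b: "t < b" "\<And>u. t < u \<Longrightarrow> u < b \<Longrightarrow> X u \<omega> \<in> - K"
        unfolding eventually_at_right_field by blast
      obtain q where "q \<in> \<rat>" "t < q" "q < min b r"
        using Rats_dense_in_real[of t "min b r"] b(1) t(2) by auto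
      with b(2)[of q] t(1) show ?thesis by (intro bexI[of _ q]) auto
    qed
    then show ?case unfolding exit_time_less_iff by auto
  qed
qed auto

text \<open>Only events with a strict inequality are available so far. The event that the exit
  occurs by \<open>s\<close> is an intersection of such events for radii decreasing to
  \<open>s\<close>, hence in \<open>F u\<close> for all \<open>u > s\<close>, and right continuity
  of the filtration puts it into \<open>F s\<close>.\<close>

lemma stopping_time_stopped_time:
  fixes X :: "real \<Rightarrow> 'w \<Rightarrow> 'b::topological_space"
  assumes X: "adapted F X" and rc: "AE \<omega> in M. \<forall>t\<ge>0. continuous (at_right t) (\<lambda>s. X s \<omega>)"
    and K: "closed K" and t: "0 \<le> t"
  shows "stopping_time F (stopped_time X K t)"
proof
  fix s
  have "{\<omega> \<in> space M. stopped_time X K t \<omega> \<le> s} \<in> sets (F s)"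
  proof -
    consider "s < 0" | "t \<le> s" | "0 \<le> s" "s < t" by linarith
    then show ?thesis
    proof cases
      case 1
      have "\<not> stopped_time X K t \<omega> \<le> s" for \<omega>
        using stopped_time_bounds(1)[OF t, of X K \<omega>] 1 by linarith
      then show ?thesis by simp
    next
      case 2
      have "stopped_time X K t \<omega> \<le> s" for \<omega>
        using stopped_time_bounds(2)[OF t, of X K \<omega>] 2 by linarith
      then show ?thesis using sets.top[of "F s"] by (simp add: space_F)
    next
      case 3
      have eq: "stopped_time X K t \<omega> \<le> s \<longleftrightarrow> exit_time X K \<omega> \<le> ereal s" for \<omega>
      proof -
        have "stopped_time X K t \<omega> \<le> s \<longleftrightarrow> min (ereal t) (exit_time X K \<omega>) \<le> ereal s"
          using ereal_stopped_time[OF t, of X K \<omega>] by (metis ereal_less_eq(3))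
        with 3 show ?thesis by (auto simp: min_le_iff_disj)
      qed
      have "{\<omega> \<in> space M. exit_time X K \<omega> \<le> ereal s} \<in> sets (F u)" if u: "s < u" for u
      proof -
        let ?r = "\<lambda>n. s + (u - s) / real (Suc n)"
        have r: "s < ?r n" "?r n \<le> u" for n
          using u divide_left_mono[of 1 "real (Suc n)" "u - s"] by simp_all
        have "{\<omega> \<in> space M. exit_time X K \<omega> < ereal (?r n)} \<in> sets (F u)" for n
          using exit_time_less_measurable[OF X rc K, of "?r n"] sets_F_mono[OF r(2)] r(1)[of n] 3 by auto
        then have "(\<Inter>n. {\<omega> \<in> space M. exit_time X K \<omega> < ereal (?r n)}) \<in> sets (F u)" by auto
        also have "(\<Inter>n. {\<omega> \<in> space M. exit_time X K \<omega> < ereal (?r n)}) = {\<omega> \<in> space M. exit_time X K \<omega> \<le> ereal s}"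
        proof safe
          fix \<omega> assume \<omega>: "\<omega> \<in> (\<Inter>n. {\<omega> \<in> space M. exit_time X K \<omega> < ereal (?r n)})"
          then show "\<omega> \<in> space M" by auto
          have "(\<lambda>n. ereal (?r n)) \<longlonglongrightarrow> ereal s"
            using tendsto_add[OF tendsto_const[of s] tendsto_mult[OF tendsto_const[of "u - s"] LIMSEQ_inverse_real_of_nat]]
            by (simp add: divide_inverse)
          moreover have "\<exists>N. \<forall>n\<ge>N. exit_time X K \<omega> \<le> ereal (?r n)"
            using \<omega> by (auto intro: less_imp_le)
          ultimately show "exit_time X K \<omega> \<le> ereal s"
            by (rule LIMSEQ_le_const)
        next
          fix \<omega> n assume "exit_time X K \<omega> \<le> ereal s"
          also have "ereal s < ereal (?r n)" using r(1) by simp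
          finally show "exit_time X K \<omega> < ereal (?r n)" .
        qed
        finally show ?thesis .
      qed
      moreover have "sets (F s) = (\<Inter>u\<in>{s<..}. sets (F u))"
        using basis 3 unfolding stochastic_basis_def by auto
      ultimately show ?thesis unfolding eq by auto
    qed
  qed
  then show "Measurable.pred (F s) (\<lambda>\<omega>. stopped_time X K t \<omega> \<le> s)" by (simp add: pred_def space_F)
qed

text \<open>With \<open>Y = X - x\<close>, the exponential martingale at the stopped time and its exponent \<open>a\<close> give
  \<open>E e\<^sup>i\<^sup>\<xi>\<^sup>Y - 1 = E (e\<^sup>i\<^sup>\<xi>\<^sup>Y (1 - e\<^sup>a))\<close>. After division by \<open>t\<close> the integrand on the right
  is bounded and converges pointwise, because \<open>\<Phi> \<circ> X\<close> is right continuous at time 0.\<close>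

lemma symbol_limit:
  fixes \<Phi> :: "real ^ 'd \<Rightarrow> real ^ 'm ^ 'd" and X :: "real ^ 'd \<Rightarrow> real \<Rightarrow> 'w \<Rightarrow> real ^ 'd"
  assumes sol: "sde_solution M F Z \<Phi> x (X x)" and fine: "finely_continuous M X \<Phi>"
    and lb: "locally_bounded \<Phi>" and K: "compact K" "x \<in> interior K"
  shows "((\<lambda>t. - ((LINT \<omega>|M. iexp ((stopped (X x) (exit_time (X x) K) t \<omega> - x) \<bullet> \<xi>) - 1)
      / complex_of_real t)) \<longlongrightarrow> \<psi> (transpose (\<Phi> x) *v \<xi>)) (at_right 0)"
proof -
  define H where "H t \<omega> = \<Phi> (Lim (at_left t) (\<lambda>s. X x s \<omega>))" for t \<omega>
  have XF: "adapted F (X x)" and Xc: "AE \<omega> in M. cadlag (\<lambda>t. X x t \<omega>)"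
    using sol by (auto simp: sde_solution_def)
  obtain Y where SI: "stochastic_integral M F Z H Y"
    and XY: "AE \<omega> in M. \<forall>t\<ge>0. X x t \<omega> = x + Y t \<omega>"
    using sol by (auto simp: sde_solution_def indistinguishable_def H_def[abs_def])
  note reg = stochastic_integral_regular[OF SI]
  have Xrc: "AE \<omega> in M. \<forall>t\<ge>0. continuous (at_right t) (\<lambda>s. X x s \<omega>)"
    using Xc by (auto simp: cadlag_def)
  have fine0: "AE \<omega> in M. \<forall>t\<ge>0. continuous (at_right t) (\<lambda>s. \<Phi> (X x s \<omega>))"
    using fine by (simp add: finely_continuous_def)
  let ?T = "stopped_time (X x) K"
  note T = stopping_time_stopped_time[OF XF Xrc compact_imp_closed[OF K(1)]] and T_bounds = stopped_time_bounds[of _ "X x" K]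
  have "bounded (\<Phi> ` K)" using lb K(1) by (simp add: locally_bounded_def)
  then obtain c where c: "\<And>y. y \<in> K \<Longrightarrow> norm (\<Phi> y) \<le> c" by (auto simp: bounded_iff)
  obtain c' where c': "\<And>A :: real ^ 'm ^ 'd. norm A \<le> c \<Longrightarrow> norm (transpose A *v \<xi>) \<le> c'"
    using bounded_transpose_mult[of c \<xi>] by blast
  obtain B where B: "0 < B" "\<And>y. norm y \<le> c' \<Longrightarrow> cmod (\<psi> y) \<le> B"
    using \<psi>_bounded_on_cball[of c'] by blast
  \<comment> \<open>The exit time itself is included: the path may jump out of \<open>K\<close>
    there, but the integrand uses its left limit, which remains in the closed set
    \<open>K\<close>.\<close>
  have H_bound: "AE \<omega> in M. \<forall>s. 0 < s \<and> ereal s \<le> exit_time (X x) K \<omega> \<longrightarrow> norm (H s \<omega>) \<le> c"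
    using Xc
  proof eventually_elim
    case (elim \<omega>)
    have "norm (H s \<omega>) \<le> c" if s: "0 < s" "ereal s \<le> exit_time (X x) K \<omega>" for s
    proof -
      obtain l where l: "((\<lambda>t. X x t \<omega>) \<longlongrightarrow> l) (at_left s)"
        using elim s(1) unfolding cadlag_def by blast
      have "X x u \<omega> \<in> K" if "0 < u" "u < s" for u
        using mem_before_exit_time[OF less_imp_le[OF that(1)] less_le_trans[OF _ s(2)]] that(2) by simp
      then have "eventually (\<lambda>u. X x u \<omega> \<in> K) (at_left s)"
        unfolding eventually_at_left_field using s(1) by blast
      with l have "l \<in> K" using compact_imp_closed[OF K(1)] by (intro Lim_in_closed_set) auto
      moreover have "Lim (at_left s) (\<lambda>t. X x t \<omega>) = l" using l by (intro tendsto_Lim) auto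
      ultimately show ?thesis using c by (simp add: H_def)
    qed
    then show ?case by blast
  qed
  have H_T: "AE \<omega> in M. \<forall>s. 0 < s \<and> s \<le> ?T t \<omega> \<longrightarrow> norm (H s \<omega>) \<le> c" if "0 \<le> t" for t
    using H_bound
  proof eventually_elim
    case (elim \<omega>)
    show ?case
    proof (intro allI impI)
      fix s assume s: "0 < s \<and> s \<le> ?T t \<omega>"
      then have "ereal s \<le> ereal (?T t \<omega>)" by simp
      also have "\<dots> \<le> exit_time (X x) K \<omega>" by (rule T_bounds(3)[OF that])
      finally show "norm (H s \<omega>) \<le> c" using elim s by blast
    qed
  qed
  let ?a = "\<lambda>t \<omega>. exponent_integral H \<xi> \<omega> (?T t \<omega>)"
  have a [measurable]: "?a t \<in> borel_measurable M"
    and E: "(LINT \<omega>|M. exp (\<i> * complex_of_real (\<xi> \<bullet> Y (?T t \<omega>) \<omega>) + ?a t \<omega>)) = 1" if "0 \<le> t" for t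
    using exponential_martingale[OF SI T[OF that] T_bounds(1)[OF that] T_bounds(2)[OF that] H_T[OF that]] by auto
  have a_bound: "AE \<omega> in M. cmod (?a t \<omega>) \<le> t * B" if "0 \<le> t" for t
    using H_T[OF that]
  proof eventually_elim
    case (elim \<omega>)
    then have "cmod (?a t \<omega>) \<le> ?T t \<omega> * B"
      unfolding exponent_integral_def using T_bounds(1)[OF that] by (intro norm_LINT_Ioc_le B(2) c') auto
    also have "\<dots> \<le> t * B" using T_bounds(2)[OF that] B(1) by (intro mult_right_mono) auto
    finally show ?case .
  qed
  have YM: "Y t \<in> borel_measurable M" if "0 \<le> t" for t
    using reg that by (auto simp: adapted_def intro: measurable_F_imp_M[of _ t])
  have Yrc: "AE \<omega> in M. \<forall>t\<ge>0. continuous (at_right t) (\<lambda>s. Y s \<omega>)"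
    using reg by (auto simp: cadlag_def)
  have YT: "(\<lambda>\<omega>. Y (?T t \<omega>) \<omega>) \<in> borel_measurable M" if "0 \<le> t" for t
    using measurable_at_random_time[OF YM Yrc stopping_time_measurable_M[OF T[OF that]] T_bounds(1)[OF that]] by auto
  define D where "D t \<omega> = iexp (\<xi> \<bullet> Y (?T t \<omega>) \<omega>) * ((1 - exp (?a t \<omega>)) / complex_of_real t)" for t \<omega>
  have D_bound: "AE \<omega> in M. cmod (D t \<omega>) \<le> B * exp (t * B)" if "0 < t" for t
    using a_bound[OF less_imp_le[OF that]]
  proof eventually_elim
    case (elim \<omega>)
    \<comment> \<open>The factor \<open>t\<close> in the bound for the exponent cancels the division
      by \<open>t\<close> in \<open>D\<close>.\<close>
    have "cmod (1 - exp (?a t \<omega>)) \<le> exp \<bar>Re (?a t \<omega>)\<bar> * cmod (?a t \<omega>)"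
      using Taylor_exp[of "?a t \<omega>" 0] by (simp add: norm_minus_commute)
    also have "\<dots> \<le> exp (t * B) * (t * B)"
      using elim abs_Re_le_cmod[of "?a t \<omega>"] by (intro mult_mono) auto
    finally show ?case using that by (simp add: D_def norm_mult norm_divide pos_divide_le_eq mult_ac)
  qed
  have D_meas: "D t \<in> borel_measurable M" if "0 < t" for t
  proof -
    note [measurable] = YT[OF less_imp_le[OF that]] a[OF less_imp_le[OF that]]
    show ?thesis unfolding D_def[abs_def] by measurable
  qed
  have quotient: "- ((LINT \<omega>|M. iexp ((stopped (X x) (exit_time (X x) K) t \<omega> - x) \<bullet> \<xi>) - 1) / complex_of_real t)
      = - (LINT \<omega>|M. D t \<omega>)" if t: "0 < t" for t
  proof -
    have t0: "0 \<le> t" using t by simp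
    note [measurable] = YT[OF t0] a[OF t0]
    let ?e = "\<lambda>\<omega>. iexp (\<xi> \<bullet> Y (?T t \<omega>) \<omega>)"
    have "integrable M (D t)"
      by (rule integrable_const_bound[OF D_bound[OF t] D_meas[OF t]])
    from integrable_mult_right[OF this, of "complex_of_real t"]
    have tD: "integrable M (\<lambda>\<omega>. complex_of_real t * D t \<omega>)" .
    have e: "integrable M ?e" by (rule integrable_const_bound[where B=1]) auto
    have eq: "exp (\<i> * complex_of_real (\<xi> \<bullet> Y (?T t \<omega>) \<omega>) + ?a t \<omega>) = ?e \<omega> - complex_of_real t * D t \<omega>" for \<omega>
      using t by (simp add: D_def exp_add field_simps)
    have X_meas: "(\<lambda>\<omega>. X x (?T t \<omega>) \<omega>) \<in> borel_measurable M"
      by (rule measurable_at_random_time[OF _ Xrc stopping_time_measurable_M[OF T[OF t0]] T_bounds(1)[OF t0]])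
        (use XF in \<open>auto simp: adapted_def intro: measurable_F_imp_M\<close>)
    note [measurable] = X_meas
    have "(LINT \<omega>|M. iexp ((stopped (X x) (exit_time (X x) K) t \<omega> - x) \<bullet> \<xi>) - 1) = (LINT \<omega>|M. ?e \<omega> - 1)"
      unfolding stopped_def stopped_time_def[symmetric]
    proof (rule integral_cong_AE)
      show "AE \<omega> in M. iexp ((X x (?T t \<omega>) \<omega> - x) \<bullet> \<xi>) - 1 = ?e \<omega> - 1"
        using XY by eventually_elim (simp add: T_bounds(1)[OF t0] inner_commute)
    qed measurable
    also have "\<dots> = (LINT \<omega>|M. ?e \<omega>) - 1" using e by (simp add: prob_space)
    \<comment> \<open>The constant 1 is rewritten as the expectation of the exponential
      martingale.\<close>
    also have "\<dots> = (LINT \<omega>|M. ?e \<omega>) - (LINT \<omega>|M. ?e \<omega> - complex_of_real t * D t \<omega>)"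
      using E[OF t0] unfolding eq by simp
    also have "\<dots> = complex_of_real t * (LINT \<omega>|M. D t \<omega>)"
      using e tD by (subst Bochner_Integration.integral_diff) auto
    finally show ?thesis using t by simp
  qed
  have limit: "AE \<omega> in M. ((\<lambda>t. D t \<omega>) \<longlongrightarrow> - \<psi> (transpose (\<Phi> x) *v \<xi>)) (at_right 0)"
  proof -
    have Y0: "AE \<omega> in M. Y 0 \<omega> = 0"
      and path: "AE \<omega> in M. (\<lambda>t. indicator {0<..} t *\<^sub>R H t \<omega>) \<in> borel_measurable borel"
      using reg by auto
    from Xc Yrc XY Y0 path fine0 H_bound show ?thesis
    proof eventually_elim
      case (elim \<omega>)
      have X0: "X x 0 \<omega> = x" using elim(3,4) by simp
      have "((\<lambda>s. X x s \<omega>) \<longlongrightarrow> x) (at_right 0)"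
        using elim(1) X0 by (auto simp: cadlag_def continuous_within)
      from topological_tendstoD[OF this open_interior K(2)]
      obtain b where b: "0 < b" "\<And>s. 0 < s \<Longrightarrow> s < b \<Longrightarrow> X x s \<omega> \<in> interior K"
        unfolding eventually_at_right_field by blast
      have "X x s \<omega> \<in> K" if "0 \<le> s" "s < b" for s
        using that b(2)[of s] X0 K(2) interior_subset[of K] by (cases "s = 0") auto
      then have "\<not> exit_time (X x) K \<omega> < ereal b" unfolding exit_time_less_iff by auto
      then have exit: "ereal b \<le> exit_time (X x) K \<omega>" by simp
      \<comment> \<open>Along a fixed path the stopping has no effect at small times, which is why
        the limit does not depend on \<open>K\<close>.\<close>
      have T_eq: "?T t \<omega> = t" if "0 < t" "t < b" for t
      proof -
        have "ereal t \<le> exit_time (X x) K \<omega>" using order_trans[OF _ exit, of "ereal t"] that by simp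
        then show ?thesis by (simp add: stopped_time_def min_def)
      qed
      let ?g = "\<lambda>s. \<psi> (transpose (H s \<omega>) *v \<xi>)" and ?l = "\<psi> (transpose (\<Phi> x) *v \<xi>)"
      \<comment> \<open>The integrand involves left limits, fine continuity the values of the path.
        They differ only on the countable set \<open>N\<close>; resetting the integrand to its limit
        there leaves the integral unchanged and makes \<open>f\<close> converge at 0.\<close>
      define N where "N = {s. 0 < s \<and> Lim (at_left s) (\<lambda>s. X x s \<omega>) \<noteq> X x s \<omega>}"
      have N: "countable N" unfolding N_def by (rule cadlag_countable_jumps[OF elim(1)])
      define f where "f s = (if s \<in> N then ?l else ?g s)" for s
      have cont: "isCont (\<lambda>A :: real ^ 'm ^ 'd. \<psi> (transpose A *v \<xi>)) (\<Phi> x)"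
        using continuous_on_compose2[OF continuous_on_\<psi> continuous_on_transpose_mult[of UNIV \<xi>] subset_UNIV]
        by (simp add: continuous_on_eq_continuous_at)
      have "((\<lambda>s. \<Phi> (X x s \<omega>)) \<longlongrightarrow> \<Phi> x) (at_right 0)"
        using elim(6) X0 by (auto simp: continuous_within)
      from isCont_tendsto_compose[OF cont this]
      have lim: "((\<lambda>s. \<psi> (transpose (\<Phi> (X x s \<omega>)) *v \<xi>)) \<longlongrightarrow> ?l) (at_right 0)" .
      have f_lim: "(f \<longlongrightarrow> ?l) (at_right 0)"
      proof (rule tendstoI)
        fix e :: real assume "0 < e"
        from tendstoD[OF lim this] eventually_at_right_less[of 0]
        show "eventually (\<lambda>s. dist (f s) ?l < e) (at_right 0)"
          by eventually_elim (use \<open>0 < e\<close> in \<open>auto simp: f_def H_def N_def\<close>)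
      qed
      have ae: "AE s in lborel. s \<notin> N"
        by (rule AE_not_in[OF countable_imp_null_set_lborel[OF N]])
      have g_meas: "(\<lambda>s. indicator {0<..t} s *\<^sub>R ?g s) \<in> borel_measurable borel" for t
        by (rule borel_measurable_exponent_integrand[where H=H, OF elim(5)])
      have [measurable]: "N \<in> sets borel" using N by (rule sets.countable[rotated]) auto
      have f_meas: "(\<lambda>s. indicator {0<..t} s *\<^sub>R f s) \<in> borel_measurable borel" for t
      proof -
        note [measurable] = g_meas[of t]
        have "(\<lambda>s. indicator {0<..t} s *\<^sub>R f s)
            = (\<lambda>s. if s \<in> N then indicator {0<..t} s *\<^sub>R ?l else indicator {0<..t} s *\<^sub>R ?g s)"
          by (auto simp: f_def)
        also have "\<dots> \<in> borel_measurable borel" by measurable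
        finally show ?thesis .
      qed
      have f_int: "eventually (\<lambda>t. integrable lborel (\<lambda>s. indicator {0<..t} s *\<^sub>R f s)) (at_right 0)"
        unfolding eventually_at_right_field
      proof (intro exI[of _ b] conjI allI impI b(1))
        fix t assume t: "0 < t" "t < b"
        have g_bound: "cmod (?g s) \<le> B" if "0 < s" "s \<le> t" for s
        proof -
          have "ereal s \<le> exit_time (X x) K \<omega>" using order_trans[OF _ exit, of "ereal s"] that t by simp
          with elim(7) that show ?thesis by (intro B(2) c') auto
        qed
        show "integrable lborel (\<lambda>s. indicator {0<..t} s *\<^sub>R f s)"
        proof (rule Bochner_Integration.integrable_bound)
          show "integrable lborel (\<lambda>s. indicator {0<..t} s * (B + cmod ?l))"
            using t by (intro integrable_mult_left integrable_real_indicator) auto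
          show "AE s in lborel. norm (indicator {0<..t} s *\<^sub>R f s) \<le> norm (indicator {0<..t} s * (B + cmod ?l))"
            using g_bound B(1) by (intro AE_I2) (auto simp: indicator_def f_def intro: add_increasing2)
        qed (use f_meas in simp)
      qed
      have a_eq: "exponent_integral H \<xi> \<omega> t = (LINT s|lborel. indicator {0<..t} s *\<^sub>R f s)" for t
        unfolding exponent_integral_def
      proof (rule integral_cong_AE)
        show "AE s in lborel. indicator {0<..t} s *\<^sub>R ?g s = indicator {0<..t} s *\<^sub>R f s"
          using ae by eventually_elim (simp add: f_def)
      qed (use f_meas g_meas in simp_all)
      have "((\<lambda>t. exponent_integral H \<xi> \<omega> t / complex_of_real t) \<longlongrightarrow> ?l) (at_right 0)"
        unfolding a_eq by (rule LINT_Ioc_average_tendsto[OF f_lim f_int])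
      from exp_increment_quotient_tendsto[OF this]
      have "((\<lambda>t. (1 - exp (exponent_integral H \<xi> \<omega> t)) / complex_of_real t) \<longlongrightarrow> - ?l) (at_right 0)" .
      moreover have "((\<lambda>t. Y t \<omega>) \<longlongrightarrow> Y 0 \<omega>) (at_right 0)"
        using elim(2) by (auto simp: continuous_within)
      then have "((\<lambda>t. iexp (\<xi> \<bullet> Y t \<omega>)) \<longlongrightarrow> iexp (\<xi> \<bullet> Y 0 \<omega>)) (at_right 0)"
        by (intro tendsto_intros)
      ultimately have "((\<lambda>t. iexp (\<xi> \<bullet> Y t \<omega>) * ((1 - exp (exponent_integral H \<xi> \<omega> t)) / complex_of_real t))
          \<longlongrightarrow> iexp (\<xi> \<bullet> Y 0 \<omega>) * - ?l) (at_right 0)"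
        by (intro tendsto_mult)
      moreover have "eventually (\<lambda>t. iexp (\<xi> \<bullet> Y t \<omega>) * ((1 - exp (exponent_integral H \<xi> \<omega> t)) / complex_of_real t) = D t \<omega>) (at_right 0)"
        unfolding eventually_at_right_field using b(1) T_eq by (intro exI[of _ b]) (simp add: D_def)
      ultimately show ?case using elim(4) by (simp add: tendsto_cong)
    qed
  qed
  have "((\<lambda>t. LINT \<omega>|M. D t \<omega>) \<longlongrightarrow> (LINT \<omega>|M. - \<psi> (transpose (\<Phi> x) *v \<xi>))) (at_right 0)"
    unfolding tendsto_at_iff_sequentially
  proof (intro allI impI)
    fix u :: "nat \<Rightarrow> real" assume u: "\<forall>i. u i \<in> {0<..} - {0}" "u \<longlonglongrightarrow> 0"
    \<comment> \<open>Boundedness of the sequence of times gives one dominating constant for all of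
      its members.\<close>
    from convergent_imp_Bseq[OF convergentI[OF u(2)]] obtain r where r: "\<And>i. u i \<le> r"
      by (auto simp: Bseq_def) (meson abs_le_D1)
    show "((\<lambda>t. LINT \<omega>|M. D t \<omega>) \<circ> u) \<longlonglongrightarrow> (LINT \<omega>|M. - \<psi> (transpose (\<Phi> x) *v \<xi>))"
      unfolding o_def
    proof (rule integral_dominated_convergence[where w="\<lambda>_. B * exp (r * B)"])
      show "D (u i) \<in> borel_measurable M" for i using u(1) by (intro D_meas) auto
      show "AE \<omega> in M. (\<lambda>i. D (u i) \<omega>) \<longlonglongrightarrow> - \<psi> (transpose (\<Phi> x) *v \<xi>)"
        using limit
      proof eventually_elim
        case (elim \<omega>)
        then show ?case using u unfolding tendsto_at_iff_sequentially o_def by blast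
      qed
      show "AE \<omega> in M. norm (D (u i) \<omega>) \<le> B * exp (r * B)" for i
      proof -
        have "B * exp (u i * B) \<le> B * exp (r * B)" using r[of i] B(1) by simp
        moreover have "AE \<omega> in M. cmod (D (u i) \<omega>) \<le> B * exp (u i * B)" using u(1) by (intro D_bound) auto
        ultimately show ?thesis by (auto elim: eventually_mono)
      qed
    qed auto
  qed
  from tendsto_minus[OF this]
  have "((\<lambda>t. - (LINT \<omega>|M. D t \<omega>)) \<longlongrightarrow> \<psi> (transpose (\<Phi> x) *v \<xi>)) (at_right 0)"
    by (simp add: prob_space)
  then show ?thesis
  proof (rule Lim_transform_eventually)
    show "eventually (\<lambda>t. - (LINT \<omega>|M. D t \<omega>) = - ((LINT \<omega>|M. iexp ((stopped (X x) (exit_time (X x) K) t \<omega> - x) \<bullet> \<xi>) - 1)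
        / complex_of_real t)) (at_right 0)"
      using eventually_at_right_less[of 0] by (rule eventually_mono) (simp only: quotient)
  qed
qed

text \<open>The description operator also requires uniqueness, for which one admissible
  neighbourhood, the closed unit ball around \<open>x\<close>, suffices.\<close>

lemma symbol_eq:
  fixes \<Phi> :: "real ^ 'd \<Rightarrow> real ^ 'm ^ 'd" and X :: "real ^ 'd \<Rightarrow> real \<Rightarrow> 'w \<Rightarrow> real ^ 'd"
  assumes "sde_solution M F Z \<Phi> x (X x)" and "finely_continuous M X \<Phi>" and "locally_bounded \<Phi>"
  shows "symbol M X x \<xi> = \<psi> (transpose (\<Phi> x) *v \<xi>)"
  unfolding symbol_def
proof (rule the_equality)
  note limit = symbol_limit[OF assms]
  show "\<forall>K. compact K \<and> x \<in> interior K \<longrightarrow>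
      ((\<lambda>t. - ((LINT \<omega>|M. iexp ((stopped (X x) (exit_time (X x) K) t \<omega> - x) \<bullet> \<xi>) - 1)
        / complex_of_real t)) \<longlongrightarrow> \<psi> (transpose (\<Phi> x) *v \<xi>)) (at_right 0)"
    using limit by blast
  fix z assume z: "\<forall>K. compact K \<and> x \<in> interior K \<longrightarrow>
      ((\<lambda>t. - ((LINT \<omega>|M. iexp ((stopped (X x) (exit_time (X x) K) t \<omega> - x) \<bullet> \<xi>) - 1)
        / complex_of_real t)) \<longlongrightarrow> z) (at_right 0)"
  have K: "compact (cball x 1)" "x \<in> interior (cball x 1)" by auto
  show "z = \<psi> (transpose (\<Phi> x) *v \<xi>)"
    by (rule tendsto_unique[OF trivial_limit_at_right_real z[rule_format, OF conjI[OF K]] limit[OF K]])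
qed

end

theorem proposition3p4:
  fixes M :: "'w measure"
    and F :: "real \<Rightarrow> 'w measure"
    and Z :: "real \<Rightarrow> 'w \<Rightarrow> real ^ 'm"
    and \<psi> :: "real ^ 'm \<Rightarrow> complex"
    and \<Phi> :: "real ^ 'd \<Rightarrow> real ^ 'm ^ 'd"
    and X :: "real ^ 'd \<Rightarrow> real \<Rightarrow> 'w \<Rightarrow> real ^ 'd"
    and x\<^sub>0 :: "real ^ 'd"
  assumes "stochastic_basis M F"
    and "levy_process M F Z"
    and "characteristic_exponent M Z \<psi>"
    and "admissible M F Z \<Phi>"
    and "\<And>x. sde_solution M F Z \<Phi> x (X x)"
    and "finely_continuous M X \<Phi>"
    and "locally_bounded \<Phi>"
    and "surj (\<lambda>\<xi>. transpose (\<Phi> x\<^sub>0) *v \<xi>)"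
    and "\<not> bounded (range \<psi>)"
    and "\<not> bounded (range \<Phi>)"
    and "beta_inf_unif (symbol M X) < \<infinity>"
  shows "beta_inf_unif1 (symbol M X) = beta_inf_unif (symbol M X)
       \<and> beta_inf_unif (symbol M X) = beta_1 \<psi>"
proof -
  interpret levy_basis M F Z \<psi> by (rule levy_basis.intro) fact+
  have q: "symbol M X x \<xi> = \<psi> (transpose (\<Phi> x) *v \<xi>)" for x \<xi>
    by (rule symbol_eq[where \<Phi>=\<Phi>, OF assms(5-7)])
  have "beta_1 \<psi> \<le> beta_inf_unif1 (symbol M X)"
    by (rule beta_1_le_beta_inf_unif1[where q="symbol M X" and \<Phi>=\<Phi> and \<psi>=\<psi>, OF q assms(8)])
  moreover have "beta_inf_unif1 (symbol M X) \<le> beta_inf_unif (symbol M X)"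
    by (rule beta_inf_unif1_le)
  moreover have "beta_inf_unif (symbol M X) \<le> beta_1 \<psi>"
    by (rule beta_inf_unif_le_beta_1[where q="symbol M X" and \<Phi>=\<Phi> and \<psi>=\<psi>, OF q continuous_on_\<psi> cmod_\<psi>_diff_le assms(11)])
  ultimately show ?thesis by (meson antisym order_trans)
qed

end
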